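(* Let $S$ be a semitopological semigroup, let $E$ be a Banach space, let $\pi$ be a JdLG-admissible representation of $S$ on $E$, and let $\pi_r$ be the restriction of $\pi$ to $E_r$. Then $\pi_r$ is weakly equivalent to a unitary representation $U$ of $S$ on a Hilbert space $\mathcal{H}$. If $E$ is a Hilbert space, then $\pi_r$ is equivalent to such a unitary representation (i.e. to a unitary representation of $S$ on a Hilbert space).
   Context: Banach and Hilbert spaces are complex; $E'$ is the dual of $E$. $\mathcal{L}(E)$ is the space of bounded linear operators on $E$; for sets of operators, "weakly" and the closure $\operatorname{cl}_\sigma$ refer to the weak operator topology. A semitopological semigroup is a semigroup with a Hausdorff topology for which multiplication is separately continuous. A representation $\pi$ of $S$ on $E$ is a semigroup homomorphism $\pi:S\to\mathcal{L}(E)$, $s\mapsto\pi_s$, continuous for the weak operator topology (with $\pi_e=\mathrm{Id}$ if $S$ has an identity $e$); it is unitary if $E$ is a Hilbert space and each $\pi_s$ is unitary. It is JdLG-admissible if $\pi(S)$ is relatively compact in the weak operator topology and $\mathscr{S}:=\operatorname{cl}_\sigma(\pi(S))$ contains a unique minimal idempotent (an idempotent is minimal if it lies in the smallest two-sided ideal of $\mathscr{S}$). Equivalently, $\mathscr{S}$ is weakly compact and $$E_r=\{\xi\in E:\forall u\in\mathscr{S}\ \exists v\in\mathscr{S},\ vu\xi=\xi\},\qquad E_{\mathrm{aws}}=\{\xi\in E:u\xi=0\text{ for some }u\in\mathscr{S}\}$$ are closed $\mathscr{S}$-invariant linear subspaces with $E=E_r\oplus E_{\mathrm{aws}}$. For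 representations $\pi_1,\pi_2$ of $S$ on $E_1,E_2$: $\pi_1$ is weakly contained in $\pi_2$ if for all $\xi\in E_1$, $f'\in E_1'$, $\epsilon>0$ there exist $\eta_1,\dots,\eta_k\in E_2$ and $h_1',\dots,h_k'\in E_2'$ with $\sup_{s\in S}\left|f'(\pi_{1,s}\xi)-\sum_{j=1}^k h_j'(\pi_{2,s}\eta_j)\right|<\epsilon$. They are weakly equivalent if each is weakly contained in the other, and equivalent if there is a bounded linear invertible operator $T:E_1\to E_2$ with $\pi_{2,s}T=T\pi_{1,s}$ for all $s\in S$. *)

theory Defs
  imports "HOL-Analysis.Analysis" "HOL-Algebra.Module"
begin

section \<open>Complex Banach and Hilbert spaces with explicit carriers\<close>

definition complex_field :: "complex ring" where
  "complex_field = \<lparr>carrier = UNIV, mult = (*), one = 1, zero = 0, add = (+)\<rparr>"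

text \<open>A complex vector space is a module over the field of complex numbers; the fields
  \<open>mult\<close> and \<open>one\<close> that the library's module record inherits from rings play no role. Carriers are
  explicit because closed subspaces have to be spaces in their own right and because the Hilbert
  space of the theorem is existentially quantified.\<close>

record 'a normed_module = "(complex, 'a) module" +
  vnorm :: "'a \<Rightarrow> real"

text \<open>The value 0 off the carrier is needed because the locale \<open>Metric_space\<close> demands nonnegativity
  and symmetry for all elements of the type.\<close>

definition vdist :: "'a normed_module \<Rightarrow> 'a \<Rightarrow> 'a \<Rightarrow> real" where
  "vdist X x y = (if x \<in> carrier X \<and> y \<in> carrier X then vnorm X (x \<ominus>\<^bsub>X\<^esub> y) else 0)"

locale complex_banach_space = module complex_field X for X :: "'a normed_module" (structure) +
  assumes vnorm_eq_zero_iff: "x \<in> carrier X \<Longrightarrow> vnorm X x = 0 \<longleftrightarrow> x = \<zero>"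
    and vnorm_triangle: "x \<in> carrier X \<Longrightarrow> y \<in> carrier X \<Longrightarrow> vnorm X (x \<oplus> y) \<le> vnorm X x + vnorm X y"
    and vnorm_smult: "x \<in> carrier X \<Longrightarrow> vnorm X (c \<odot> x) = cmod c * vnorm X x"
    and complete: "Metric_space.mcomplete (carrier X) (vdist X)"

text \<open>The inner product is linear in the first argument. The last axiom says that it induces the
  norm, and it contains positive definiteness.\<close>

locale complex_hilbert_space = complex_banach_space X for X :: "'a normed_module" (structure) +
  fixes ip :: "'a \<Rightarrow> 'a \<Rightarrow> complex"
  assumes ip_add: "x \<in> carrier X \<Longrightarrow> y \<in> carrier X \<Longrightarrow> z \<in> carrier X \<Longrightarrow>
      ip (x \<oplus> y) z = ip x z + ip y z"
    and ip_smult: "x \<in> carrier X \<Longrightarrow> y \<in> carrier X \<Longrightarrow> ip (c \<odot> x) y = c * ip x y"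
    and ip_cnj: "x \<in> carrier X \<Longrightarrow> y \<in> carrier X \<Longrightarrow> ip y x = cnj (ip x y)"
    and ip_self: "x \<in> carrier X \<Longrightarrow> ip x x = complex_of_real ((vnorm X x)\<^sup>2)"

section \<open>Bounded operators and the weak operator topology\<close>

text \<open>Maps are extensional, so that equality of operators is equality of functions; accordingly
  operators are multiplied with \<^const>\<open>compose\<close>.\<close>

definition bounded_maps :: "'a normed_module \<Rightarrow> 'b normed_module \<Rightarrow> ('a \<Rightarrow> 'b) set" where
  "bounded_maps X Y = {T \<in> carrier X \<rightarrow>\<^sub>E carrier Y.
     (\<forall>x\<in>carrier X. \<forall>y\<in>carrier X. T (x \<oplus>\<^bsub>X\<^esub> y) = T x \<oplus>\<^bsub>Y\<^esub> T y) \<and>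
     (\<forall>c. \<forall>x\<in>carrier X. T (c \<odot>\<^bsub>X\<^esub> x) = c \<odot>\<^bsub>Y\<^esub> T x) \<and>
     (\<exists>C. \<forall>x\<in>carrier X. vnorm Y (T x) \<le> C * vnorm X x)}"

definition complex_space :: "complex normed_module" where
  "complex_space = \<lparr>carrier = UNIV, mult = (*), one = 1, zero = 0, add = (+), smult = (*), vnorm = cmod\<rparr>"

definition dual :: "'a normed_module \<Rightarrow> ('a \<Rightarrow> complex) set" where
  "dual X = bounded_maps X complex_space"

definition weak_operator_topology :: "'a normed_module \<Rightarrow> ('a \<Rightarrow> 'a) topology" where
  "weak_operator_topology X = topology_generated_by
     {{T \<in> bounded_maps X X. f (T x) \<in> U} | x f U. x \<in> carrier X \<and> f \<in> dual X \<and> open U}"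

section \<open>Representations of semitopological semigroups\<close>

class semitopological_semigroup = semigroup_mult + t2_space +
  assumes open_vimage_mult_left: "open U \<Longrightarrow> open ((\<lambda>x. a * x) -` U)"
    and open_vimage_mult_right: "open U \<Longrightarrow> open ((\<lambda>x. x * a) -` U)"

definition representation ::
    "'a normed_module \<Rightarrow> ('s::semitopological_semigroup \<Rightarrow> 'a \<Rightarrow> 'a) \<Rightarrow> bool" where
  "representation X \<pi> \<longleftrightarrow>
     (\<forall>s. \<pi> s \<in> bounded_maps X X) \<and>
     (\<forall>s t. \<pi> (s * t) = compose (carrier X) (\<pi> s) (\<pi> t)) \<and>
     (\<forall>e. (\<forall>s. e * s = s \<and> s * e = s) \<longrightarrow> \<pi> e = restrict id (carrier X)) \<and>
     continuous_map euclidean (weak_operator_topology X) \<pi>"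

definition unitary_representation ::
    "'a normed_module \<Rightarrow> ('a \<Rightarrow> 'a \<Rightarrow> complex) \<Rightarrow> ('s::semitopological_semigroup \<Rightarrow> 'a \<Rightarrow> 'a) \<Rightarrow> bool" where
  "unitary_representation H ip U \<longleftrightarrow> complex_hilbert_space H ip \<and> representation H U \<and>
     (\<forall>s. U s ` carrier H = carrier H \<and>
          (\<forall>x\<in>carrier H. \<forall>y\<in>carrier H. ip (U s x) (U s y) = ip x y))"

section \<open>JdLG-admissibility\<close>

definition op_closure :: "'a normed_module \<Rightarrow> ('s \<Rightarrow> 'a \<Rightarrow> 'a) \<Rightarrow> ('a \<Rightarrow> 'a) set" where
  "op_closure X \<pi> = weak_operator_topology X closure_of range \<pi>"

definition two_sided_ideal :: "'a normed_module \<Rightarrow> ('a \<Rightarrow> 'a) set \<Rightarrow> ('a \<Rightarrow> 'a) set \<Rightarrow> bool" where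
  "two_sided_ideal X \<S> I \<longleftrightarrow> I \<noteq> {} \<and> I \<subseteq> \<S> \<and>
     (\<forall>u\<in>\<S>. \<forall>v\<in>I. compose (carrier X) u v \<in> I \<and> compose (carrier X) v u \<in> I)"

definition minimal_idempotent :: "'a normed_module \<Rightarrow> ('a \<Rightarrow> 'a) set \<Rightarrow> ('a \<Rightarrow> 'a) \<Rightarrow> bool" where
  "minimal_idempotent X \<S> p \<longleftrightarrow> compose (carrier X) p p = p \<and>
     (\<exists>K. two_sided_ideal X \<S> K \<and> (\<forall>I. two_sided_ideal X \<S> I \<longrightarrow> K \<subseteq> I) \<and> p \<in> K)"

definition JdLG_admissible ::
    "'a normed_module \<Rightarrow> ('s::semitopological_semigroup \<Rightarrow> 'a \<Rightarrow> 'a) \<Rightarrow> bool" where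
  "JdLG_admissible X \<pi> \<longleftrightarrow> representation X \<pi> \<and>
     compactin (weak_operator_topology X) (op_closure X \<pi>) \<and>
     (\<exists>!p. minimal_idempotent X (op_closure X \<pi>) p)"

definition reversible_part :: "'a normed_module \<Rightarrow> ('s \<Rightarrow> 'a \<Rightarrow> 'a) \<Rightarrow> 'a set" where
  "reversible_part X \<pi> =
     {\<xi> \<in> carrier X. \<forall>u\<in>op_closure X \<pi>. \<exists>v\<in>op_closure X \<pi>. v (u \<xi>) = \<xi>}"

definition reversible_space :: "'a normed_module \<Rightarrow> ('s \<Rightarrow> 'a \<Rightarrow> 'a) \<Rightarrow> 'a normed_module" where
  "reversible_space X \<pi> = X\<lparr>carrier := reversible_part X \<pi>\<rparr>"

definition reversible_rep :: "'a normed_module \<Rightarrow> ('s \<Rightarrow> 'a \<Rightarrow> 'a) \<Rightarrow> 's \<Rightarrow> 'a \<Rightarrow> 'a" where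
  "reversible_rep X \<pi> s = restrict (\<pi> s) (reversible_part X \<pi>)"

section \<open>Weak containment and equivalence\<close>

text \<open>The conjunct \<^const>\<open>bdd_above\<close> says that the supremum is finite; without it the real-valued
  \<open>SUP\<close> would be unspecified.\<close>

definition weakly_contained ::
    "'a normed_module \<Rightarrow> ('s \<Rightarrow> 'a \<Rightarrow> 'a) \<Rightarrow> 'b normed_module \<Rightarrow> ('s \<Rightarrow> 'b \<Rightarrow> 'b) \<Rightarrow> bool" where
  "weakly_contained X\<^sub>1 \<pi>\<^sub>1 X\<^sub>2 \<pi>\<^sub>2 \<longleftrightarrow>
     (\<forall>\<xi>\<in>carrier X\<^sub>1. \<forall>f\<in>dual X\<^sub>1. \<forall>\<epsilon>>0. \<exists>(k::nat) \<eta> h.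
        (\<forall>j<k. \<eta> j \<in> carrier X\<^sub>2 \<and> h j \<in> dual X\<^sub>2) \<and>
        bdd_above (range (\<lambda>s. cmod (f (\<pi>\<^sub>1 s \<xi>) - (\<Sum>j<k. h j (\<pi>\<^sub>2 s (\<eta> j)))))) \<and>
        (SUP s. cmod (f (\<pi>\<^sub>1 s \<xi>) - (\<Sum>j<k. h j (\<pi>\<^sub>2 s (\<eta> j))))) < \<epsilon>)"

definition weakly_equivalent ::
    "'a normed_module \<Rightarrow> ('s \<Rightarrow> 'a \<Rightarrow> 'a) \<Rightarrow> 'b normed_module \<Rightarrow> ('s \<Rightarrow> 'b \<Rightarrow> 'b) \<Rightarrow> bool" where
  "weakly_equivalent X\<^sub>1 \<pi>\<^sub>1 X\<^sub>2 \<pi>\<^sub>2 \<longleftrightarrow>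
     weakly_contained X\<^sub>1 \<pi>\<^sub>1 X\<^sub>2 \<pi>\<^sub>2 \<and> weakly_contained X\<^sub>2 \<pi>\<^sub>2 X\<^sub>1 \<pi>\<^sub>1"

definition equivalent_rep ::
    "'a normed_module \<Rightarrow> ('s \<Rightarrow> 'a \<Rightarrow> 'a) \<Rightarrow> 'b normed_module \<Rightarrow> ('s \<Rightarrow> 'b \<Rightarrow> 'b) \<Rightarrow> bool" where
  "equivalent_rep X\<^sub>1 \<pi>\<^sub>1 X\<^sub>2 \<pi>\<^sub>2 \<longleftrightarrow>
     (\<exists>T\<in>bounded_maps X\<^sub>1 X\<^sub>2. \<exists>T'\<in>bounded_maps X\<^sub>2 X\<^sub>1.
        (\<forall>x\<in>carrier X\<^sub>1. T' (T x) = x) \<and> (\<forall>y\<in>carrier X\<^sub>2. T (T' y) = y) \<and>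
        (\<forall>s. \<forall>x\<in>carrier X\<^sub>1. \<pi>\<^sub>2 s (T x) = T (\<pi>\<^sub>1 s x)))"

end

theory Submission
  imports Defs
begin

text \<open>Let \<open>p\<close> be the unique minimal idempotent of the weakly compact semigroup \<open>\<S> = cl \<pi>(S)\<close>. Then
  the smallest ideal \<open>K = p \<S>\<close> is a weakly compact group with identity \<open>p\<close>, \<open>p\<close> is central, and the
  reversible part of the space is the range of \<open>p\<close>, on which \<open>\<S>\<close> acts through \<open>K\<close>. Neither Ellis's
  theorem nor Haar measure is needed: a Baire category argument on \<open>K\<close> shows that orbits are bounded
  and then norm totally bounded, so all coefficients of \<open>K\<close> are almost periodic functions on the
  abstract group \<open>K\<close>, which carry an invariant mean by Maak's elementary theory.

  On a Hilbert space, averaging the inner product over \<open>K\<close> gives an equivalent invariant inner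
  product on the reversible part. On a Banach space, let \<open>K\<close> act by right translation on the span of
  the coefficients of \<open>\<pi>\<^sub>r\<close>, with the inner product given by the mean, and let \<open>U\<close> be the
  action on the completion. A functional applied to the vector given by the coefficient of \<open>(f, x)\<close>
  is bounded and linear in \<open>x\<close>, so coefficients of \<open>U\<close> are limits of coefficients of \<open>\<pi>\<^sub>r\<close>;
  conversely, a coefficient of \<open>\<pi>\<^sub>r\<close> is the uniform limit of its convolutions with an
  approximate identity, and these are coefficients of \<open>U\<close>.\<close>

text \<open>Multiplication in the weak operator topology is only separately continuous, so nothing
  uniform about \<open>K\<close> can be read off from its topology. Uniformity comes from norms:
  norm balls are weakly closed, which lets Baire's theorem act on weakly compact sets, and the
  estimates it yields survive translation on both sides because \<open>K\<close> is uniformly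
  bounded. The Hilbert space of the Banach case has to live on a type built from the semigroup
  alone. Coefficients are therefore stored as functions on \<open>S\<close>, their values on
  \<open>K\<close> are recovered from the weak density of \<pi>(S) in \<S>, and the points of the
  completion are functionals on these functions instead of classes of sequences. The approximate
  identity \<beta> need not be a coefficient, hence need not give a vector of that space. Only the
  functional that integrates coefficients against \<beta> is used; Cauchy--Schwarz in the larger
  space of all almost periodic functions bounds it.\<close>

lemma complex_field_simps [simp]:
  "carrier complex_field = UNIV" "add complex_field = (+)" "mult complex_field = (*)"
  "one complex_field = 1" "zero complex_field = 0"
  by (simp_all add: complex_field_def)

lemma cring_complex_field: "cring complex_field"
proof (intro cringI abelian_groupI comm_monoidI)
  fix x :: complex
  show "\<exists>y\<in>carrier complex_field. y \<oplus>\<^bsub>complex_field\<^esub> x = \<zero>\<^bsub>complex_field\<^esub>"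
    by (auto intro!: exI[of _ "- x"])
qed (auto simp: algebra_simps)

lemma complex_space_simps [simp]:
  "carrier complex_space = UNIV" "add complex_space = (+)" "zero complex_space = 0"
  "smult complex_space = (*)" "vnorm complex_space = cmod"
  by (simp_all add: complex_space_def)

lemma dual_iff:
  "f \<in> dual X \<longleftrightarrow> f \<in> extensional (carrier X) \<and>
     (\<forall>x\<in>carrier X. \<forall>y\<in>carrier X. f (x \<oplus>\<^bsub>X\<^esub> y) = f x + f y) \<and>
     (\<forall>c. \<forall>x\<in>carrier X. f (c \<odot>\<^bsub>X\<^esub> x) = c * f x) \<and>
     (\<exists>C. \<forall>x\<in>carrier X. cmod (f x) \<le> C * vnorm X x)"
  by (auto simp: dual_def bounded_maps_def PiE_def)

section \<open>The Hahn--Banach theorem\<close>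

text \<open>Completeness is left out because the Hilbert spaces constructed below are shown to be
  complete only after the calculus of norms is available in them.\<close>

locale complex_normed_space = module complex_field X for X :: "'a normed_module" (structure) +
  assumes vnorm_eq_zero_iff: "x \<in> carrier X \<Longrightarrow> vnorm X x = 0 \<longleftrightarrow> x = \<zero>"
    and vnorm_triangle: "x \<in> carrier X \<Longrightarrow> y \<in> carrier X \<Longrightarrow> vnorm X (x \<oplus> y) \<le> vnorm X x + vnorm X y"
    and vnorm_smult: "x \<in> carrier X \<Longrightarrow> vnorm X (c \<odot> x) = cmod c * vnorm X x"
begin

section \<open>Arithmetic of vectors and norms\<close>

lemma smult_in [simp, intro]: "x \<in> carrier X \<Longrightarrow> c \<odot> x \<in> carrier X"
  using smult_closed[of c x] by simp

lemma smult_add_left: "x \<in> carrier X \<Longrightarrow> (a + b) \<odot> x = a \<odot> x \<oplus> b \<odot> x"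
  using smult_l_distr[of a b x] by simp

lemma smult_add_right: "x \<in> carrier X \<Longrightarrow> y \<in> carrier X \<Longrightarrow> c \<odot> (x \<oplus> y) = c \<odot> x \<oplus> c \<odot> y"
  using smult_r_distr[of c x y] by simp

lemma smult_mult: "x \<in> carrier X \<Longrightarrow> a \<odot> (b \<odot> x) = (a * b) \<odot> x"
  using smult_assoc1[of a b x] by simp

lemma smult_1 [simp]: "x \<in> carrier X \<Longrightarrow> 1 \<odot> x = x"
  using smult_one[of x] by simp

lemma smult_0 [simp]: "x \<in> carrier X \<Longrightarrow> 0 \<odot> x = \<zero>"
  using smult_l_null[of x] by simp

lemma smult_zero [simp]: "c \<odot> \<zero> = \<zero>"
  using smult_r_null[of c] by simp

lemma minus_smult: "x \<in> carrier X \<Longrightarrow> \<ominus> x = (-1) \<odot> x"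
proof -
  assume x: "x \<in> carrier X"
  have "x \<oplus> (-1) \<odot> x = (1 + (-1)) \<odot> x"
    using x smult_add_left[of x 1 "-1"] by simp
  then have "x \<oplus> (-1) \<odot> x = \<zero>" using x by simp
  then show ?thesis using x by (metis M.a_comm M.minus_equality smult_in)
qed

lemma diff_smult: "x \<in> carrier X \<Longrightarrow> y \<in> carrier X \<Longrightarrow> x \<ominus> y = x \<oplus> (-1) \<odot> y"
  by (simp add: a_minus_def minus_smult)

lemma smult_diff: "x \<in> carrier X \<Longrightarrow> y \<in> carrier X \<Longrightarrow> c \<odot> (x \<ominus> y) = c \<odot> x \<ominus> c \<odot> y"
  by (simp add: diff_smult smult_add_right smult_mult)

lemma diff_self [simp]: "x \<in> carrier X \<Longrightarrow> x \<ominus> x = \<zero>"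
  by (simp add: a_minus_def M.r_neg)

lemma diff_zero [simp]: "x \<in> carrier X \<Longrightarrow> x \<ominus> \<zero> = x"
  by (simp add: a_minus_def)

lemma diff_in [simp, intro]: "x \<in> carrier X \<Longrightarrow> y \<in> carrier X \<Longrightarrow> x \<ominus> y \<in> carrier X"
  by (simp add: a_minus_def)

lemma diff_add_cancel: "x \<in> carrier X \<Longrightarrow> y \<in> carrier X \<Longrightarrow> (x \<ominus> y) \<oplus> y = x"
  by (simp add: a_minus_def M.a_assoc M.l_neg)

lemma diff_diff_add: "x \<in> carrier X \<Longrightarrow> y \<in> carrier X \<Longrightarrow> z \<in> carrier X \<Longrightarrow>
    (x \<ominus> y) \<oplus> (y \<ominus> z) = x \<ominus> z"
  by (metis M.a_assoc M.minus_closed a_minus_def diff_add_cancel M.a_inv_closed)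

lemma add_diff_add: "x \<in> carrier X \<Longrightarrow> y \<in> carrier X \<Longrightarrow> u \<in> carrier X \<Longrightarrow> v \<in> carrier X \<Longrightarrow>
    (x \<oplus> y) \<ominus> (u \<oplus> v) = (x \<ominus> u) \<oplus> (y \<ominus> v)"
  by (simp add: a_minus_def M.minus_add M.add.m_ac)

lemma diff_eq_zero_iff: "x \<in> carrier X \<Longrightarrow> y \<in> carrier X \<Longrightarrow> x \<ominus> y = \<zero> \<longleftrightarrow> x = y"
  by (metis diff_add_cancel M.l_zero diff_self)

lemma vnorm_zero [simp]: "vnorm X \<zero> = 0"
  by (simp add: vnorm_eq_zero_iff)

lemma vnorm_minus: "x \<in> carrier X \<Longrightarrow> vnorm X (\<ominus> x) = vnorm X x"
  by (simp add: minus_smult vnorm_smult)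

lemma vnorm_nonneg [simp]: "x \<in> carrier X \<Longrightarrow> 0 \<le> vnorm X x"
  using vnorm_triangle[of x "\<ominus> x"] by (simp add: M.r_neg vnorm_minus)

lemma vnorm_diff_commute: "x \<in> carrier X \<Longrightarrow> y \<in> carrier X \<Longrightarrow> vnorm X (x \<ominus> y) = vnorm X (y \<ominus> x)"
  by (metis M.minus_add M.minus_minus M.a_comm M.a_inv_closed a_minus_def vnorm_minus diff_in)

lemma vnorm_diff_triangle: "x \<in> carrier X \<Longrightarrow> y \<in> carrier X \<Longrightarrow> z \<in> carrier X \<Longrightarrow>
    vnorm X (x \<ominus> z) \<le> vnorm X (x \<ominus> y) + vnorm X (y \<ominus> z)"
  by (metis diff_diff_add diff_in vnorm_triangle)

lemma vnorm_le_diff: "x \<in> carrier X \<Longrightarrow> y \<in> carrier X \<Longrightarrow> vnorm X x \<le> vnorm X (x \<ominus> y) + vnorm X y"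
  by (metis diff_add_cancel diff_in vnorm_triangle)

lemma Metric_space_vdist: "Metric_space (carrier X) (vdist X)"
proof
  fix x y z
  show "0 \<le> vdist X x y" by (simp add: vdist_def)
  show "vdist X x y = vdist X y x" by (simp add: vdist_def vnorm_diff_commute)
  show "vdist X x y = 0 \<longleftrightarrow> x = y" if "x \<in> carrier X" "y \<in> carrier X"
    using that by (simp add: vdist_def vnorm_eq_zero_iff diff_eq_zero_iff)
  show "vdist X x z \<le> vdist X x y + vdist X y z"
    if "x \<in> carrier X" "y \<in> carrier X" "z \<in> carrier X"
    using that by (simp add: vdist_def vnorm_diff_triangle)
qed

text \<open>The later completeness proofs work with norms of differences. These agree with
  \<open>vdist\<close> only on the carrier, so the condition on the range is split off before the
  metric notions are unfolded.\<close>

lemma mcomplete_iff: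
  "Metric_space.mcomplete (carrier X) (vdist X) \<longleftrightarrow> (\<forall>\<sigma> :: nat \<Rightarrow> 'a. range \<sigma> \<subseteq> carrier X \<longrightarrow>
     (\<forall>\<epsilon>>0. \<exists>N. \<forall>m\<ge>N. \<forall>n\<ge>N. vnorm X (\<sigma> m \<ominus> \<sigma> n) < \<epsilon>) \<longrightarrow>
     (\<exists>x\<in>carrier X. \<forall>\<epsilon>>0. \<exists>N. \<forall>n\<ge>N. vnorm X (\<sigma> n \<ominus> x) < \<epsilon>))"
proof -
  interpret MS: Metric_space "carrier X" "vdist X" by (rule Metric_space_vdist)
  have 1: "MS.MCauchy \<sigma> \<longleftrightarrow> range \<sigma> \<subseteq> carrier X \<and>
      (\<forall>\<epsilon>>0. \<exists>N. \<forall>m\<ge>N. \<forall>n\<ge>N. vnorm X (\<sigma> m \<ominus> \<sigma> n) < \<epsilon>)" for \<sigma>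
  proof (cases "range \<sigma> \<subseteq> carrier X")
    case True
    then have "vdist X (\<sigma> m) (\<sigma> n) = vnorm X (\<sigma> m \<ominus> \<sigma> n)" for m n by (auto simp: vdist_def)
    moreover have "(\<forall>n n'. N \<le> n \<longrightarrow> N \<le> n' \<longrightarrow> vnorm X (\<sigma> n \<ominus> \<sigma> n') < \<epsilon>) \<longleftrightarrow>
        (\<forall>m\<ge>N. \<forall>n\<ge>N. vnorm X (\<sigma> m \<ominus> \<sigma> n) < \<epsilon>)" for N \<epsilon>
      by blast
    ultimately show ?thesis using True unfolding MS.MCauchy_def by simp
  qed (simp add: MS.MCauchy_def)
  have 2: "limitin MS.mtopology \<sigma> x sequentially \<longleftrightarrow> x \<in> carrier X \<and>
      (\<forall>\<epsilon>>0. \<exists>N. \<forall>n\<ge>N. vnorm X (\<sigma> n \<ominus> x) < \<epsilon>)" if "range \<sigma> \<subseteq> carrier X" for \<sigma> x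
  proof (cases "x \<in> carrier X")
    case True
    then have "vdist X (\<sigma> n) x = vnorm X (\<sigma> n \<ominus> x)" for n using that by (auto simp: vdist_def)
    moreover have "\<sigma> n \<in> carrier X" for n using that by blast
    ultimately show ?thesis using True unfolding MS.limit_metric_sequentially by simp
  qed (simp add: MS.limit_metric_sequentially)
  have 3: "(\<exists>x. limitin MS.mtopology \<sigma> x sequentially) \<longleftrightarrow>
      (\<exists>x\<in>carrier X. \<forall>\<epsilon>>0. \<exists>N. \<forall>n\<ge>N. vnorm X (\<sigma> n \<ominus> x) < \<epsilon>)" if "range \<sigma> \<subseteq> carrier X" for \<sigma>
    unfolding 2[OF that] by blast
  show ?thesis unfolding MS.mcomplete_def 1 imp_conjL by (simp only: 3 cong: imp_cong)
qed

section \<open>Sublinear functionals and their minimal elements\<close>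

definition sublinear :: "('a \<Rightarrow> real) \<Rightarrow> bool" where
  "sublinear q \<longleftrightarrow> (\<forall>x\<in>carrier X. \<forall>y\<in>carrier X. q (x \<oplus> y) \<le> q x + q y) \<and>
     (\<forall>x\<in>carrier X. \<forall>t>0. q (complex_of_real t \<odot> x) \<le> t * q x)"

lemma sublinear_add: "sublinear q \<Longrightarrow> x \<in> carrier X \<Longrightarrow> y \<in> carrier X \<Longrightarrow> q (x \<oplus> y) \<le> q x + q y"
  by (simp add: sublinear_def)

text \<open>Scaling back by \<open>1 / t\<close> supplies the converse inequality; the definition
  asks only for the half that has to be checked in each construction.\<close>

lemma sublinear_scale:
  assumes "sublinear q" "x \<in> carrier X" "t > 0"
  shows "q (complex_of_real t \<odot> x) = t * q x"
proof (rule antisym)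
  show "q (complex_of_real t \<odot> x) \<le> t * q x" using assms by (simp add: sublinear_def)
  have "q (complex_of_real (1/t) \<odot> (complex_of_real t \<odot> x)) \<le> (1/t) * q (complex_of_real t \<odot> x)"
    using assms(1,3) smult_in[OF assms(2), of "complex_of_real t"]
    unfolding sublinear_def by (metis zero_less_divide_1_iff)
  moreover have "complex_of_real (1/t) \<odot> (complex_of_real t \<odot> x) = x"
    using assms by (simp add: smult_mult)
  ultimately show "t * q x \<le> q (complex_of_real t \<odot> x)"
    using assms by (simp add: field_simps)
qed

lemma sublinear_zero: "sublinear q \<Longrightarrow> q \<zero> = 0"
  using sublinear_scale[of q \<zero> 2] by simp

lemma sublinear_ge: "sublinear q \<Longrightarrow> x \<in> carrier X \<Longrightarrow> - q (\<ominus> x) \<le> q x"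
  using sublinear_add[of q x "\<ominus> x"] sublinear_zero[of q] by (simp add: M.r_neg)

text \<open>A linear functional below \<open>shift q y\<close> is at most \<open>- q y\<close> at
  \<open>\<ominus> y\<close> (take \<open>t = 1\<close>) and therefore equals \<open>q y\<close> at
  \<open>y\<close>. The same construction gives both the additivity of minimal functionals and the
  attainment of \<open>q\<close> at a prescribed vector.\<close>

definition shift :: "('a \<Rightarrow> real) \<Rightarrow> 'a \<Rightarrow> 'a \<Rightarrow> real" where
  "shift q y x = (INF t\<in>{0..}. q (x \<oplus> complex_of_real t \<odot> y) - t * q y)"

lemma shift_le:
  assumes "sublinear q" "x \<in> carrier X" "y \<in> carrier X" "t \<ge> 0"
  shows "shift q y x \<le> q (x \<oplus> complex_of_real t \<odot> y) - t * q y"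
  unfolding shift_def
proof (rule cINF_lower)
  show "t \<in> {0..}" using assms by simp
  \<comment> \<open>Subadditivity for \<open>t y = (x + t y) - x\<close> gives a lower bound
    independent of \<open>t\<close>, so that the real infimum is meaningful.\<close>
  have "- q (\<ominus> x) \<le> q (x \<oplus> complex_of_real t \<odot> y) - t * q y" if "t \<ge> 0" for t
  proof -
    have "t * q y = q (complex_of_real t \<odot> y)"
      using assms that by (cases "t = 0") (simp_all add: sublinear_scale sublinear_zero)
    also have "complex_of_real t \<odot> y = (x \<oplus> complex_of_real t \<odot> y) \<oplus> \<ominus> x"
      using assms by (metis M.a_comm M.a_inv_closed M.add.m_closed M.r_neg1 smult_in)
    also have "q \<dots> \<le> q (x \<oplus> complex_of_real t \<odot> y) + q (\<ominus> x)"
      using assms by (intro sublinear_add) auto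
    finally show ?thesis by linarith
  qed
  then show "bdd_below ((\<lambda>t. q (x \<oplus> complex_of_real t \<odot> y) - t * q y) ` {0..})"
    by (intro bdd_belowI2) auto
qed

lemma shift_le_self:
  assumes "sublinear q" "x \<in> carrier X" "y \<in> carrier X"
  shows "shift q y x \<le> q x"
  using shift_le[OF assms, of 0] assms by simp

lemma le_shift:
  assumes "\<And>t. t \<ge> 0 \<Longrightarrow> c \<le> q (x \<oplus> complex_of_real t \<odot> y) - t * q y"
  shows "c \<le> shift q y x"
  unfolding shift_def by (rule cINF_greatest) (use assms in auto)

text \<open>The parameters \<open>s\<close> and \<open>t\<close> chosen for two summands combine to
  \<open>s + t\<close> for their sum, and scaling the vector by \<open>s\<close> replaces the
  parameter \<open>t\<close> by \<open>s * t\<close>.\<close>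

lemma sublinear_shift:
  assumes q: "sublinear q" and y: "y \<in> carrier X"
  shows "sublinear (shift q y)"
  unfolding sublinear_def
proof (intro conjI ballI allI impI)
  fix x z assume x: "x \<in> carrier X" and z: "z \<in> carrier X"
  let ?B = "\<lambda>x t. q (x \<oplus> complex_of_real t \<odot> y) - t * q y"
  have *: "shift q y (x \<oplus> z) \<le> ?B x s + ?B z t" if "s \<ge> 0" "t \<ge> 0" for s t
  proof -
    have "shift q y (x \<oplus> z) \<le> ?B (x \<oplus> z) (s + t)"
      using shift_le[of q "x \<oplus> z" y "s + t"] x z y q that by simp
    also have "(x \<oplus> z) \<oplus> complex_of_real (s + t) \<odot> y
        = (x \<oplus> complex_of_real s \<odot> y) \<oplus> (z \<oplus> complex_of_real t \<odot> y)"
      using x y z by (simp add: smult_add_left M.add.m_ac)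
    also have "q \<dots> \<le> q (x \<oplus> complex_of_real s \<odot> y) + q (z \<oplus> complex_of_real t \<odot> y)"
      using x y z q by (intro sublinear_add) auto
    finally show ?thesis by (simp add: algebra_simps)
  qed
  have "shift q y (x \<oplus> z) - ?B x s \<le> shift q y z" if "s \<ge> 0" for s
    using *[OF that] by (intro le_shift) (simp add: algebra_simps)
  then have "shift q y (x \<oplus> z) - shift q y z \<le> shift q y x"
    by (intro le_shift) (simp add: algebra_simps)
  then show "shift q y (x \<oplus> z) \<le> shift q y x + shift q y z" by simp
next
  fix x s assume x: "x \<in> carrier X" and s: "(s::real) > 0"
  have "shift q y (complex_of_real s \<odot> x) / s \<le> q (x \<oplus> complex_of_real t \<odot> y) - t * q y"
    if "t \<ge> 0" for t
  proof -
    have "shift q y (complex_of_real s \<odot> x)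
        \<le> q (complex_of_real s \<odot> x \<oplus> complex_of_real (s * t) \<odot> y) - s * t * q y"
      using x y q s that by (intro shift_le) auto
    also have "complex_of_real s \<odot> x \<oplus> complex_of_real (s * t) \<odot> y
        = complex_of_real s \<odot> (x \<oplus> complex_of_real t \<odot> y)"
      using x y by (simp add: smult_add_right smult_mult)
    also have "q \<dots> = s * q (x \<oplus> complex_of_real t \<odot> y)"
      using x y q s by (intro sublinear_scale) auto
    finally show ?thesis using s by (simp add: field_simps)
  qed
  then have "shift q y (complex_of_real s \<odot> x) / s \<le> shift q y x" by (rule le_shift)
  then show "shift q y (complex_of_real s \<odot> x) \<le> s * shift q y x"
    using s by (simp add: field_simps)
qed

lemma sublinear_restrict: "sublinear q \<Longrightarrow> sublinear (restrict q (carrier X))"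
  by (auto simp: sublinear_def)

text \<open>Zorn's lemma for the reversed pointwise order. The infimum of a chain is finite because
  each member is at least \<open>- q (\<ominus> x)\<close> at \<open>x\<close>, and it is
  subadditive because the smaller of two members serves both summands. Candidates are extensional,
  so a comparison on the carrier is a comparison of functions.\<close>

lemma sublinear_minimal:
  assumes q: "sublinear q"
  obtains m where "sublinear m" "\<And>x. x \<in> carrier X \<Longrightarrow> m x \<le> q x"
    "\<And>r x. sublinear r \<Longrightarrow> (\<And>x. x \<in> carrier X \<Longrightarrow> r x \<le> m x) \<Longrightarrow> x \<in> carrier X \<Longrightarrow> r x = m x"
proof -
  define A where "A = {r \<in> extensional (carrier X). sublinear r \<and> (\<forall>x\<in>carrier X. r x \<le> q x)}"
  define P where "P = (\<lambda>r s. (s :: 'a \<Rightarrow> real) \<le> r)"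
  have po: "partial_order_on A (relation_of P A)"
    by (rule partial_order_on_relation_ofI) (auto simp: P_def)
  have "\<exists>m\<in>A. \<forall>r\<in>A. P m r \<longrightarrow> r = m"
  proof (rule predicate_Zorn[OF po])
    fix C assume C: "C \<in> Chains (relation_of P A)"
    then have CA: "C \<subseteq> A" and lin: "\<And>r s. r \<in> C \<Longrightarrow> s \<in> C \<Longrightarrow> r \<le> s \<or> s \<le> r"
      by (auto simp: Chains_def relation_of_def P_def)
    show "\<exists>u\<in>A. \<forall>r\<in>C. P r u"
    proof (cases "C = {}")
      case True
      then show ?thesis using q by (intro bexI[of _ "restrict q (carrier X)"])
          (auto simp: A_def sublinear_restrict)
    next
      case False
      define u where "u = (\<lambda>x\<in>carrier X. INF r\<in>C. r x)"
      have bd: "bdd_below ((\<lambda>r. r x) ` C)" if x: "x \<in> carrier X" for x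
      proof (rule bdd_belowI2)
        fix r assume "r \<in> C"
        then have r: "sublinear r" "r (\<ominus> x) \<le> q (\<ominus> x)" using CA x by (auto simp: A_def)
        then show "- q (\<ominus> x) \<le> r x" using sublinear_ge[of r x] x by linarith
      qed
      have le: "u x \<le> r x" if "r \<in> C" "x \<in> carrier X" for r x
        using cINF_lower[OF bd that(1)] that by (simp add: u_def)
      have ge: "c \<le> u x" if "x \<in> carrier X" "\<And>r. r \<in> C \<Longrightarrow> c \<le> r x" for c x
        using cINF_greatest[of C c "\<lambda>r. r x"] False that by (simp add: u_def)
      have "u (x \<oplus> y) \<le> u x + u y" if xy: "x \<in> carrier X" "y \<in> carrier X" for x y
      proof -
        have *: "u (x \<oplus> y) \<le> r x + s y" if rs: "r \<in> C" "s \<in> C" for r s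
        proof -
          obtain w where w: "w \<in> C" "w \<le> r" "w \<le> s" using lin[OF rs] rs by auto
          have "u (x \<oplus> y) \<le> w (x \<oplus> y)" using le w xy by auto
          also have "\<dots> \<le> w x + w y" using w CA xy by (intro sublinear_add) (auto simp: A_def)
          also have "\<dots> \<le> r x + s y" using w by (simp add: add_mono le_funD)
          finally show ?thesis .
        qed
        have "u (x \<oplus> y) - r x \<le> u y" if "r \<in> C" for r
          using *[OF that] xy by (intro ge) (auto simp: algebra_simps)
        then have "u (x \<oplus> y) - u y \<le> u x"
          using xy by (intro ge) (auto simp: algebra_simps)
        then show ?thesis by simp
      qed
      moreover have "u (complex_of_real t \<odot> x) \<le> t * u x" if x: "x \<in> carrier X" and t: "t > 0" for x t
      proof -
        have "u (complex_of_real t \<odot> x) / t \<le> r x" if "r \<in> C" for r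
        proof -
          have "u (complex_of_real t \<odot> x) \<le> r (complex_of_real t \<odot> x)" using le that x by auto
          also have "\<dots> = t * r x" using that CA x t by (intro sublinear_scale) (auto simp: A_def)
          finally show ?thesis using t by (simp add: field_simps)
        qed
        then have "u (complex_of_real t \<odot> x) / t \<le> u x" using x by (intro ge)
        then show ?thesis using t by (simp add: field_simps)
      qed
      ultimately have "sublinear u" by (simp add: sublinear_def)
      moreover have "u x \<le> q x" if "x \<in> carrier X" for x
      proof -
        obtain r where "r \<in> C" using False by blast
        then have "u x \<le> r x" "r x \<le> q x" using le that CA by (auto simp: A_def)
        then show ?thesis by linarith
      qed
      ultimately have "u \<in> A" by (auto simp: A_def u_def)
      moreover have "u \<le> r" if "r \<in> C" for r
      proof (rule le_funI)
        fix x
        have "r \<in> extensional (carrier X)" using that CA by (auto simp: A_def)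
        then show "u x \<le> r x" using le[OF that] 
          by (cases "x \<in> carrier X") (auto simp: u_def extensional_def)
      qed
      ultimately show ?thesis by (auto simp: P_def)
    qed
  qed
  then obtain m where m: "m \<in> A" "\<And>r. r \<in> A \<Longrightarrow> r \<le> m \<Longrightarrow> r = m" by (auto simp: P_def)
  show ?thesis
  proof (rule that[of m])
    show "sublinear m" "\<And>x. x \<in> carrier X \<Longrightarrow> m x \<le> q x" using m(1) by (auto simp: A_def)
    fix r x assume r: "sublinear r" "\<And>x. x \<in> carrier X \<Longrightarrow> r x \<le> m x" and x: "x \<in> carrier X"
    have "restrict r (carrier X) \<in> A" using r m(1) order_trans by (fastforce simp: A_def sublinear_restrict)
    moreover have "restrict r (carrier X) \<le> m"
      using r m(1) by (auto simp: le_fun_def A_def extensional_def)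
    ultimately have "restrict r (carrier X) = m" by (rule m(2))
    then show "r x = m x" using x by auto
  qed
qed

text \<open>A minimal sublinear functional is additive, since it cannot lie strictly above its shifts.\<close>

lemma hahn_banach_real:
  assumes q: "sublinear q"
  obtains F where "\<And>x y. x \<in> carrier X \<Longrightarrow> y \<in> carrier X \<Longrightarrow> F (x \<oplus> y) = F x + F y"
    "\<And>t x. x \<in> carrier X \<Longrightarrow> F (complex_of_real t \<odot> x) = t * F x"
    "\<And>x. x \<in> carrier X \<Longrightarrow> F x \<le> q x"
proof -
  obtain m where m: "sublinear m" "\<And>x. x \<in> carrier X \<Longrightarrow> m x \<le> q x"
    and min: "\<And>r x. sublinear r \<Longrightarrow> (\<And>x. x \<in> carrier X \<Longrightarrow> r x \<le> m x) \<Longrightarrow> x \<in> carrier X \<Longrightarrow> r x = m x"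
    using sublinear_minimal[OF q] by blast
  have add: "m (x \<oplus> y) = m x + m y" if "x \<in> carrier X" "y \<in> carrier X" for x y
  proof (rule antisym)
    show "m (x \<oplus> y) \<le> m x + m y" using that m by (intro sublinear_add)
    have "shift m y x = m x"
      using that m by (intro min) (auto simp: sublinear_shift shift_le_self)
    then show "m x + m y \<le> m (x \<oplus> y)" using shift_le[of m x y 1] that m by simp
  qed
  have neg: "m (\<ominus> x) = - m x" if "x \<in> carrier X" for x
    using add[of x "\<ominus> x"] that sublinear_zero[OF m(1)] by (simp add: M.r_neg)
  have "m (complex_of_real t \<odot> x) = t * m x" if x: "x \<in> carrier X" for t x
  proof -
    consider "t > 0" | "t = 0" | "t < 0" by linarith
    then show ?thesis
    proof cases
      case 3
      have "complex_of_real t \<odot> x = \<ominus> (complex_of_real (- t) \<odot> x)"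
        using x by (simp add: minus_smult smult_mult)
      then have "m (complex_of_real t \<odot> x) = - m (complex_of_real (- t) \<odot> x)"
        using neg[of "complex_of_real (- t) \<odot> x"] x by simp
      then show ?thesis using sublinear_scale[OF m(1) x, of "-t"] 3 by simp
    qed (use x m in \<open>auto simp: sublinear_scale sublinear_zero\<close>)
  qed
  then show ?thesis using that[of m] add m by blast
qed

text \<open>A real functional below \<open>shift q x0\<close> attains \<open>q x0\<close>, and
  complexification preserves the bound. With the norm as \<open>q\<close> it yields norming
  functionals, with the distance to a subspace annihilating ones.\<close>

lemma hahn_banach_seminorm:
  assumes add: "\<And>x y. x \<in> carrier X \<Longrightarrow> y \<in> carrier X \<Longrightarrow> q (x \<oplus> y) \<le> q x + q y"
    and scale: "\<And>c x. x \<in> carrier X \<Longrightarrow> q (c \<odot> x) = cmod c * q x"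
    and x0: "x0 \<in> carrier X"
    and bound: "\<And>x. x \<in> carrier X \<Longrightarrow> q x \<le> B * vnorm X x"
  obtains f where "f \<in> dual X" "\<And>x. x \<in> carrier X \<Longrightarrow> cmod (f x) \<le> q x" "f x0 = complex_of_real (q x0)"
proof -
  have q: "sublinear q" unfolding sublinear_def using add scale by auto
  obtain F where Fadd: "\<And>x y. x \<in> carrier X \<Longrightarrow> y \<in> carrier X \<Longrightarrow> F (x \<oplus> y) = F x + F y"
    and Fsm: "\<And>t x. x \<in> carrier X \<Longrightarrow> F (complex_of_real t \<odot> x) = t * F x"
    and Fsh: "\<And>x. x \<in> carrier X \<Longrightarrow> F x \<le> shift q x0 x"
    using hahn_banach_real[OF sublinear_shift[OF q x0]] by blast
  have Fle: "F x \<le> q x" if "x \<in> carrier X" for x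
    using Fsh[OF that] shift_le_self[OF q that x0] by linarith
  have "F (\<ominus> x0) \<le> - q x0"
    using Fsh[of "\<ominus> x0"] shift_le[OF q _ x0, of "\<ominus> x0" 1] x0 sublinear_zero[OF q]
    by (simp add: M.l_neg)
  moreover have "F (\<ominus> x0) = - F x0"
    using Fsm[of x0 "-1"] x0 by (simp add: minus_smult)
  ultimately have Fx0: "q x0 \<le> F x0" by linarith
  \<comment> \<open>The real part of a complex linear functional determines it: this is the only one
    with real part \<open>F\<close>.\<close>
  define f where "f = (\<lambda>x\<in>carrier X. Complex (F x) (- F (\<i> \<odot> x)))"
  have f_add: "f (x \<oplus> y) = f x + f y" if "x \<in> carrier X" "y \<in> carrier X" for x y
    using that by (simp add: f_def Fadd smult_add_right complex_eq_iff)
  have f_smult: "f (c \<odot> x) = c * f x" if x: "x \<in> carrier X" for c x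
  proof -
    have *: "F (Complex a b \<odot> x) = a * F x + b * F (\<i> \<odot> x)" for a b
    proof -
      have "Complex a b \<odot> x = complex_of_real a \<odot> x \<oplus> complex_of_real b \<odot> (\<i> \<odot> x)"
        using x by (simp add: smult_mult smult_add_left[symmetric] Complex_eq mult.commute)
      then show ?thesis using x by (simp add: Fadd Fsm)
    qed
    have "\<i> * c = Complex (- Im c) (Re c)" by (simp add: complex_eq_iff)
    then have "\<i> \<odot> (c \<odot> x) = Complex (- Im c) (Re c) \<odot> x"
      using x by (simp add: smult_mult)
    then have 1: "F (\<i> \<odot> (c \<odot> x)) = - Im c * F x + Re c * F (\<i> \<odot> x)"
      by (simp only: *)
    have 2: "F (c \<odot> x) = Re c * F x + Im c * F (\<i> \<odot> x)"
      using *[of "Re c" "Im c"] by simp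
    have "f (c \<odot> x) = Complex (F (c \<odot> x)) (- F (\<i> \<odot> (c \<odot> x)))"
      using x by (simp add: f_def)
    also have "\<dots> = c * Complex (F x) (- F (\<i> \<odot> x))"
      unfolding 1 2 by (simp add: complex_eq_iff algebra_simps)
    finally show ?thesis using x by (simp add: f_def)
  qed
  have f_le: "cmod (f x) \<le> q x" if x: "x \<in> carrier X" for x
  proof (cases "f x = 0")
    case True
    have "q (\<ominus> x) = q x" using scale[of x "-1"] x by (simp add: minus_smult)
    then have "0 \<le> q x" using add[of x "\<ominus> x"] sublinear_zero[OF q] x by (simp add: M.r_neg)
    then show ?thesis using True by simp
  next
    case False
    \<comment> \<open>This unimodular factor rotates \<open>f x\<close> to the positive axis, where
      it is controlled by its real part.\<close>
    define c where "c = cnj (f x) / cmod (f x)"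
    have "cnj (f x) * f x = complex_of_real (cmod (f x)) * complex_of_real (cmod (f x))"
      using complex_norm_square[of "f x"] by (simp add: mult.commute power2_eq_square)
    then have c: "cmod c = 1" "c * f x = cmod (f x)"
      using False by (simp_all add: c_def norm_divide)
    have "cmod (f x) = Re (f (c \<odot> x))" using f_smult[OF x] c by simp
    also have "\<dots> = F (c \<odot> x)" using x by (simp add: f_def)
    also have "\<dots> \<le> q (c \<odot> x)" using Fle x by blast
    also have "\<dots> = q x" using scale[OF x] c by simp
    finally show ?thesis .
  qed
  show ?thesis
  proof (rule that[of f])
    have "cmod (f x) \<le> B * vnorm X x" if "x \<in> carrier X" for x
      using f_le[OF that] bound[OF that] by linarith
    moreover have "f \<in> extensional (carrier X)" by (simp add: f_def)
    ultimately show "f \<in> dual X" unfolding dual_iff using f_add f_smult by blast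
    show "cmod (f x) \<le> q x" if "x \<in> carrier X" for x using f_le[OF that] .
    have "Re (f x0) = F x0" using x0 by (simp add: f_def)
    then have "Re (f x0) = q x0" "cmod (f x0) \<le> q x0"
      using Fx0 Fle[OF x0] f_le[OF x0] by linarith+
    moreover from this have "(cmod (f x0))\<^sup>2 \<le> (q x0)\<^sup>2" by (intro power_mono) auto
    ultimately show "f x0 = complex_of_real (q x0)" by (simp add: cmod_power2 complex_eq_iff)
  qed
qed

lemma norming_functional:
  assumes "x \<in> carrier X"
  obtains f where "f \<in> dual X" "\<And>y. y \<in> carrier X \<Longrightarrow> cmod (f y) \<le> vnorm X y" "f x = complex_of_real (vnorm X x)"
  by (rule hahn_banach_seminorm[where q = "vnorm X" and B = 1 and ?x0.0 = x])
    (use assms in \<open>auto simp: vnorm_triangle vnorm_smult\<close>)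

text \<open>The distance to \<open>V\<close> is a seminorm dominated by the norm; it vanishes on
  \<open>V\<close> and is at least \<open>d\<close> at \<open>x\<close>. A functional that attains
  it at \<open>x\<close> separates \<open>x\<close> from \<open>V\<close>.\<close>

lemma annihilating_functional:
  assumes V: "V \<subseteq> carrier X" "V \<noteq> {}"
    and Vadd: "\<And>v w. v \<in> V \<Longrightarrow> w \<in> V \<Longrightarrow> v \<oplus> w \<in> V" and Vsm: "\<And>c v. v \<in> V \<Longrightarrow> c \<odot> v \<in> V"
    and x: "x \<in> carrier X" and d: "d > 0" "\<And>v. v \<in> V \<Longrightarrow> d \<le> vnorm X (x \<ominus> v)"
  obtains f where "f \<in> dual X" "\<And>v. v \<in> V \<Longrightarrow> f v = 0" "f x \<noteq> 0"
proof -
  define q where "q = (\<lambda>y. INF v\<in>V. vnorm X (y \<ominus> v))"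
  have Vc: "v \<in> carrier X" if "v \<in> V" for v using V that by blast
  have le: "q y \<le> vnorm X (y \<ominus> v)" if "y \<in> carrier X" "v \<in> V" for y v
    unfolding q_def by (rule cINF_lower) (use that Vc in \<open>auto intro!: bdd_belowI2[where m = 0]\<close>)
  have ge: "c \<le> q y" if "\<And>v. v \<in> V \<Longrightarrow> c \<le> vnorm X (y \<ominus> v)" for c y
    unfolding q_def by (rule cINF_greatest) (use that V in auto)
  have V0: "\<zero> \<in> V" using V Vsm[of _ 0] Vc by fastforce
  have qadd: "q (y \<oplus> z) \<le> q y + q z" if yz: "y \<in> carrier X" "z \<in> carrier X" for y z
  proof -
    have *: "q (y \<oplus> z) \<le> vnorm X (y \<ominus> v) + vnorm X (z \<ominus> w)" if vw: "v \<in> V" "w \<in> V" for v w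
    proof -
      have "q (y \<oplus> z) \<le> vnorm X ((y \<oplus> z) \<ominus> (v \<oplus> w))" using le Vadd vw yz by auto
      also have "\<dots> \<le> vnorm X (y \<ominus> v) + vnorm X (z \<ominus> w)"
        using yz vw Vc by (simp add: add_diff_add vnorm_triangle)
      finally show ?thesis .
    qed
    have "q (y \<oplus> z) - vnorm X (y \<ominus> v) \<le> q z" if "v \<in> V" for v
      using *[OF that] by (intro ge) (auto simp: algebra_simps)
    then have "q (y \<oplus> z) - q z \<le> q y" by (intro ge) (auto simp: algebra_simps)
    then show ?thesis by simp
  qed
  have qsm_le: "q (c \<odot> y) \<le> cmod c * q y" if y: "y \<in> carrier X" and c: "c \<noteq> 0" for c y
  proof -
    have "q (c \<odot> y) / cmod c \<le> vnorm X (y \<ominus> v)" if v: "v \<in> V" for v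
    proof -
      have "q (c \<odot> y) \<le> vnorm X (c \<odot> y \<ominus> c \<odot> v)" using le Vsm v y by auto
      also have "\<dots> = cmod c * vnorm X (y \<ominus> v)"
        using v y Vc by (simp add: smult_diff[symmetric] vnorm_smult)
      finally show ?thesis using c by (simp add: field_simps)
    qed
    then have "q (c \<odot> y) / cmod c \<le> q y" by (rule ge)
    then show ?thesis using c by (simp add: field_simps)
  qed
  have q0: "q \<zero> = 0"
    using le[of \<zero> \<zero>] ge[of 0 \<zero>] V0 Vc by fastforce
  have qsm: "q (c \<odot> y) = cmod c * q y" if y: "y \<in> carrier X" for c y
  proof (cases "c = 0")
    case True then show ?thesis using y q0 by simp
  next
    case False
    have "q ((1/c) \<odot> (c \<odot> y)) \<le> cmod (1/c) * q (c \<odot> y)" using qsm_le y False by auto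
    then have "cmod c * q y \<le> q (c \<odot> y)"
      using y False by (simp add: smult_mult norm_divide field_simps)
    then show ?thesis using qsm_le[OF y False] by linarith
  qed
  have qle: "q y \<le> 1 * vnorm X y" if "y \<in> carrier X" for y using le[OF that V0] that by simp
  obtain f where f: "f \<in> dual X" "\<And>y. y \<in> carrier X \<Longrightarrow> cmod (f y) \<le> q y"
      "f x = complex_of_real (q x)"
    using hahn_banach_seminorm[OF qadd qsm x qle] by blast
  have "q v \<le> 0" if "v \<in> V" for v using le[of v v] that Vc by simp
  then have "f v = 0" if "v \<in> V" for v
    using f(2)[OF Vc[OF that]] that by (metis norm_le_zero_iff order_trans)
  moreover have "d \<le> q x" using d by (intro ge) auto
  then have "f x \<noteq> 0" using f(3) d by simp
  ultimately show ?thesis using that f by blast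
qed

section \<open>The weak operator topology\<close>

text \<open>The zero functional together with \<open>U = UNIV\<close> exhibits the set of all
  bounded maps as a subbasic open set.\<close>

lemma topspace_wot [simp]: "topspace (weak_operator_topology X) = bounded_maps X X"
proof -
  have "(\<lambda>x\<in>carrier X. 0) \<in> dual X" by (auto simp: dual_iff intro: exI[of _ 0])
  then have "{T \<in> bounded_maps X X. (\<lambda>x\<in>carrier X. 0::complex) (T \<zero>) \<in> UNIV}
      \<in> {{T \<in> bounded_maps X X. f (T x) \<in> U} | x f U. x \<in> carrier X \<and> f \<in> dual X \<and> open U}"
    by (intro CollectI exI[of _ \<zero>] exI[of _ "\<lambda>x\<in>carrier X. 0::complex"] exI[of _ UNIV]) auto
  then show ?thesis unfolding weak_operator_topology_def topology_generated_by_topspace by auto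
qed

text \<open>The universal property of an initial topology; through it every proof of weak continuity
  reduces to coefficients.\<close>

lemma continuous_map_wot_iff:
  "continuous_map Z (weak_operator_topology X) h \<longleftrightarrow> h \<in> topspace Z \<rightarrow> bounded_maps X X \<and>
     (\<forall>x\<in>carrier X. \<forall>f\<in>dual X. continuous_map Z euclidean (\<lambda>z. f (h z x)))" (is "?L \<longleftrightarrow> ?R")
proof
  assume L: ?L
  then have h: "h \<in> topspace Z \<rightarrow> bounded_maps X X" by (simp add: continuous_map_def)
  have "openin Z {z \<in> topspace Z. f (h z x) \<in> U}"
    if "x \<in> carrier X" "f \<in> dual X" "open U" for x f U
  proof -
    have "openin (weak_operator_topology X) {T \<in> bounded_maps X X. f (T x) \<in> U}"
      unfolding weak_operator_topology_def using that by (intro topology_generated_by_Basis) blast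
    then have "openin Z {z \<in> topspace Z. h z \<in> {T \<in> bounded_maps X X. f (T x) \<in> U}}"
      using L openin_continuous_map_preimage by blast
    also have "{z \<in> topspace Z. h z \<in> {T \<in> bounded_maps X X. f (T x) \<in> U}} = {z \<in> topspace Z. f (h z x) \<in> U}"
      using h by auto
    finally show ?thesis .
  qed
  then show ?R using h by (auto simp: continuous_map_def)
next
  assume R: ?R
  show ?L
    unfolding weak_operator_topology_def
  proof (rule continuous_on_generated_topo)
    fix V assume "V \<in> {{T \<in> bounded_maps X X. f (T x) \<in> U} | x f U. x \<in> carrier X \<and> f \<in> dual X \<and> open U}"
    then obtain x f U where V: "V = {T \<in> bounded_maps X X. f (T x) \<in> U}"
      "x \<in> carrier X" "f \<in> dual X" "open U" by blast
    then have "openin Z {z \<in> topspace Z. f (h z x) \<in> U}"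
      using R by (auto simp: continuous_map_def)
    moreover have "h -` V \<inter> topspace Z = {z \<in> topspace Z. f (h z x) \<in> U}"
      using R V by (auto simp: Pi_def)
    ultimately show "openin Z (h -` V \<inter> topspace Z)" by simp
  next
    have "\<Union> {{T \<in> bounded_maps X X. f (T x) \<in> U} | x f U. x \<in> carrier X \<and> f \<in> dual X \<and> open U}
        = topspace (weak_operator_topology X)"
      unfolding weak_operator_topology_def topology_generated_by_topspace by simp
    then show "h ` topspace Z \<subseteq> \<Union> {{T \<in> bounded_maps X X. f (T x) \<in> U} | x f U. x \<in> carrier X \<and> f \<in> dual X \<and> open U}"
      using R by auto
  qed
qed

lemma continuous_map_wot_eval:
  "x \<in> carrier X \<Longrightarrow> f \<in> dual X \<Longrightarrow> continuous_map (weak_operator_topology X) euclidean (\<lambda>T. f (T x))"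
  using continuous_map_wot_iff[of "weak_operator_topology X" "\<lambda>T. T"] by simp

section \<open>Bounded operators and functionals\<close>

lemma bounded_map_in: "T \<in> bounded_maps X Y \<Longrightarrow> x \<in> carrier X \<Longrightarrow> T x \<in> carrier Y"
  by (auto simp: bounded_maps_def)

lemma bounded_map_add: "T \<in> bounded_maps X Y \<Longrightarrow> x \<in> carrier X \<Longrightarrow> y \<in> carrier X \<Longrightarrow>
    T (x \<oplus> y) = T x \<oplus>\<^bsub>Y\<^esub> T y"
  by (auto simp: bounded_maps_def)

lemma bounded_map_smult: "T \<in> bounded_maps X Y \<Longrightarrow> x \<in> carrier X \<Longrightarrow> T (c \<odot> x) = c \<odot>\<^bsub>Y\<^esub> T x"
  by (auto simp: bounded_maps_def)

lemma bounded_map_diff: "T \<in> bounded_maps X X \<Longrightarrow> x \<in> carrier X \<Longrightarrow> y \<in> carrier X \<Longrightarrow>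
    T (x \<ominus> y) = T x \<ominus> T y"
  by (simp add: diff_smult bounded_map_in bounded_map_add bounded_map_smult)

text \<open>The constant in \<open>bounded_maps\<close> may be zero or negative; later estimates
  divide by it.\<close>

lemma bounded_map_bound:
  assumes "T \<in> bounded_maps X X"
  obtains C where "C > 0" "\<And>x. x \<in> carrier X \<Longrightarrow> vnorm X (T x) \<le> C * vnorm X x"
proof -
  obtain C where C: "\<And>x. x \<in> carrier X \<Longrightarrow> vnorm X (T x) \<le> C * vnorm X x"
    using assms unfolding bounded_maps_def by blast
  have "vnorm X (T x) \<le> (\<bar>C\<bar> + 1) * vnorm X x" if "x \<in> carrier X" for x
    using C[OF that] mult_right_mono[of C "\<bar>C\<bar> + 1" "vnorm X x"] vnorm_nonneg[OF that] by linarith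
  then show ?thesis using that[of "\<bar>C\<bar> + 1"] by simp
qed

lemma bounded_map_compose:
  assumes S: "S \<in> bounded_maps X X" and T: "T \<in> bounded_maps X X"
  shows "compose (carrier X) S T \<in> bounded_maps X X"
proof -
  obtain C where C: "C > 0" "\<And>x. x \<in> carrier X \<Longrightarrow> vnorm X (S x) \<le> C * vnorm X x"
    using bounded_map_bound[OF S] by blast
  obtain D where D: "D > 0" "\<And>x. x \<in> carrier X \<Longrightarrow> vnorm X (T x) \<le> D * vnorm X x"
    using bounded_map_bound[OF T] by blast
  have "vnorm X (S (T x)) \<le> (C * D) * vnorm X x" if "x \<in> carrier X" for x
    using C(2)[OF bounded_map_in[OF T that]] mult_left_mono[OF D(2)[OF that], of C] less_imp_le[OF C(1)]
    by (simp only: mult.assoc) (meson order_trans)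
  then show ?thesis
    unfolding bounded_maps_def
    using bounded_map_in[OF S] bounded_map_in[OF T] bounded_map_add[OF S] bounded_map_add[OF T]
      bounded_map_smult[OF S] bounded_map_smult[OF T]
    by (auto simp: compose_def intro!: exI[of _ "C * D"])
qed

lemma bounded_map_ext: "S \<in> bounded_maps X Y \<Longrightarrow> T \<in> bounded_maps X Y \<Longrightarrow>
    (\<And>x. x \<in> carrier X \<Longrightarrow> S x = T x) \<Longrightarrow> S = T"
  unfolding bounded_maps_def by (auto intro: PiE_ext)

lemma dual_bound:
  assumes "f \<in> dual X"
  obtains C where "C > 0" "\<And>x. x \<in> carrier X \<Longrightarrow> cmod (f x) \<le> C * vnorm X x"
proof -
  obtain C where C: "\<And>x. x \<in> carrier X \<Longrightarrow> cmod (f x) \<le> C * vnorm X x"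
    using assms unfolding dual_iff by blast
  have "cmod (f x) \<le> (\<bar>C\<bar> + 1) * vnorm X x" if "x \<in> carrier X" for x
    using C[OF that] mult_right_mono[of C "\<bar>C\<bar> + 1" "vnorm X x"] vnorm_nonneg[OF that] by linarith
  then show ?thesis using that[of "\<bar>C\<bar> + 1"] by simp
qed

lemma dual_add: "f \<in> dual X \<Longrightarrow> x \<in> carrier X \<Longrightarrow> y \<in> carrier X \<Longrightarrow> f (x \<oplus> y) = f x + f y"
  by (simp add: dual_iff)

lemma dual_smult: "f \<in> dual X \<Longrightarrow> x \<in> carrier X \<Longrightarrow> f (c \<odot> x) = c * f x"
  by (simp add: dual_iff)

lemma dual_diff: "f \<in> dual X \<Longrightarrow> x \<in> carrier X \<Longrightarrow> y \<in> carrier X \<Longrightarrow> f (x \<ominus> y) = f x - f y"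
  by (simp add: diff_smult dual_add dual_smult)

lemma dual_compose:
  assumes f: "f \<in> dual X" and T: "T \<in> bounded_maps X X"
  shows "compose (carrier X) f T \<in> dual X"
proof -
  obtain C where C: "C > 0" "\<And>x. x \<in> carrier X \<Longrightarrow> cmod (f x) \<le> C * vnorm X x"
    using dual_bound[OF f] by blast
  obtain D where D: "D > 0" "\<And>x. x \<in> carrier X \<Longrightarrow> vnorm X (T x) \<le> D * vnorm X x"
    using bounded_map_bound[OF T] by blast
  have "cmod (f (T x)) \<le> (C * D) * vnorm X x" if "x \<in> carrier X" for x
    using C(2)[OF bounded_map_in[OF T that]] mult_left_mono[OF D(2)[OF that], of C] less_imp_le[OF C(1)]
    by (simp only: mult.assoc) (meson order_trans)
  then show ?thesis
    unfolding dual_iff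
    using f bounded_map_in[OF T] bounded_map_add[OF T] bounded_map_smult[OF T]
    by (auto simp: compose_def dual_add dual_smult intro!: exI[of _ "C * D"])
qed

text \<open>If \<open>S x\<close> and \<open>T x\<close> differ, a norming functional of
  \<open>S x \<ominus> T x\<close> takes different values at them.\<close>

lemma Hausdorff_wot: "Hausdorff_space (weak_operator_topology X)"
  unfolding Hausdorff_space_def
proof (intro allI impI)
  fix S T assume "S \<in> topspace (weak_operator_topology X) \<and> T \<in> topspace (weak_operator_topology X) \<and> S \<noteq> T"
  then have S: "S \<in> bounded_maps X X" and T: "T \<in> bounded_maps X X" and "S \<noteq> T" by auto
  then obtain x where x: "x \<in> carrier X" "S x \<noteq> T x" using bounded_map_ext by blast
  have Sx: "S x \<in> carrier X" "T x \<in> carrier X" using S T x bounded_map_in by auto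
  obtain f where f: "f \<in> dual X" "f (S x \<ominus> T x) = complex_of_real (vnorm X (S x \<ominus> T x))"
    using norming_functional[of "S x \<ominus> T x"] Sx by blast
  have "f (S x) - f (T x) \<noteq> 0"
    using f x Sx by (simp add: dual_diff[symmetric] vnorm_eq_zero_iff diff_eq_zero_iff)
  then obtain U V where UV: "open U" "open V" "f (S x) \<in> U" "f (T x) \<in> V" "U \<inter> V = {}"
    using hausdorff[of "f (S x)" "f (T x)"] by auto
  have op: "openin (weak_operator_topology X) {R \<in> bounded_maps X X. f (R x) \<in> W}" if "open W" for W
    using openin_continuous_map_preimage[OF continuous_map_wot_eval[OF x(1) f(1)], of W] that by simp
  show "\<exists>U V. openin (weak_operator_topology X) U \<and> openin (weak_operator_topology X) V \<and>
      S \<in> U \<and> T \<in> V \<and> disjnt U V"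
    using op[OF UV(1)] op[OF UV(2)] UV S T
    by (intro exI[of _ "{R \<in> bounded_maps X X. f (R x) \<in> U}"] exI[of _ "{R \<in> bounded_maps X X. f (R x) \<in> V}"])
      (auto simp: disjnt_def)
qed

text \<open>Hahn--Banach describes a norm ball by the functionals of norm at most one, each of which
  imposes a weakly closed condition. Norm estimates enter the Baire arguments on weakly compact sets
  through this fact.\<close>

lemma closedin_wot_ball:
  assumes x: "x \<in> carrier X" and y: "y \<in> carrier X"
  shows "closedin (weak_operator_topology X) {T \<in> bounded_maps X X. vnorm X (T x \<ominus> y) \<le> r}"
proof -
  let ?D = "{f \<in> dual X. \<forall>z\<in>carrier X. cmod (f z) \<le> vnorm X z}"
  let ?C = "\<lambda>f. {T \<in> bounded_maps X X. f (T x) \<in> cball (f y) r}"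
  have 0: "(\<lambda>x\<in>carrier X. 0) \<in> ?D" by (auto simp: dual_iff intro: exI[of _ 0])
  have "closedin (weak_operator_topology X) (\<Inter>f\<in>?D. ?C f)"
  proof (rule closedin_INT)
    show "closedin (weak_operator_topology X) (?C f)" if "f \<in> ?D" for f
      using closedin_continuous_map_preimage[OF continuous_map_wot_eval[of x f], of "cball (f y) r"] that x by simp
  qed (use 0 in blast)
  also have "(\<Inter>f\<in>?D. ?C f) = {T \<in> bounded_maps X X. vnorm X (T x \<ominus> y) \<le> r}"
  proof (intro equalityI subsetI)
    fix T assume T: "T \<in> (\<Inter>f\<in>?D. ?C f)"
    then have Tb: "T \<in> bounded_maps X X" using 0 by blast
    then have Tx: "T x \<in> carrier X" using x bounded_map_in by blast
    obtain f where f: "f \<in> dual X" "\<And>z. z \<in> carrier X \<Longrightarrow> cmod (f z) \<le> vnorm X z"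
       "f (T x \<ominus> y) = complex_of_real (vnorm X (T x \<ominus> y))"
      using norming_functional[of "T x \<ominus> y"] Tx y by blast
    have "dist (f y) (f (T x)) \<le> r" using T f by auto
    then have "cmod (f (T x \<ominus> y)) \<le> r"
      using dual_diff[OF f(1) Tx y] by (metis dist_norm norm_minus_commute)
    then show "T \<in> {T \<in> bounded_maps X X. vnorm X (T x \<ominus> y) \<le> r}" using f(3) Tb Tx y by simp
  next
    fix T assume T: "T \<in> {T \<in> bounded_maps X X. vnorm X (T x \<ominus> y) \<le> r}"
    then have Tx: "T x \<in> carrier X" using x bounded_map_in by blast
    have le: "cmod (f (T x \<ominus> y)) \<le> r" if "f \<in> ?D" for f
    proof -
      have "cmod (f (T x \<ominus> y)) \<le> vnorm X (T x \<ominus> y)" using that Tx y by simp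
      also have "\<dots> \<le> r" using T by simp
      finally show ?thesis .
    qed
    have "dist (f y) (f (T x)) \<le> r" if "f \<in> ?D" for f
      using le[OF that] that dual_diff[of f "T x" y] Tx y by (simp add: dist_norm norm_minus_commute[of "f y"])
    then show "T \<in> (\<Inter>f\<in>?D. ?C f)" using T by simp
  qed
  finally show ?thesis .
qed

end

sublocale complex_banach_space \<subseteq> complex_normed_space
  by unfold_locales (fact vnorm_eq_zero_iff vnorm_triangle vnorm_smult)+

lemma (in complex_normed_space) complex_banach_spaceI:
  assumes "\<And>\<sigma> :: nat \<Rightarrow> 'a. range \<sigma> \<subseteq> carrier X \<Longrightarrow> (\<And>\<epsilon>. \<epsilon> > 0 \<Longrightarrow> \<exists>N. \<forall>m\<ge>N. \<forall>n\<ge>N. vnorm X (\<sigma> m \<ominus> \<sigma> n) < \<epsilon>) \<Longrightarrow>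
    \<exists>x\<in>carrier X. \<forall>\<epsilon>>0. \<exists>N. \<forall>n\<ge>N. vnorm X (\<sigma> n \<ominus> x) < \<epsilon>"
  shows "complex_banach_space X"
proof (intro complex_banach_space.intro complex_banach_space_axioms.intro)
  show "module complex_field X" ..
  show "Metric_space.mcomplete (carrier X) (vdist X)"
    using assms by (intro mcomplete_iff[THEN iffD2] allI impI) simp
qed (fact vnorm_eq_zero_iff vnorm_triangle vnorm_smult)+

section \<open>Compact semitopological semigroups\<close>

locale semitop_semigroup =
  fixes T :: "'b topology" and m :: "'b \<Rightarrow> 'b \<Rightarrow> 'b" (infixl \<open>\<cdot>\<close> 70)
  assumes Hausdorff: "Hausdorff_space T"
    and m_closed: "x \<in> topspace T \<Longrightarrow> y \<in> topspace T \<Longrightarrow> x \<cdot> y \<in> topspace T"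
    and m_assoc: "x \<in> topspace T \<Longrightarrow> y \<in> topspace T \<Longrightarrow> z \<in> topspace T \<Longrightarrow> (x \<cdot> y) \<cdot> z = x \<cdot> (y \<cdot> z)"
    and continuous_left: "a \<in> topspace T \<Longrightarrow> continuous_map T T (\<lambda>x. a \<cdot> x)"
    and continuous_right: "a \<in> topspace T \<Longrightarrow> continuous_map T T (\<lambda>x. x \<cdot> a)"
begin

lemma compactin_closedin: "compactin T A \<Longrightarrow> closedin T A"
  using Hausdorff compactin_imp_closedin by blast

lemma compactin_left_mult: "a \<in> topspace T \<Longrightarrow> compactin T A \<Longrightarrow> compactin T ((\<lambda>x. a \<cdot> x) ` A)"
  using continuous_left image_compactin by blast

lemma compactin_right_mult: "a \<in> topspace T \<Longrightarrow> compactin T A \<Longrightarrow> compactin T ((\<lambda>x. x \<cdot> a) ` A)"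
  using continuous_right image_compactin by blast

text \<open>Separate continuity allows only one factor at a time to pass to the closure: first the
  right one for a fixed left factor in \<open>A\<close>, then the left one for a fixed right factor
  in the closure.\<close>

lemma closure_of_mult_closed:
  assumes A: "A \<subseteq> topspace T" and closed: "\<And>x y. x \<in> A \<Longrightarrow> y \<in> A \<Longrightarrow> x \<cdot> y \<in> A"
    and u: "u \<in> T closure_of A" and v: "v \<in> T closure_of A"
  shows "u \<cdot> v \<in> T closure_of A"
proof -
  have ut: "u \<in> topspace T" and vt: "v \<in> topspace T"
    using u v by (auto simp: in_closure_of)
  have 1: "a \<cdot> v \<in> T closure_of A" if a: "a \<in> A" for a
  proof -
    have "a \<cdot> v \<in> (\<lambda>x. a \<cdot> x) ` (T closure_of A)" using v by blast
    also have "\<dots> \<subseteq> T closure_of ((\<lambda>x. a \<cdot> x) ` A)"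
      using a A by (intro continuous_map_image_closure_subset continuous_left) auto
    also have "\<dots> \<subseteq> T closure_of A"
      using a closed by (intro closure_of_mono) auto
    finally show ?thesis .
  qed
  have "u \<cdot> v \<in> (\<lambda>x. x \<cdot> v) ` (T closure_of A)" using u by blast
  also have "\<dots> \<subseteq> T closure_of ((\<lambda>x. x \<cdot> v) ` A)"
    using vt by (intro continuous_map_image_closure_subset continuous_right)
  also have "\<dots> \<subseteq> T closure_of (T closure_of A)"
    using 1 by (intro closure_of_mono) auto
  finally show ?thesis by simp
qed

text \<open>Numakura: in a minimal closed subsemigroup \<open>B\<close> one has \<open>B a = B\<close> for \<open>a \<in> B\<close>, and then the
  stabiliser of \<open>a\<close> is a closed subsemigroup of \<open>B\<close> as well.\<close>

lemma compact_semigroup_idempotent: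
  assumes A: "compactin T A" "A \<noteq> {}" and closed: "\<And>x y. x \<in> A \<Longrightarrow> y \<in> A \<Longrightarrow> x \<cdot> y \<in> A"
  obtains e where "e \<in> A" "e \<cdot> e = e"
proof -
  define F where "F = {B. B \<subseteq> A \<and> compactin T B \<and> B \<noteq> {} \<and> (\<forall>x\<in>B. \<forall>y\<in>B. x \<cdot> y \<in> B)}"
  have po: "partial_order_on F (relation_of (\<supseteq>) F)"
    by (rule partial_order_on_relation_ofI) auto
  have "\<exists>B\<in>F. \<forall>C\<in>F. B \<supseteq> C \<longrightarrow> C = B"
  proof (rule predicate_Zorn[OF po])
    fix C assume C: "C \<in> Chains (relation_of (\<supseteq>) F)"
    then have CF: "C \<subseteq> F" and lin: "\<And>r s. r \<in> C \<Longrightarrow> s \<in> C \<Longrightarrow> r \<subseteq> s \<or> s \<subseteq> r"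
      by (auto simp: Chains_def relation_of_def)
    show "\<exists>u\<in>F. \<forall>B\<in>C. B \<supseteq> u"
    proof (cases "C = {}")
      case True
      then show ?thesis using A closed by (intro bexI[of _ A]) (auto simp: F_def)
    next
      case False
      have "\<Inter>\<G> \<noteq> {}" if "finite \<G>" "\<G> \<subseteq> C" "\<G> \<noteq> {}" for \<G>
      proof -
        have "\<exists>B\<in>\<G>. \<forall>D\<in>\<G>. B \<subseteq> D"
          using that
        proof (induction rule: finite_induct)
          case (insert x \<G>)
          show ?case
          proof (cases "\<G> = {}")
            case False
            then obtain B where B: "B \<in> \<G>" "\<And>D. D \<in> \<G> \<Longrightarrow> B \<subseteq> D"
              using insert.IH insert.prems by (metis insert_subset)
            then consider "x \<subseteq> B" | "B \<subseteq> x" using lin[of x B] insert.prems by blast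
            then show ?thesis
            proof cases
              case 1
              then have "x \<subseteq> D" if "D \<in> insert x \<G>" for D using B(2)[of D] that by blast
              then show ?thesis by blast
            next
              case 2
              then show ?thesis using B by (intro bexI[of _ B]) auto
            qed
          qed simp
        qed simp
        then obtain B where B: "B \<in> \<G>" "\<And>D. D \<in> \<G> \<Longrightarrow> B \<subseteq> D" by auto
        then have "B \<noteq> {}" using CF that by (auto simp: F_def)
        then show ?thesis using B by blast
      qed
      note fip = this
      obtain B0 where B0: "B0 \<in> C" using False by blast
      have B0A: "B0 \<subseteq> A" using B0 CF by (auto simp: F_def)
      have clos: "closedin T B" if "B \<in> C" for B
        using that CF compactin_closedin by (auto simp: F_def)
      have "A \<inter> \<Inter>\<F> \<noteq> {}" if "finite \<F>" "\<F> \<subseteq> C" for \<F>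
        using fip[of "insert B0 \<F>"] that B0 B0A by auto
      then have *: "\<forall>\<F>. finite \<F> \<and> \<F> \<subseteq> C \<longrightarrow> A \<inter> \<Inter>\<F> \<noteq> {}" by simp
      have "\<forall>K\<in>C. closedin T K" using clos by simp
      with A(1) * have ne: "A \<inter> \<Inter>C \<noteq> {}" unfolding compactin_fip by metis
      have "\<Inter>C \<subseteq> B0" using B0 by blast
      moreover have "closedin T (\<Inter>C)"
        using False clos by (intro closedin_Inter) auto
      ultimately have "compactin T (\<Inter>C)"
        using B0 CF by (auto simp: F_def intro: closed_compactin)
      moreover have "\<Inter>C \<subseteq> A" using B0 B0A by blast
      ultimately have "\<Inter>C \<in> F" using ne CF by (auto simp: F_def)
      then show ?thesis by auto
    qed
  qed
  then obtain B where BF: "B \<in> F" and min: "\<And>C. C \<in> F \<Longrightarrow> C \<subseteq> B \<Longrightarrow> C = B" by blast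
  then obtain a where a: "a \<in> B" by (auto simp: F_def)
  have BA: "B \<subseteq> A" and Bc: "compactin T B" and Bm: "\<And>x y. x \<in> B \<Longrightarrow> y \<in> B \<Longrightarrow> x \<cdot> y \<in> B"
    using BF by (auto simp: F_def)
  have Bt: "x \<in> topspace T" if "x \<in> B" for x using that Bc compactin_subset_topspace by blast
  have "(x \<cdot> a) \<cdot> (y \<cdot> a) = (x \<cdot> a \<cdot> y) \<cdot> a" if "x \<in> B" "y \<in> B" for x y
    using that a Bt m_closed by (simp add: m_assoc)
  then have "(\<lambda>x. x \<cdot> a) ` B \<in> F"
    using a Bt Bm BA Bc compactin_right_mult[of a B] by (auto simp: F_def)
  then have Ba: "(\<lambda>x. x \<cdot> a) ` B = B" by (rule min) (use a Bm in auto)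
  define C where "C = {x \<in> B. x \<cdot> a = a}"
  have "closedin T {x \<in> topspace T. x \<cdot> a \<in> {a}}"
    using a Bt Hausdorff by (intro closedin_continuous_map_preimage[OF continuous_right])
      (auto simp: closedin_Hausdorff_sing_eq)
  with Bc have "compactin T (B \<inter> {x \<in> topspace T. x \<cdot> a \<in> {a}})" by (rule compact_Int_closedin)
  also have "B \<inter> {x \<in> topspace T. x \<cdot> a \<in> {a}} = C" using Bt by (auto simp: C_def)
  finally have "compactin T C" .
  moreover have "C \<noteq> {}" using Ba a by (force simp: C_def)
  moreover have "x \<cdot> y \<in> C" if "x \<in> C" "y \<in> C" for x y
    using that Bm Bt a by (auto simp: C_def m_assoc)
  ultimately have "C \<in> F" using BA by (auto simp: F_def C_def)
  then have "C = B" by (rule min) (auto simp: C_def)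
  then have "a \<cdot> a = a" using a by (auto simp: C_def)
  then show ?thesis using that a BA by blast
qed

text \<open>\<open>A a\<close> and \<open>a A\<close> are compact subsemigroups and so contain
  idempotents. Where \<open>p\<close> is the only idempotent, this says that \<open>a\<close> has
  inverses on both sides.\<close>

lemma idempotent_multiple:
  assumes A: "compactin T A" and closed: "\<And>x y. x \<in> A \<Longrightarrow> y \<in> A \<Longrightarrow> x \<cdot> y \<in> A" and a: "a \<in> A"
  obtains v w where "v \<in> A" "(v \<cdot> a) \<cdot> (v \<cdot> a) = v \<cdot> a" "w \<in> A" "(a \<cdot> w) \<cdot> (a \<cdot> w) = a \<cdot> w"
proof -
  have t: "x \<in> topspace T" if "x \<in> A" for x using that A compactin_subset_topspace by blast
  have assoc: "(x \<cdot> a) \<cdot> (y \<cdot> a) = (x \<cdot> a \<cdot> y) \<cdot> a" "(a \<cdot> x) \<cdot> (a \<cdot> y) = a \<cdot> (x \<cdot> a \<cdot> y)"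
    if "x \<in> A" "y \<in> A" for x y
    using that a t m_closed by (simp_all add: m_assoc)
  have *: "x \<cdot> y \<in> (\<lambda>x. x \<cdot> a) ` A" if "x \<in> (\<lambda>x. x \<cdot> a) ` A" "y \<in> (\<lambda>x. x \<cdot> a) ` A" for x y
    using that assoc closed a by auto
  have **: "x \<cdot> y \<in> (\<lambda>x. a \<cdot> x) ` A" if "x \<in> (\<lambda>x. a \<cdot> x) ` A" "y \<in> (\<lambda>x. a \<cdot> x) ` A" for x y
    using that assoc closed a by auto
  have "\<exists>e\<in>(\<lambda>x. x \<cdot> a) ` A. e \<cdot> e = e"
    using compact_semigroup_idempotent[OF compactin_right_mult[OF t[OF a] A] _ *] a by blast
  moreover have "\<exists>e\<in>(\<lambda>x. a \<cdot> x) ` A. e \<cdot> e = e"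
    using compact_semigroup_idempotent[OF compactin_left_mult[OF t[OF a] A] _ **] a by blast
  ultimately show ?thesis using that by blast
qed

text \<open>Idempotents of the form \<open>v a\<close> and \<open>a w\<close> lie in
  \<open>K\<close> and hence equal \<open>p\<close>, so every element of \<open>K\<close> is
  invertible with respect to \<open>p\<close>. If \<open>w\<close> is a right inverse of
  \<open>p v\<close>, then \<open>w (p v)\<close> is idempotent and again equals \<open>p\<close>,
  which gives \<open>p v p = p v\<close>; symmetrically \<open>p v p = v p\<close>. Thus
  \<open>p\<close> is central, \<open>p S\<close> is an ideal inside \<open>K\<close>, and by
  minimality it is all of \<open>K\<close>.\<close>

lemma minimal_ideal_group:
  assumes S: "compactin T S" and S_closed: "\<And>x y. x \<in> S \<Longrightarrow> y \<in> S \<Longrightarrow> x \<cdot> y \<in> S"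
    and KS: "K \<subseteq> S" and ideal: "\<And>u v. u \<in> S \<Longrightarrow> v \<in> K \<Longrightarrow> u \<cdot> v \<in> K" "\<And>u v. u \<in> S \<Longrightarrow> v \<in> K \<Longrightarrow> v \<cdot> u \<in> K"
    and min: "\<And>I. I \<noteq> {} \<Longrightarrow> I \<subseteq> S \<Longrightarrow> (\<And>u v. u \<in> S \<Longrightarrow> v \<in> I \<Longrightarrow> u \<cdot> v \<in> I \<and> v \<cdot> u \<in> I) \<Longrightarrow> K \<subseteq> I"
    and p: "p \<in> K" "p \<cdot> p = p" and unique: "\<And>e. e \<in> K \<Longrightarrow> e \<cdot> e = e \<Longrightarrow> e = p"
  shows "group \<lparr>carrier = K, mult = m, one = p\<rparr>" "compactin T K"
    "\<And>u. u \<in> S \<Longrightarrow> p \<cdot> u = u \<cdot> p"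
proof -
  have St: "x \<in> topspace T" if "x \<in> S" for x using that S compactin_subset_topspace by blast
  have Kt: "x \<in> topspace T" if "x \<in> K" for x using that St KS by blast
  have pS: "p \<in> S" using p KS by blast
  have inv: "\<exists>v\<in>S. v \<cdot> a = p" "\<exists>v\<in>S. a \<cdot> v = p" if a: "a \<in> K" for a
  proof -
    have "a \<in> S" using a KS by blast
    then obtain v w where "v \<in> S" "(v \<cdot> a) \<cdot> (v \<cdot> a) = v \<cdot> a" "w \<in> S" "(a \<cdot> w) \<cdot> (a \<cdot> w) = a \<cdot> w"
      using idempotent_multiple[OF S S_closed] by blast
    then show "\<exists>v\<in>S. v \<cdot> a = p" "\<exists>v\<in>S. a \<cdot> v = p" using unique ideal a by metis+
  qed
  have pvp: "p \<cdot> v \<cdot> p = p \<cdot> v" "p \<cdot> v \<cdot> p = v \<cdot> p" if v: "v \<in> S" for v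
  proof -
    have vt: "v \<in> topspace T" "p \<in> topspace T" using v St pS by auto
    obtain w where w: "w \<in> S" "(p \<cdot> v) \<cdot> w = p" using inv(2) ideal(2) v p by blast
    have wt: "w \<in> topspace T" using w St by blast
    have "(w \<cdot> (p \<cdot> v)) \<cdot> (w \<cdot> (p \<cdot> v)) = w \<cdot> (((p \<cdot> v) \<cdot> w) \<cdot> (p \<cdot> v))"
      using wt vt m_closed by (simp add: m_assoc)
    also have "\<dots> = w \<cdot> (p \<cdot> v)" using w p vt by (simp flip: m_assoc)
    finally have "w \<cdot> (p \<cdot> v) = p" using unique ideal w v p by blast
    then have "p \<cdot> v \<cdot> p = ((p \<cdot> v) \<cdot> w) \<cdot> (p \<cdot> v)" using wt vt m_closed by (simp add: m_assoc)
    also have "\<dots> = p \<cdot> v" using w p vt by (simp flip: m_assoc)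
    finally show "p \<cdot> v \<cdot> p = p \<cdot> v" .
    obtain w where w: "w \<in> S" "w \<cdot> (v \<cdot> p) = p" using inv(1) ideal(1) v p by blast
    have wt: "w \<in> topspace T" using w St by blast
    have "((v \<cdot> p) \<cdot> w) \<cdot> ((v \<cdot> p) \<cdot> w) = (v \<cdot> p) \<cdot> ((w \<cdot> (v \<cdot> p)) \<cdot> w)"
      using wt vt m_closed by (simp add: m_assoc)
    also have "\<dots> = (v \<cdot> (p \<cdot> p)) \<cdot> w" using w vt wt m_closed by (simp add: m_assoc)
    finally have "(v \<cdot> p) \<cdot> w = p" using unique ideal w v p by metis
    then have "p \<cdot> v \<cdot> p = (v \<cdot> p) \<cdot> (w \<cdot> (v \<cdot> p))" using wt vt m_closed by (simp flip: m_assoc)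
    also have "\<dots> = v \<cdot> p" using w p vt by (simp add: m_assoc)
    finally show "p \<cdot> v \<cdot> p = v \<cdot> p" .
  qed
  show comm: "p \<cdot> u = u \<cdot> p" if "u \<in> S" for u using pvp[OF that] by simp
  have "K \<subseteq> (\<lambda>v. p \<cdot> v) ` S"
  proof (rule min)
    show "(\<lambda>v. p \<cdot> v) ` S \<noteq> {}" "(\<lambda>v. p \<cdot> v) ` S \<subseteq> S" using pS S_closed by auto
    fix u v assume u: "u \<in> S" and "v \<in> (\<lambda>v. p \<cdot> v) ` S"
    then obtain w where w: "w \<in> S" "v = p \<cdot> w" by blast
    have "u \<cdot> v = p \<cdot> (u \<cdot> w)" "v \<cdot> u = p \<cdot> (w \<cdot> u)"
      using w u St pS comm[OF u] m_assoc[of u p w] m_assoc[of p u w] m_assoc[of p w u] by simp_all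
    then show "u \<cdot> v \<in> (\<lambda>v. p \<cdot> v) ` S \<and> v \<cdot> u \<in> (\<lambda>v. p \<cdot> v) ` S"
      using S_closed u w by auto
  qed
  moreover have "(\<lambda>v. p \<cdot> v) ` S \<subseteq> K" using p ideal by blast
  ultimately have K: "K = (\<lambda>v. p \<cdot> v) ` S" by blast
  then show "compactin T K" using compactin_left_mult[OF _ S, of p] St pS by simp
  have one: "p \<cdot> a = a" if a: "a \<in> K" for a
  proof -
    obtain v where "v \<in> S" "a = p \<cdot> v" using a K by blast
    then show ?thesis using m_assoc[of p p v] St pS p by simp
  qed
  show "group \<lparr>carrier = K, mult = m, one = p\<rparr>"
  proof (rule groupI, goal_cases)
    case (5 a)
    then obtain v where v: "v \<in> S" "v \<cdot> a = p" using inv by auto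
    then have "(p \<cdot> v) \<cdot> a = p" using m_assoc[of p v a] St Kt pS p 5 by simp
    then show ?case using ideal(2) v p by auto
  qed (use p one ideal KS Kt m_assoc in auto)
qed

text \<open>Baire's theorem for the compact Hausdorff space \<open>A\<close> gives some
  \<open>C n\<close> an interior relative to \<open>A\<close>. Left inverses carry any point of
  \<open>A\<close> to any other by a left translation, so the preimages of this interior under left
  translations form an open cover, and compactness leaves finitely many.\<close>

lemma compact_group_countable_closed_cover:
  fixes C :: "nat \<Rightarrow> 'b set"
  assumes A: "compactin T A" "A \<noteq> {}" and closed: "\<And>x y. x \<in> A \<Longrightarrow> y \<in> A \<Longrightarrow> x \<cdot> y \<in> A"
    and one: "\<And>a. a \<in> A \<Longrightarrow> a \<cdot> p = a" and inv: "\<And>a. a \<in> A \<Longrightarrow> \<exists>v\<in>A. v \<cdot> a = p"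
    and C: "\<And>n. closedin T (C n)" and cover: "A \<subseteq> (\<Union>n. C n)"
  obtains n F where "finite F" "F \<subseteq> A" "A \<subseteq> (\<Union>h\<in>F. {x. h \<cdot> x \<in> C n})"
proof -
  define Z where "Z = subtopology T A"
  have At: "A \<subseteq> topspace T" using A compactin_subset_topspace by blast
  then have tZ: "topspace Z = A" by (auto simp: Z_def)
  have Zc: "compact_space Z" using A by (simp add: Z_def compact_space_subtopology)
  have ZH: "Hausdorff_space Z" using Hausdorff by (simp add: Z_def Hausdorff_space_subtopology)
  have "\<exists>n. Z interior_of (A \<inter> C n) \<noteq> {}"
  proof (rule ccontr)
    assume "\<nexists>n. Z interior_of (A \<inter> C n) \<noteq> {}"
    then have "Z interior_of \<Union>(range (\<lambda>n. A \<inter> C n)) = {}"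
    proof (intro Baire_category_alt disjI2 conjI)
      show "locally_compact_space Z" using Zc by (rule compact_imp_locally_compact_space)
      show "regular_space Z" using Zc ZH by (rule compact_Hausdorff_imp_regular_space)
      fix D assume "D \<in> range (\<lambda>n. A \<inter> C n)"
      then obtain n where D: "D = A \<inter> C n" by blast
      then show "closedin Z D" using C unfolding Z_def closedin_subtopology by blast
      show "Z interior_of D = {}" using D \<open>\<nexists>n. Z interior_of (A \<inter> C n) \<noteq> {}\<close> by blast
    qed simp
    moreover have "\<Union>(range (\<lambda>n. A \<inter> C n)) = topspace Z" using cover tZ by auto
    ultimately have "topspace Z = {}" using interior_of_topspace[of Z] by metis
    then show False using A(2) tZ by simp
  qed
  then obtain n O' where O': "openin Z O'" "O' \<noteq> {}" "O' \<subseteq> C n"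
    using openin_interior_of[of Z] interior_of_subset[of Z] by (meson le_inf_iff)
  then obtain b where b: "b \<in> O'" "b \<in> A" using openin_subset tZ by blast
  have sub: "openin Z {x \<in> A. h \<cdot> x \<in> O'}" if h: "h \<in> A" for h
  proof -
    have "continuous_map Z Z (\<lambda>x. h \<cdot> x)"
      using h At closed continuous_left[of h]
      by (auto simp: Z_def continuous_map_in_subtopology intro: continuous_map_from_subtopology)
    then show ?thesis using O' tZ openin_continuous_map_preimage by blast
  qed
  have "\<exists>h\<in>A. h \<cdot> x \<in> O'" if x: "x \<in> A" for x
  proof -
    obtain v where v: "v \<in> A" "v \<cdot> x = p" using inv x by blast
    have "(b \<cdot> v) \<cdot> x = b" using m_assoc[of b v x] b v x At one by auto
    then show ?thesis using closed b v by metis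
  qed
  then have "topspace Z \<subseteq> \<Union>((\<lambda>h. {x \<in> A. h \<cdot> x \<in> O'}) ` A)" by (auto simp: tZ)
  moreover have "\<forall>U\<in>(\<lambda>h. {x \<in> A. h \<cdot> x \<in> O'}) ` A. openin Z U" using sub by blast
  ultimately have "\<exists>\<F>. finite \<F> \<and> \<F> \<subseteq> (\<lambda>h. {x \<in> A. h \<cdot> x \<in> O'}) ` A \<and> topspace Z \<subseteq> \<Union>\<F>"
    by (intro Zc[unfolded compact_space_alt, rule_format] conjI)
  then obtain \<F> where \<F>: "finite \<F>" "\<F> \<subseteq> (\<lambda>h. {x \<in> A. h \<cdot> x \<in> O'}) ` A" "topspace Z \<subseteq> \<Union>\<F>"
    by blast
  then obtain F where "finite F" "F \<subseteq> A" "\<F> = (\<lambda>h. {x \<in> A. h \<cdot> x \<in> O'}) ` F"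
    by (meson finite_subset_image)
  moreover from this have "A \<subseteq> (\<Union>h\<in>F. {x. h \<cdot> x \<in> C n})" using \<F>(3) O'(3) unfolding tZ by blast
  ultimately show ?thesis using that by blast
qed

end

section \<open>The mean of an almost periodic function\<close>

context group
begin

text \<open>Maak's definition of almost periodicity; the finite cover is given by the level sets of a
  labelling \<open>l\<close>.\<close>

definition almost_periodic :: "('a \<Rightarrow> complex) \<Rightarrow> bool" where
  "almost_periodic f \<longleftrightarrow> (\<forall>\<epsilon>>0. \<exists>l :: 'a \<Rightarrow> nat. finite (l ` carrier G) \<and>
     (\<forall>k\<in>carrier G. \<forall>k'\<in>carrier G. l k = l k' \<longrightarrow>
       (\<forall>x\<in>carrier G. \<forall>y\<in>carrier G. cmod (f (x \<otimes> k \<otimes> y) - f (x \<otimes> k' \<otimes> y)) < \<epsilon>)))"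

text \<open>A list and not a finite set: when averages are composed, the products of the
  translations may coincide and must be counted with multiplicity.\<close>

definition left_average :: "'a list \<Rightarrow> ('a \<Rightarrow> complex) \<Rightarrow> 'a \<Rightarrow> complex" where
  "left_average xs f g = (\<Sum>x\<leftarrow>xs. f (x \<otimes> g)) / of_nat (length xs)"

definition right_average :: "'a list \<Rightarrow> ('a \<Rightarrow> complex) \<Rightarrow> 'a \<Rightarrow> complex" where
  "right_average xs f g = (\<Sum>x\<leftarrow>xs. f (g \<otimes> x)) / of_nat (length xs)"

definition has_mean :: "('a \<Rightarrow> complex) \<Rightarrow> complex \<Rightarrow> bool" where
  "has_mean f c \<longleftrightarrow> (\<forall>\<epsilon>>0. \<exists>xs. xs \<noteq> [] \<and> set xs \<subseteq> carrier G \<and>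
     (\<forall>g\<in>carrier G. cmod (left_average xs f g - c) < \<epsilon>))"

text \<open>Left averages commute with right averages. This makes the right mean the tool for the
  uniqueness of the left mean and for its behaviour under left averaging.\<close>

definition has_right_mean :: "('a \<Rightarrow> complex) \<Rightarrow> complex \<Rightarrow> bool" where
  "has_right_mean f c \<longleftrightarrow> (\<forall>\<epsilon>>0. \<exists>xs. xs \<noteq> [] \<and> set xs \<subseteq> carrier G \<and>
     (\<forall>g\<in>carrier G. cmod (right_average xs f g - c) < \<epsilon>))"

definition mean :: "('a \<Rightarrow> complex) \<Rightarrow> complex" where
  "mean f = (THE c. has_mean f c)"

section \<open>Closure properties of almost periodic functions\<close>

lemma almost_periodicE:
  assumes "almost_periodic f" "\<epsilon> > 0"
  obtains l :: "'a \<Rightarrow> nat" where "finite (l ` carrier G)"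
    "\<And>k k' x y. k \<in> carrier G \<Longrightarrow> k' \<in> carrier G \<Longrightarrow> l k = l k' \<Longrightarrow> x \<in> carrier G \<Longrightarrow> y \<in> carrier G \<Longrightarrow>
      cmod (f (x \<otimes> k \<otimes> y) - f (x \<otimes> k' \<otimes> y)) < \<epsilon>"
  using assms unfolding almost_periodic_def by metis

lemma has_meanE:
  assumes "has_mean f c" "\<epsilon> > 0"
  obtains xs where "xs \<noteq> []" "set xs \<subseteq> carrier G"
    "\<And>g. g \<in> carrier G \<Longrightarrow> cmod (left_average xs f g - c) < \<epsilon>"
proof -
  obtain xs where "xs \<noteq> [] \<and> set xs \<subseteq> carrier G \<and> (\<forall>g\<in>carrier G. cmod (left_average xs f g - c) < \<epsilon>)"
    using assms unfolding has_mean_def by meson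
  then show ?thesis using that[of xs] by blast
qed

lemma has_right_meanE:
  assumes "has_right_mean f c" "\<epsilon> > 0"
  obtains xs where "xs \<noteq> []" "set xs \<subseteq> carrier G"
    "\<And>g. g \<in> carrier G \<Longrightarrow> cmod (right_average xs f g - c) < \<epsilon>"
proof -
  obtain xs where "xs \<noteq> [] \<and> set xs \<subseteq> carrier G \<and> (\<forall>g\<in>carrier G. cmod (right_average xs f g - c) < \<epsilon>)"
    using assms unfolding has_right_mean_def by meson
  then show ?thesis using that[of xs] by blast
qed

text \<open>The common refinement of two finite partitions is again a labelling by natural numbers
  via \<open>prod_encode\<close>. Sums, products and Lipschitz images are obtained from it by a
  choice of \<delta>.\<close>

lemma almost_periodic_combine:
  assumes f: "almost_periodic f" and h: "almost_periodic h"
    and F: "\<And>\<epsilon>. \<epsilon> > 0 \<Longrightarrow> \<exists>\<delta>>0. \<forall>u\<in>carrier G. \<forall>v\<in>carrier G.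
      cmod (f u - f v) < \<delta> \<longrightarrow> cmod (h u - h v) < \<delta> \<longrightarrow> cmod (F u - F v) < \<epsilon>"
  shows "almost_periodic F"
  unfolding almost_periodic_def
proof (intro allI impI)
  fix \<epsilon> :: real assume "\<epsilon> > 0"
  then obtain \<delta> where \<delta>: "\<delta> > 0" "\<And>u v. u \<in> carrier G \<Longrightarrow> v \<in> carrier G \<Longrightarrow>
      cmod (f u - f v) < \<delta> \<Longrightarrow> cmod (h u - h v) < \<delta> \<Longrightarrow> cmod (F u - F v) < \<epsilon>"
    using F by meson
  obtain l :: "'a \<Rightarrow> nat" where l: "finite (l ` carrier G)"
    "\<And>k k' x y. k \<in> carrier G \<Longrightarrow> k' \<in> carrier G \<Longrightarrow> l k = l k' \<Longrightarrow> x \<in> carrier G \<Longrightarrow> y \<in> carrier G \<Longrightarrow>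
      cmod (f (x \<otimes> k \<otimes> y) - f (x \<otimes> k' \<otimes> y)) < \<delta>"
    using almost_periodicE[OF f \<delta>(1)] by blast
  obtain l' :: "'a \<Rightarrow> nat" where l': "finite (l' ` carrier G)"
    "\<And>k k' x y. k \<in> carrier G \<Longrightarrow> k' \<in> carrier G \<Longrightarrow> l' k = l' k' \<Longrightarrow> x \<in> carrier G \<Longrightarrow> y \<in> carrier G \<Longrightarrow>
      cmod (h (x \<otimes> k \<otimes> y) - h (x \<otimes> k' \<otimes> y)) < \<delta>"
    using almost_periodicE[OF h \<delta>(1)] by blast
  show "\<exists>l :: 'a \<Rightarrow> nat. finite (l ` carrier G) \<and>
     (\<forall>k\<in>carrier G. \<forall>k'\<in>carrier G. l k = l k' \<longrightarrow>
       (\<forall>x\<in>carrier G. \<forall>y\<in>carrier G. cmod (F (x \<otimes> k \<otimes> y) - F (x \<otimes> k' \<otimes> y)) < \<epsilon>))"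
  proof (intro exI[of _ "\<lambda>k. prod_encode (l k, l' k)"] conjI ballI impI)
    have "(\<lambda>k. prod_encode (l k, l' k)) ` carrier G \<subseteq> prod_encode ` (l ` carrier G \<times> l' ` carrier G)"
      by auto
    then show "finite ((\<lambda>k. prod_encode (l k, l' k)) ` carrier G)"
      by (rule finite_subset) (use l l' in auto)
    fix k k' x y assume *: "k \<in> carrier G" "k' \<in> carrier G"
      "prod_encode (l k, l' k) = prod_encode (l k', l' k')" "x \<in> carrier G" "y \<in> carrier G"
    then have "l k = l k'" "l' k = l' k'" by (auto dest: inj_onD[OF inj_prod_encode])
    then show "cmod (F (x \<otimes> k \<otimes> y) - F (x \<otimes> k' \<otimes> y)) < \<epsilon>"
      using l l' * by (intro \<delta>(2)) auto
  qed
qed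

lemma almost_periodic_add:
  assumes "almost_periodic f" "almost_periodic h"
  shows "almost_periodic (\<lambda>g. f g + h g)"
proof (rule almost_periodic_combine[OF assms])
  fix \<epsilon> :: real assume "\<epsilon> > 0"
  have "cmod ((f u + h u) - (f v + h v)) < \<epsilon>"
    if "cmod (f u - f v) < \<epsilon> / 2" "cmod (h u - h v) < \<epsilon> / 2" for u v
    using norm_triangle_ineq[of "f u - f v" "h u - h v"] that by (simp add: algebra_simps)
  then show "\<exists>\<delta>>0. \<forall>u\<in>carrier G. \<forall>v\<in>carrier G. cmod (f u - f v) < \<delta> \<longrightarrow> cmod (h u - h v) < \<delta> \<longrightarrow>
      cmod ((f u + h u) - (f v + h v)) < \<epsilon>"
    using \<open>\<epsilon> > 0\<close> by (intro exI[of _ "\<epsilon> / 2"]) auto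
qed

lemma almost_periodic_const: "almost_periodic (\<lambda>g. c)"
  unfolding almost_periodic_def by (intro allI impI exI[of _ "\<lambda>_. 0"]) (auto intro: finite_subset[of _ "{0}"])

lemma almost_periodic_cong:
  "almost_periodic f \<Longrightarrow> (\<And>g. g \<in> carrier G \<Longrightarrow> f g = h g) \<Longrightarrow> almost_periodic h"
  by (rule almost_periodic_combine[of f f]) auto

lemma almost_periodic_lipschitz:
  assumes f: "almost_periodic f" and F: "\<And>u v. u \<in> carrier G \<Longrightarrow> v \<in> carrier G \<Longrightarrow>
    cmod (F u - F v) \<le> B * cmod (f u - f v)"
  shows "almost_periodic F"
proof (rule almost_periodic_combine[OF f f])
  fix \<epsilon> :: real assume \<epsilon>: "\<epsilon> > 0"
  have "cmod (F u - F v) < \<epsilon>"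
    if "cmod (f u - f v) < \<epsilon> / (\<bar>B\<bar> + 1)" "u \<in> carrier G" "v \<in> carrier G" for u v
  proof -
    have "cmod (F u - F v) \<le> (\<bar>B\<bar> + 1) * cmod (f u - f v)"
      using F[OF that(2,3)] mult_right_mono[of B "\<bar>B\<bar> + 1" "cmod (f u - f v)"] by force
    also have "\<dots> < \<epsilon>" using that(1) by (simp add: field_simps)
    finally show ?thesis .
  qed
  then show "\<exists>\<delta>>0. \<forall>u\<in>carrier G. \<forall>v\<in>carrier G. cmod (f u - f v) < \<delta> \<longrightarrow> cmod (f u - f v) < \<delta> \<longrightarrow>
      cmod (F u - F v) < \<epsilon>"
    using \<epsilon> by (intro exI[of _ "\<epsilon> / (\<bar>B\<bar> + 1)"]) auto
qed

lemma almost_periodic_cmult: "almost_periodic f \<Longrightarrow> almost_periodic (\<lambda>g. c * f g)"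
  by (rule almost_periodic_lipschitz[of f _ "cmod c"]) (auto simp: norm_mult simp flip: right_diff_distrib)

lemma almost_periodic_cnj: "almost_periodic f \<Longrightarrow> almost_periodic (\<lambda>g. cnj (f g))"
  by (rule almost_periodic_lipschitz[of f _ 1]) (auto simp flip: complex_cnj_diff)

lemma almost_periodic_sum_list:
  "(\<And>x. x \<in> set xs \<Longrightarrow> almost_periodic (f x)) \<Longrightarrow> almost_periodic (\<lambda>g. \<Sum>x\<leftarrow>xs. f x g)"
  by (induction xs) (auto intro: almost_periodic_const almost_periodic_add)

text \<open>The same labelling works, because the definition already quantifies over the
  translations on both sides.\<close>

lemma almost_periodic_translate:
  assumes f: "almost_periodic f" and a: "a \<in> carrier G" "b \<in> carrier G"
  shows "almost_periodic (\<lambda>g. f (a \<otimes> g \<otimes> b))"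
  unfolding almost_periodic_def
proof (intro allI impI)
  fix \<epsilon> :: real assume "\<epsilon> > 0"
  then obtain l :: "'a \<Rightarrow> nat" where l: "finite (l ` carrier G)"
    "\<And>k k' x y. k \<in> carrier G \<Longrightarrow> k' \<in> carrier G \<Longrightarrow> l k = l k' \<Longrightarrow> x \<in> carrier G \<Longrightarrow> y \<in> carrier G \<Longrightarrow>
      cmod (f (x \<otimes> k \<otimes> y) - f (x \<otimes> k' \<otimes> y)) < \<epsilon>"
    using almost_periodicE[OF f] by blast
  have "cmod (f (a \<otimes> (x \<otimes> k \<otimes> y) \<otimes> b) - f (a \<otimes> (x \<otimes> k' \<otimes> y) \<otimes> b)) < \<epsilon>"
    if "k \<in> carrier G" "k' \<in> carrier G" "l k = l k'" "x \<in> carrier G" "y \<in> carrier G" for k k' x y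
    using l(2)[of k k' "a \<otimes> x" "y \<otimes> b"] that a by (simp add: m_assoc)
  then show "\<exists>l :: 'a \<Rightarrow> nat. finite (l ` carrier G) \<and>
     (\<forall>k\<in>carrier G. \<forall>k'\<in>carrier G. l k = l k' \<longrightarrow> (\<forall>x\<in>carrier G. \<forall>y\<in>carrier G.
       cmod (f (a \<otimes> (x \<otimes> k \<otimes> y) \<otimes> b) - f (a \<otimes> (x \<otimes> k' \<otimes> y) \<otimes> b)) < \<epsilon>))"
    using l(1) by blast
qed

lemma almost_periodic_translate_left:
  assumes "almost_periodic f" "a \<in> carrier G" shows "almost_periodic (\<lambda>g. f (a \<otimes> g))"
  using almost_periodic_translate[OF assms one_closed]
  by (rule almost_periodic_cong) (use assms in simp)

lemma almost_periodic_translate_right: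
  assumes "almost_periodic f" "a \<in> carrier G" shows "almost_periodic (\<lambda>g. f (g \<otimes> a))"
  using almost_periodic_translate[OF assms(1) one_closed assms(2)]
  by (rule almost_periodic_cong) (use assms in simp)

lemma almost_periodic_left_average:
  assumes "almost_periodic f" "set xs \<subseteq> carrier G"
  shows "almost_periodic (left_average xs f)"
proof -
  have "almost_periodic (\<lambda>g. (1 / of_nat (length xs)) * (\<Sum>x\<leftarrow>xs. f (x \<otimes> g)))"
    using assms by (intro almost_periodic_cmult almost_periodic_sum_list almost_periodic_translate_left) auto
  then show ?thesis by (rule almost_periodic_cong) (simp add: left_average_def)
qed

lemma almost_periodic_inv:
  assumes f: "almost_periodic f" shows "almost_periodic (\<lambda>g. f (inv g))"
  unfolding almost_periodic_def
proof (intro allI impI)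
  fix \<epsilon> :: real assume "\<epsilon> > 0"
  then obtain l :: "'a \<Rightarrow> nat" where l: "finite (l ` carrier G)"
    "\<And>k k' x y. k \<in> carrier G \<Longrightarrow> k' \<in> carrier G \<Longrightarrow> l k = l k' \<Longrightarrow> x \<in> carrier G \<Longrightarrow> y \<in> carrier G \<Longrightarrow>
      cmod (f (x \<otimes> k \<otimes> y) - f (x \<otimes> k' \<otimes> y)) < \<epsilon>"
    using almost_periodicE[OF f] by blast
  show "\<exists>l :: 'a \<Rightarrow> nat. finite (l ` carrier G) \<and>
     (\<forall>k\<in>carrier G. \<forall>k'\<in>carrier G. l k = l k' \<longrightarrow> (\<forall>x\<in>carrier G. \<forall>y\<in>carrier G.
       cmod (f (inv (x \<otimes> k \<otimes> y)) - f (inv (x \<otimes> k' \<otimes> y))) < \<epsilon>))"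
  proof (intro exI[of _ "\<lambda>k. l (inv k)"] conjI ballI impI)
    show "finite ((\<lambda>k. l (inv k)) ` carrier G)"
      by (rule finite_subset[OF _ l(1)]) auto
    fix k k' x y assume *: "k \<in> carrier G" "k' \<in> carrier G" "l (inv k) = l (inv k')"
      "x \<in> carrier G" "y \<in> carrier G"
    then show "cmod (f (inv (x \<otimes> k \<otimes> y)) - f (inv (x \<otimes> k' \<otimes> y))) < \<epsilon>"
      using l(2)[of "inv k" "inv k'" "inv y" "inv x"] by (simp add: inv_mult_group m_assoc)
  qed
qed

text \<open>Up to an error of one, \<open>f\<close> takes only its values at one representative of
  each of the finitely many cells.\<close>

lemma almost_periodic_bounded:
  assumes f: "almost_periodic f"
  obtains B where "B > 0" "\<And>g. g \<in> carrier G \<Longrightarrow> cmod (f g) \<le> B"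
proof -
  obtain l :: "'a \<Rightarrow> nat" where l: "finite (l ` carrier G)"
    "\<And>k k' x y. k \<in> carrier G \<Longrightarrow> k' \<in> carrier G \<Longrightarrow> l k = l k' \<Longrightarrow> x \<in> carrier G \<Longrightarrow> y \<in> carrier G \<Longrightarrow>
      cmod (f (x \<otimes> k \<otimes> y) - f (x \<otimes> k' \<otimes> y)) < 1"
    using almost_periodicE[OF f, of 1] by auto
  obtain K where K: "K \<subseteq> carrier G" "finite K" "l ` carrier G = l ` K"
    using finite_subset_image[OF l(1) order_refl] by metis
  have "cmod (f g) \<le> 1 + (\<Sum>k\<in>K. cmod (f k))" if g: "g \<in> carrier G" for g
  proof -
    obtain k where k: "k \<in> K" "l g = l k" using K g by blast
    then have "cmod (f g - f k) < 1" using l(2)[of g k \<one> \<one>] g K by auto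
    then have "cmod (f g) \<le> 1 + cmod (f k)" using norm_triangle_ineq2[of "f g" "f k"] by linarith
    also have "cmod (f k) \<le> (\<Sum>k\<in>K. cmod (f k))" using k K by (intro member_le_sum) auto
    finally show ?thesis by simp
  qed
  moreover have "1 + (\<Sum>k\<in>K. cmod (f k)) > 0" by (simp add: add_pos_nonneg sum_nonneg)
  ultimately show ?thesis using that by blast
qed

lemma almost_periodic_mult:
  assumes f: "almost_periodic f" and h: "almost_periodic h"
  shows "almost_periodic (\<lambda>g. f g * h g)"
proof (rule almost_periodic_combine[OF f h])
  obtain B where B: "B > 0" "\<And>g. g \<in> carrier G \<Longrightarrow> cmod (f g) \<le> B"
    using almost_periodic_bounded[OF f] by blast
  obtain D where D: "D > 0" "\<And>g. g \<in> carrier G \<Longrightarrow> cmod (h g) \<le> D"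
    using almost_periodic_bounded[OF h] by blast
  fix \<epsilon> :: real assume \<epsilon>: "\<epsilon> > 0"
  have "cmod (f u * h u - f v * h v) < \<epsilon>"
    if "cmod (f u - f v) < \<epsilon> / (B + D)" "cmod (h u - h v) < \<epsilon> / (B + D)" "u \<in> carrier G" "v \<in> carrier G" for u v
  proof -
    have "f u * h u - f v * h v = f u * (h u - h v) + (f u - f v) * h v" by (simp add: algebra_simps)
    then have "cmod (f u * h u - f v * h v) \<le> cmod (f u) * cmod (h u - h v) + cmod (f u - f v) * cmod (h v)"
      by (metis norm_mult norm_triangle_ineq)
    also have "\<dots> \<le> B * cmod (h u - h v) + cmod (f u - f v) * D"
      using B D that by (intro add_mono mult_right_mono mult_left_mono) auto
    also have "\<dots> < B * (\<epsilon> / (B + D)) + \<epsilon> / (B + D) * D"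
      using B D that by (intro add_strict_mono mult_strict_left_mono mult_strict_right_mono) auto
    also have "\<dots> = (B + D) * (\<epsilon> / (B + D))" by (simp only: distrib_right mult.commute)
    also have "\<dots> = \<epsilon>" using B D by simp
    finally show ?thesis .
  qed
  then show "\<exists>\<delta>>0. \<forall>u\<in>carrier G. \<forall>v\<in>carrier G. cmod (f u - f v) < \<delta> \<longrightarrow> cmod (h u - h v) < \<delta> \<longrightarrow>
      cmod (f u * h u - f v * h v) < \<epsilon>"
    using \<epsilon> B D by (intro exI[of _ "\<epsilon> / (B + D)"]) auto
qed

section \<open>Left and right averages\<close>

lemma left_average_append_map:
  assumes "ys \<noteq> []" "set xs \<subseteq> carrier G" "set ys \<subseteq> carrier G" "g \<in> carrier G"
  shows "left_average ys (left_average xs f) g = left_average [x \<otimes> y. y \<leftarrow> ys, x \<leftarrow> xs] f g"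
proof -
  \<comment> \<open>The inner average evaluates \<open>f\<close> at
    \<open>x \<otimes> (y \<otimes> g)\<close>, so its translations stand on the left in the
    products.\<close>
  have "(\<Sum>y\<leftarrow>ys. left_average xs f (y \<otimes> g)) = (\<Sum>z\<leftarrow>[x \<otimes> y. y \<leftarrow> ys, x \<leftarrow> xs]. f (z \<otimes> g)) / of_nat (length xs)"
    using assms(3)
  proof (induction ys)
    case (Cons y ys)
    have "(\<Sum>x\<leftarrow>xs. f (x \<otimes> (y \<otimes> g))) = (\<Sum>x\<leftarrow>xs. f (x \<otimes> y \<otimes> g))"
      using Cons.prems assms by (intro arg_cong[where f=sum_list] map_cong) (auto simp: m_assoc)
    moreover have "(\<Sum>y\<leftarrow>ys. left_average xs f (y \<otimes> g))
        = (\<Sum>z\<leftarrow>[x \<otimes> y. y \<leftarrow> ys, x \<leftarrow> xs]. f (z \<otimes> g)) / of_nat (length xs)"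
      using Cons by simp
    ultimately show ?case by (simp add: left_average_def add_divide_distrib comp_def)
  qed simp
  moreover have "length [x \<otimes> y. y \<leftarrow> ys, x \<leftarrow> xs] = length ys * length xs"
    by (induction ys) auto
  ultimately show ?thesis by (simp add: left_average_def[of ys] left_average_def[of "concat _"] mult.commute)
qed

lemma left_average_nearly:
  assumes "xs \<noteq> []" "set xs \<subseteq> carrier G" "g \<in> carrier G"
    and "\<And>x. x \<in> carrier G \<Longrightarrow> cmod (f x - c) < \<epsilon>"
  shows "cmod (left_average xs f g - c) < \<epsilon>"
proof -
  have "cmod ((\<Sum>x\<leftarrow>xs. f (x \<otimes> g)) - of_nat (length xs) * c) < of_nat (length xs) * \<epsilon>"
    using assms(1,2)
  proof (induction xs rule: list_nonempty_induct)
    case (single x)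
    then show ?case using assms by simp
  next
    case (cons x xs)
    have "cmod (f (x \<otimes> g) - c) < \<epsilon>" using cons assms by simp
    then have "cmod ((f (x \<otimes> g) - c) + ((\<Sum>x\<leftarrow>xs. f (x \<otimes> g)) - of_nat (length xs) * c)) < \<epsilon> + of_nat (length xs) * \<epsilon>"
      using cons by (intro norm_triangle_lt add_strict_mono) auto
    then show ?case by (simp add: algebra_simps)
  qed
  moreover have "(\<Sum>x\<leftarrow>xs. f (x \<otimes> g)) - of_nat (length xs) * c = of_nat (length xs) * (left_average xs f g - c)"
    using assms(1) by (simp add: left_average_def algebra_simps)
  ultimately show ?thesis using assms(1) by (simp add: norm_mult)
qed

lemma right_average_inv:
  assumes "set xs \<subseteq> carrier G" "g \<in> carrier G"
  shows "right_average xs f g = left_average (map (\<lambda>x. inv x) xs) (\<lambda>g. f (inv g)) (inv g)"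
proof -
  have "(\<Sum>x\<leftarrow>xs. f (g \<otimes> x)) = (\<Sum>x\<leftarrow>xs. f (inv (inv x \<otimes> inv g)))"
    using assms by (intro arg_cong[where f=sum_list] map_cong) (auto simp: inv_mult_group)
  then show ?thesis by (simp add: right_average_def left_average_def comp_def)
qed

lemma right_average_nearly:
  assumes xs: "xs \<noteq> []" "set xs \<subseteq> carrier G" and g: "g \<in> carrier G"
    and f: "\<And>x. x \<in> carrier G \<Longrightarrow> cmod (f x - c) < \<epsilon>"
  shows "cmod (right_average xs f g - c) < \<epsilon>"
  unfolding right_average_inv[OF xs(2) g]
  by (rule left_average_nearly) (use assms in auto)

lemma left_right_average_commute:
  assumes "set xs \<subseteq> carrier G" "set ys \<subseteq> carrier G" "g \<in> carrier G"
  shows "right_average ys (left_average xs f) g = left_average xs (right_average ys f) g"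
proof -
  have "(\<Sum>y\<leftarrow>ys. \<Sum>x\<leftarrow>xs. f (x \<otimes> (g \<otimes> y))) = (\<Sum>x\<leftarrow>xs. \<Sum>y\<leftarrow>ys. f (x \<otimes> g \<otimes> y))"
    using assms(1,2)
  proof (induction ys)
    case (Cons y ys)
    have "(\<Sum>x\<leftarrow>xs. f (x \<otimes> (g \<otimes> y))) = (\<Sum>x\<leftarrow>xs. f (x \<otimes> g \<otimes> y))"
      using Cons.prems assms by (intro arg_cong[where f=sum_list] map_cong) (auto simp: m_assoc)
    moreover have "(\<Sum>y\<leftarrow>ys. \<Sum>x\<leftarrow>xs. f (x \<otimes> (g \<otimes> y))) = (\<Sum>x\<leftarrow>xs. \<Sum>y\<leftarrow>ys. f (x \<otimes> g \<otimes> y))"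
      using Cons by simp
    ultimately show ?case by (simp add: sum_list_addf)
  qed simp
  then show ?thesis
    by (simp add: left_average_def right_average_def divide_inverse sum_list_mult_const)
qed

text \<open>The double average over \<open>xs\<close> on the left and \<open>ys\<close> on the right
  is a right average of values near \<open>c\<close> and, in the other order, a left average of
  values near \<open>d\<close>. By commutation these are the same number.\<close>

lemma mean_eq_right_mean:
  assumes "has_mean f c" "has_right_mean f d"
  shows "c = d"
proof (rule ccontr)
  assume "c \<noteq> d"
  define \<epsilon> where "\<epsilon> = cmod (c - d) / 2"
  have \<epsilon>: "\<epsilon> > 0" using \<open>c \<noteq> d\<close> by (simp add: \<epsilon>_def)
  obtain xs where xs: "xs \<noteq> []" "set xs \<subseteq> carrier G"
    "\<And>g. g \<in> carrier G \<Longrightarrow> cmod (left_average xs f g - c) < \<epsilon>"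
    using has_meanE[OF assms(1) \<epsilon>] by metis
  obtain ys where ys: "ys \<noteq> []" "set ys \<subseteq> carrier G"
    "\<And>g. g \<in> carrier G \<Longrightarrow> cmod (right_average ys f g - d) < \<epsilon>"
    using has_right_meanE[OF assms(2) \<epsilon>] by metis
  have "cmod (right_average ys (left_average xs f) \<one> - c) < \<epsilon>"
    by (rule right_average_nearly) (use xs ys in auto)
  moreover have "cmod (left_average xs (right_average ys f) \<one> - d) < \<epsilon>"
    by (rule left_average_nearly) (use xs ys in auto)
  ultimately have "cmod (c - d) < 2 * \<epsilon>"
    unfolding left_right_average_commute[OF xs(2) ys(2) one_closed]
    using norm_triangle_ineq4[of "left_average xs (right_average ys f) \<one> - d" "left_average xs (right_average ys f) \<one> - c"]
    by simp
  then show False by (simp add: \<epsilon>_def)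
qed

lemma has_right_mean_left_average:
  assumes "has_right_mean f c" and xs: "xs \<noteq> []" "set xs \<subseteq> carrier G"
  shows "has_right_mean (left_average xs f) c"
  unfolding has_right_mean_def
proof (intro allI impI)
  fix \<epsilon> :: real assume "\<epsilon> > 0"
  then obtain ys where ys: "ys \<noteq> []" "set ys \<subseteq> carrier G"
    "\<And>g. g \<in> carrier G \<Longrightarrow> cmod (right_average ys f g - c) < \<epsilon>"
    using has_right_meanE[OF assms(1)] by metis
  have "cmod (right_average ys (left_average xs f) g - c) < \<epsilon>" if "g \<in> carrier G" for g
    unfolding left_right_average_commute[OF xs(2) ys(2) that]
    by (rule left_average_nearly) (use xs ys that in auto)
  then show "\<exists>ys. ys \<noteq> [] \<and> set ys \<subseteq> carrier G \<and>
      (\<forall>g\<in>carrier G. cmod (right_average ys (left_average xs f) g - c) < \<epsilon>)"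
    using ys by blast
qed

text \<open>If \<open>s\<close> bounds a left average \<open>F\<close> of \<open>f\<close> from above and \<open>F\<close> drops by \<open>\<delta>\<close> somewhere, then
  averaging \<open>F\<close> over \<open>n\<close> translates that move this drop into every cell lowers the bound by
  \<open>\<delta> / (2 n)\<close>; the point is that \<open>n\<close> depends on \<open>f\<close> and \<open>\<delta>\<close> only.\<close>

lemma oscillation_decrease:
  assumes f: "almost_periodic f" and \<delta>: "\<delta> > 0"
  obtains n :: nat where "n > 0"
    "\<And>xs s x0. xs \<noteq> [] \<Longrightarrow> set xs \<subseteq> carrier G \<Longrightarrow> x0 \<in> carrier G \<Longrightarrow>
      (\<And>g. g \<in> carrier G \<Longrightarrow> Re (left_average xs f g) \<le> s) \<Longrightarrow> Re (left_average xs f x0) \<le> s - \<delta> \<Longrightarrow>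
      \<exists>ys. ys \<noteq> [] \<and> set ys \<subseteq> carrier G \<and>
        (\<forall>g\<in>carrier G. Re (left_average ys (left_average xs f) g) \<le> s - \<delta> / (2 * real n))"
proof -
  \<comment> \<open>Cells of variation below \<delta> / 2 leave half of the drop for one of the
    \<open>n\<close> translates, and the average over all of them keeps \<delta> / (2 n).\<close>
  obtain l :: "'a \<Rightarrow> nat" where l: "finite (l ` carrier G)"
    "\<And>k k' x y. k \<in> carrier G \<Longrightarrow> k' \<in> carrier G \<Longrightarrow> l k = l k' \<Longrightarrow> x \<in> carrier G \<Longrightarrow> y \<in> carrier G \<Longrightarrow>
      cmod (f (x \<otimes> k \<otimes> y) - f (x \<otimes> k' \<otimes> y)) < \<delta> / 2"
    using almost_periodicE[OF f, of "\<delta> / 2"] \<delta> by auto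
  obtain K where K: "K \<subseteq> carrier G" "finite K" "l ` carrier G = l ` K"
    using finite_subset_image[OF l(1) order_refl] by metis
  obtain ks where ks: "set ks = K" using K(2) finite_list by blast
  have ks0: "ks \<noteq> []" using K(3) ks one_closed by force
  show ?thesis
  proof (rule that[of "length ks"])
    show "length ks > 0" using ks0 by simp
    fix xs s x0
    assume xs: "xs \<noteq> []" "set xs \<subseteq> carrier G" and x0: "x0 \<in> carrier G"
      and s: "\<And>g. g \<in> carrier G \<Longrightarrow> Re (left_average xs f g) \<le> s"
      and drop: "Re (left_average xs f x0) \<le> s - \<delta>"
    let ?F = "left_average xs f"
    define ys where "ys = map (\<lambda>k. x0 \<otimes> inv k) ks"
    have F_close: "cmod (?F (x \<otimes> k) - ?F (x \<otimes> k')) \<le> \<delta> / 2"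
      if "k \<in> carrier G" "k' \<in> carrier G" "l k = l k'" "x \<in> carrier G" for k k' x
    proof -
      have "cmod ((\<Sum>z\<leftarrow>xs. f (z \<otimes> (x \<otimes> k))) - (\<Sum>z\<leftarrow>xs. f (z \<otimes> (x \<otimes> k')))) \<le> of_nat (length xs) * (\<delta> / 2)"
        using xs(2)
      proof (induction xs)
        case (Cons z xs)
        have "cmod (f (z \<otimes> (x \<otimes> k)) - f (z \<otimes> (x \<otimes> k'))) \<le> \<delta> / 2"
          using l(2)[of k k' "z \<otimes> x" \<one>] that Cons.prems by (simp add: m_assoc)
        then have "cmod ((f (z \<otimes> (x \<otimes> k)) - f (z \<otimes> (x \<otimes> k'))) +
            ((\<Sum>z\<leftarrow>xs. f (z \<otimes> (x \<otimes> k))) - (\<Sum>z\<leftarrow>xs. f (z \<otimes> (x \<otimes> k'))))) \<le> \<delta> / 2 + of_nat (length xs) * (\<delta> / 2)"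
          using Cons by (intro norm_triangle_le add_mono) auto
        then show ?case by (simp add: algebra_simps)
      qed simp
      moreover have "(\<Sum>z\<leftarrow>xs. f (z \<otimes> (x \<otimes> k))) - (\<Sum>z\<leftarrow>xs. f (z \<otimes> (x \<otimes> k')))
          = of_nat (length xs) * (?F (x \<otimes> k) - ?F (x \<otimes> k'))"
        using xs(1) by (simp add: left_average_def algebra_simps)
      ultimately show ?thesis using xs(1) by (simp add: norm_mult)
    qed
    have "Re (left_average ys ?F g) \<le> s - \<delta> / (2 * real (length ks))" if g: "g \<in> carrier G" for g
    proof -
      obtain k where k: "k \<in> set ks" "l g = l k" using K g ks by blast
      have kc: "k \<in> carrier G" using k K ks by blast
      have "cmod (?F (x0 \<otimes> inv k \<otimes> g) - ?F (x0 \<otimes> inv k \<otimes> k)) \<le> \<delta> / 2"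
        using F_close[of g k "x0 \<otimes> inv k"] g k kc x0 by simp
      moreover have "x0 \<otimes> inv k \<otimes> k = x0" using kc x0 by (simp add: m_assoc)
      ultimately have "Re (?F (x0 \<otimes> inv k \<otimes> g)) - Re (?F x0) \<le> \<delta> / 2"
        using abs_Re_le_cmod[of "?F (x0 \<otimes> inv k \<otimes> g) - ?F x0"] by simp
      then have 1: "Re (?F (x0 \<otimes> inv k \<otimes> g)) \<le> s - \<delta> / 2" using drop by linarith
      have "(\<Sum>k\<leftarrow>ks. Re (?F (x0 \<otimes> inv k \<otimes> g))) \<le> of_nat (length ks) * s - \<delta> / 2"
        using k(1) ks K(1)
      proof -
        have ksc: "set ks \<subseteq> carrier G" using ks K by blast
        have all: "(\<Sum>k\<leftarrow>zs. Re (?F (x0 \<otimes> inv k \<otimes> g))) \<le> of_nat (length zs) * s" if "set zs \<subseteq> carrier G" for zs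
          using that
        proof (induction zs)
          case (Cons z zs)
          then show ?case using s[of "x0 \<otimes> inv z \<otimes> g"] x0 g by (simp add: algebra_simps)
        qed simp
        obtain as bs where ab: "ks = as @ k # bs" using k(1) split_list by metis
        then show ?thesis using all[of as] all[of bs] 1 ksc by (simp add: algebra_simps)
      qed
      moreover have "Re (\<Sum>k\<leftarrow>zs. h k) = (\<Sum>k\<leftarrow>zs. Re (h k))" for zs and h :: "'a \<Rightarrow> complex"
        by (induction zs) auto
      ultimately have "Re (\<Sum>k\<leftarrow>ks. ?F (x0 \<otimes> inv k \<otimes> g)) \<le> of_nat (length ks) * s - \<delta> / 2"
        by metis
      moreover have "left_average ys F g = (\<Sum>k\<leftarrow>ks. F (x0 \<otimes> inv k \<otimes> g)) / of_nat (length ks)" for F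
        by (simp add: left_average_def ys_def comp_def)
      ultimately have "Re (left_average ys ?F g) \<le> (of_nat (length ks) * s - \<delta> / 2) / of_nat (length ks)"
        using ks0 by (simp add: Re_divide_of_nat divide_right_mono)
      also have "\<dots> = s - \<delta> / (2 * real (length ks))" using ks0 by (simp add: field_simps)
      finally show ?thesis .
    qed
    moreover have "ys \<noteq> []" "set ys \<subseteq> carrier G" using ks0 ks K x0 by (auto simp: ys_def)
    ultimately show "\<exists>ys. ys \<noteq> [] \<and> set ys \<subseteq> carrier G \<and>
        (\<forall>g\<in>carrier G. Re (left_average ys (left_average xs f) g) \<le> s - \<delta> / (2 * real (length ks)))"
      by blast
  qed
qed

text \<open>The infimum over all left averages of the oscillation of the real part is zero, since
  otherwise the previous lemma would lower it by a fixed amount.\<close>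

lemma small_oscillation:
  assumes f: "almost_periodic f" and \<epsilon>: "\<epsilon> > 0"
  shows "\<exists>xs. xs \<noteq> [] \<and> set xs \<subseteq> carrier G \<and>
    (\<forall>g\<in>carrier G. \<forall>h\<in>carrier G. Re (left_average xs f g) - Re (left_average xs f h) \<le> \<epsilon>)"
proof (rule ccontr)
  assume neg: "\<not> ?thesis"
  define W where "W = {w. \<exists>xs s. xs \<noteq> [] \<and> set xs \<subseteq> carrier G \<and>
    (\<forall>g\<in>carrier G. s - w \<le> Re (left_average xs f g) \<and> Re (left_average xs f g) \<le> s)}"
  have W_eps: "\<epsilon> \<le> w" if "w \<in> W" for w
  proof (rule ccontr)
    assume "\<not> \<epsilon> \<le> w"
    obtain xs s where xs: "xs \<noteq> []" "set xs \<subseteq> carrier G"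
      "\<forall>g\<in>carrier G. s - w \<le> Re (left_average xs f g) \<and> Re (left_average xs f g) \<le> s"
      using \<open>w \<in> W\<close> unfolding W_def by auto
    have "Re (left_average xs f g) - Re (left_average xs f h) \<le> \<epsilon>" if "g \<in> carrier G" "h \<in> carrier G" for g h
      using bspec[OF xs(3) that(1)] bspec[OF xs(3) that(2)] \<open>\<not> \<epsilon> \<le> w\<close> by linarith
    then show False using neg xs by blast
  qed
  obtain B where B: "B > 0" "\<And>g. g \<in> carrier G \<Longrightarrow> cmod (f g) \<le> B"
    using almost_periodic_bounded[OF f] by blast
  have "B - 2 * B \<le> Re (left_average [\<one>] f g) \<and> Re (left_average [\<one>] f g) \<le> B" if "g \<in> carrier G" for g
    using B(2)[OF that] abs_Re_le_cmod[of "f g"] that by (auto simp: left_average_def abs_le_iff)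
  then have WB: "2 * B \<in> W" unfolding W_def by (intro CollectI exI[of _ "[\<one>]"] exI[of _ B]) auto
  have bd: "bdd_below W" using W_eps by (rule bdd_belowI[of _ \<epsilon>])
  \<comment> \<open>The drop used is \<epsilon> / 2: an average that never falls to
    \<open>s - \<epsilon> / 2\<close> would put \<epsilon> / 2 into \<open>W\<close>, whose members
    are at least \<epsilon>.\<close>
  have "\<epsilon> / 2 > 0" using \<epsilon> by simp
  then obtain n :: nat where n: "n > 0"
    "\<And>xs s x0. xs \<noteq> [] \<Longrightarrow> set xs \<subseteq> carrier G \<Longrightarrow> x0 \<in> carrier G \<Longrightarrow>
      (\<And>g. g \<in> carrier G \<Longrightarrow> Re (left_average xs f g) \<le> s) \<Longrightarrow> Re (left_average xs f x0) \<le> s - \<epsilon> / 2 \<Longrightarrow>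
      \<exists>ys. ys \<noteq> [] \<and> set ys \<subseteq> carrier G \<and>
        (\<forall>g\<in>carrier G. Re (left_average ys (left_average xs f) g) \<le> s - \<epsilon> / 2 / (2 * real n))"
    using oscillation_decrease[OF f] by metis
  define d where "d = \<epsilon> / 2 / (2 * real n)"
  have d: "d > 0" using \<epsilon> n by (simp add: d_def)
  then obtain w where w: "w \<in> W" "w < Inf W + d"
    using WB cInf_lessD[of W "Inf W + d"] by fastforce
  obtain xs s where xs: "xs \<noteq> []" "set xs \<subseteq> carrier G"
    and xs': "\<forall>g\<in>carrier G. s - w \<le> Re (left_average xs f g) \<and> Re (left_average xs f g) \<le> s"
    using w unfolding W_def by auto
  note xs = xs bspec[OF xs']
  have "\<exists>x0\<in>carrier G. Re (left_average xs f x0) \<le> s - \<epsilon> / 2"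
  proof (rule ccontr)
    assume *: "\<not> ?thesis"
    have "s - \<epsilon> / 2 \<le> Re (left_average xs f g) \<and> Re (left_average xs f g) \<le> s" if "g \<in> carrier G" for g
      using * xs(3)[OF that] that by (meson linear)
    then have "\<epsilon> / 2 \<in> W" unfolding W_def using xs by blast
    then show False using W_eps[of "\<epsilon> / 2"] \<epsilon> by simp
  qed
  then obtain x0 where x0: "x0 \<in> carrier G" "Re (left_average xs f x0) \<le> s - \<epsilon> / 2" by blast
  obtain ys where ys: "ys \<noteq> []" "set ys \<subseteq> carrier G"
    and ys': "\<forall>g\<in>carrier G. Re (left_average ys (left_average xs f) g) \<le> s - d"
    using n(2)[OF xs(1,2) x0(1) _ x0(2)] xs(3) unfolding d_def by metis
  note ys = ys bspec[OF ys']
  define zs where "zs = [x \<otimes> y. y \<leftarrow> ys, x \<leftarrow> xs]"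
  have zs: "zs \<noteq> []" "set zs \<subseteq> carrier G"
    using xs(1,2) ys(1,2) by (auto simp: zs_def neq_Nil_conv)
  have eq: "left_average zs f g = left_average ys (left_average xs f) g" if "g \<in> carrier G" for g
    unfolding zs_def by (rule left_average_append_map[symmetric]) (use xs ys that in auto)
  have low: "s - w \<le> Re (left_average ys (left_average xs f) g)" if g: "g \<in> carrier G" for g
  proof -
    have "of_nat (length us) * (s - w) \<le> (\<Sum>y\<leftarrow>us. Re (left_average xs f (y \<otimes> g)))" if "set us \<subseteq> carrier G" for us
      using that
    proof (induction us)
      case (Cons u us)
      then show ?case using xs(3)[of "u \<otimes> g"] g by (simp add: algebra_simps)
    qed simp
    moreover have "Re (\<Sum>y\<leftarrow>us. h y) = (\<Sum>y\<leftarrow>us. Re (h y))" for us and h :: "'a \<Rightarrow> complex"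
      by (induction us) auto
    ultimately have "of_nat (length ys) * (s - w) \<le> Re (\<Sum>y\<leftarrow>ys. left_average xs f (y \<otimes> g))"
      using ys(2) by simp
    then show ?thesis using ys(1) by (simp add: left_average_def[of ys] field_simps)
  qed
  have "(s - d) - (w - d) \<le> Re (left_average zs f g) \<and> Re (left_average zs f g) \<le> s - d"
    if "g \<in> carrier G" for g
    using low[OF that] ys(3)[OF that] eq[OF that] by simp
  then have "w - d \<in> W" unfolding W_def using zs by blast
  then have "Inf W \<le> w - d" using bd by (rule cInf_lower)
  then show False using w by simp
qed

section \<open>Existence and uniqueness of the mean\<close>

lemma left_average_cmult: "left_average xs (\<lambda>g. c * f g) g = c * left_average xs f g"
  by (simp add: left_average_def sum_list_const_mult)

lemma left_average_add: "left_average xs (\<lambda>g. f g + h g) g = left_average xs f g + left_average xs h g"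
  by (simp add: left_average_def sum_list_addf add_divide_distrib)

lemma left_average_diff_Re_le:
  assumes "xs \<noteq> []" "set xs \<subseteq> carrier G" "g \<in> carrier G" "h \<in> carrier G"
    and "\<And>x y. x \<in> carrier G \<Longrightarrow> y \<in> carrier G \<Longrightarrow> Re (f x) - Re (f y) \<le> \<epsilon>"
  shows "Re (left_average xs f g) - Re (left_average xs f h) \<le> \<epsilon>"
proof -
  have "Re (\<Sum>x\<leftarrow>us. f (x \<otimes> g)) - Re (\<Sum>x\<leftarrow>us. f (x \<otimes> h)) \<le> of_nat (length us) * \<epsilon>"
    if "set us \<subseteq> carrier G" for us
    using that
  proof (induction us)
    case (Cons u us)
    then show ?case using assms(5)[of "u \<otimes> g" "u \<otimes> h"] assms(3,4) by (simp add: algebra_simps)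
  qed simp
  from this[OF assms(2)] show ?thesis
    using assms(1) by (simp add: left_average_def field_simps)
qed

text \<open>One average flattens the real part. A second one is chosen for
  \<open>- \<i> * F\<close>, whose real part is the imaginary part of \<open>F\<close>, and it
  cannot increase the oscillation of the real part again.\<close>

lemma small_oscillation_cmod:
  assumes f: "almost_periodic f" and \<epsilon>: "\<epsilon> > 0"
  obtains xs where "xs \<noteq> []" "set xs \<subseteq> carrier G"
    "\<And>g h. g \<in> carrier G \<Longrightarrow> h \<in> carrier G \<Longrightarrow> cmod (left_average xs f g - left_average xs f h) < \<epsilon>"
proof -
  have \<epsilon>3: "\<epsilon> / 3 > 0" using \<epsilon> by simp
  obtain xs where xs: "xs \<noteq> []" "set xs \<subseteq> carrier G"
    "\<forall>g\<in>carrier G. \<forall>h\<in>carrier G. Re (left_average xs f g) - Re (left_average xs f h) \<le> \<epsilon> / 3"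
    using small_oscillation[OF f \<epsilon>3] by auto
  define F where "F = left_average xs f"
  have "almost_periodic (\<lambda>g. - \<i> * F g)"
    unfolding F_def using f xs by (intro almost_periodic_cmult almost_periodic_left_average)
  then obtain ys where ys: "ys \<noteq> []" "set ys \<subseteq> carrier G"
    "\<forall>g\<in>carrier G. \<forall>h\<in>carrier G. Re (left_average ys (\<lambda>g. - \<i> * F g) g)
        - Re (left_average ys (\<lambda>g. - \<i> * F g) h) \<le> \<epsilon> / 3"
    using small_oscillation \<epsilon>3 by meson
  define zs where "zs = [x \<otimes> y. y \<leftarrow> ys, x \<leftarrow> xs]"
  have zs: "zs \<noteq> []" "set zs \<subseteq> carrier G"
    using xs(1,2) ys(1,2) by (auto simp: zs_def neq_Nil_conv)
  have eq: "left_average zs f g = left_average ys F g" if "g \<in> carrier G" for g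
    unfolding zs_def F_def by (rule left_average_append_map[symmetric]) (use xs ys that in auto)
  have Re: "Re (left_average zs f g) - Re (left_average zs f h) \<le> \<epsilon> / 3"
    if "g \<in> carrier G" "h \<in> carrier G" for g h
    unfolding eq[OF that(1)] eq[OF that(2)]
    using left_average_diff_Re_le[OF ys(1,2) that, of F "\<epsilon> / 3"] xs(3) by (simp add: F_def)
  have Im: "Im (left_average zs f g) - Im (left_average zs f h) \<le> \<epsilon> / 3"
    if "g \<in> carrier G" "h \<in> carrier G" for g h
  proof -
    have "Re (left_average ys (\<lambda>g. - \<i> * F g) g) = Im (left_average ys F g)" for g
      unfolding left_average_cmult by simp
    then show ?thesis using ys(3) that by (simp only: eq)
  qed
  have "cmod (left_average zs f g - left_average zs f h) < \<epsilon>"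
    if "g \<in> carrier G" "h \<in> carrier G" for g h
  proof -
    have "cmod (left_average zs f g - left_average zs f h) \<le>
       \<bar>Re (left_average zs f g - left_average zs f h)\<bar> + \<bar>Im (left_average zs f g - left_average zs f h)\<bar>"
      by (rule cmod_le)
    then show ?thesis using Re[OF that] Re[OF that(2,1)] Im[OF that] Im[OF that(2,1)] \<epsilon> by simp
  qed
  then show ?thesis using that zs by blast
qed

lemma small_right_oscillation_cmod:
  assumes f: "almost_periodic f" and \<epsilon>: "\<epsilon> > 0"
  obtains xs where "xs \<noteq> []" "set xs \<subseteq> carrier G"
    "\<And>g h. g \<in> carrier G \<Longrightarrow> h \<in> carrier G \<Longrightarrow> cmod (right_average xs f g - right_average xs f h) < \<epsilon>"
proof -
  obtain xs where xs: "xs \<noteq> []" "set xs \<subseteq> carrier G"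
    "\<And>g h. g \<in> carrier G \<Longrightarrow> h \<in> carrier G \<Longrightarrow>
       cmod (left_average xs (\<lambda>g. f (inv g)) g - left_average xs (\<lambda>g. f (inv g)) h) < \<epsilon>"
    using small_oscillation_cmod[OF almost_periodic_inv[OF f] \<epsilon>] by metis
  define ys where "ys = map (\<lambda>x. inv x) xs"
  have ys: "set ys \<subseteq> carrier G" using xs by (auto simp: ys_def)
  have "map (\<lambda>x. inv x) ys = xs" using xs(2) by (auto simp: ys_def comp_def subset_iff intro!: map_idI)
  then have "right_average ys f g = left_average xs (\<lambda>g. f (inv g)) (inv g)" if "g \<in> carrier G" for g
    using right_average_inv[OF ys that, of f] by simp
  then show ?thesis using that[of ys] ys xs by (simp add: ys_def)
qed

text \<open>A nearly constant left average \<open>l n\<close> and a nearly constant right average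
  \<open>r k\<close> are both close to the same double average, hence to each other, for all
  \<open>n\<close> and \<open>k\<close>. Comparing two values of \<open>l\<close> with one value of
  \<open>r\<close> shows that \<open>l\<close> is Cauchy, and its limit is approximated from both
  sides.\<close>

lemma mean_exists:
  assumes f: "almost_periodic f"
  obtains c where "has_mean f c" "has_right_mean f c"
proof -
  have "\<exists>xs. xs \<noteq> [] \<and> set xs \<subseteq> carrier G \<and> (\<forall>g\<in>carrier G. \<forall>h\<in>carrier G.
      cmod (left_average xs f g - left_average xs f h) < inverse (real (Suc n)))" for n
    using small_oscillation_cmod[OF f, of "inverse (real (Suc n))"] by (metis inverse_positive_iff_positive of_nat_0_less_iff zero_less_Suc)
  then obtain xs where xs: "\<And>n. xs n \<noteq> []" "\<And>n. set (xs n) \<subseteq> carrier G"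
    and xs_osc: "\<And>n. \<forall>g\<in>carrier G. \<forall>h\<in>carrier G.
      cmod (left_average (xs n) f g - left_average (xs n) f h) < inverse (real (Suc n))"
    by metis
  have "\<exists>zs. zs \<noteq> [] \<and> set zs \<subseteq> carrier G \<and> (\<forall>g\<in>carrier G. \<forall>h\<in>carrier G.
      cmod (right_average zs f g - right_average zs f h) < inverse (real (Suc n)))" for n
    using small_right_oscillation_cmod[OF f, of "inverse (real (Suc n))"] by (metis inverse_positive_iff_positive of_nat_0_less_iff zero_less_Suc)
  then obtain zs where zs: "\<And>n. zs n \<noteq> []" "\<And>n. set (zs n) \<subseteq> carrier G"
    and zs_osc: "\<And>n. \<forall>g\<in>carrier G. \<forall>h\<in>carrier G.
      cmod (right_average (zs n) f g - right_average (zs n) f h) < inverse (real (Suc n))"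
    by metis
  define l where "l n = left_average (xs n) f \<one>" for n
  define r where "r n = right_average (zs n) f \<one>" for n
  have lr: "cmod (l n - r k) < inverse (real (Suc n)) + inverse (real (Suc k))" for n k
  proof -
    have "cmod (right_average (zs k) (left_average (xs n) f) \<one> - l n) < inverse (real (Suc n))"
      using xs_osc[of n] by (intro right_average_nearly zs) (auto simp: l_def)
    moreover have "cmod (left_average (xs n) (right_average (zs k) f) \<one> - r k) < inverse (real (Suc k))"
      using zs_osc[of k] by (intro left_average_nearly xs) (auto simp: r_def)
    ultimately show ?thesis
      unfolding left_right_average_commute[OF xs(2) zs(2) one_closed]
      using norm_triangle_ineq4[of "left_average (xs n) (right_average (zs k) f) \<one> - r k"
          "left_average (xs n) (right_average (zs k) f) \<one> - l n"] by simp
  qed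
  have inv_less: "inverse (real (Suc n)) < \<epsilon>" if "inverse (real (Suc M)) < \<epsilon>" "n \<ge> M" for n M \<epsilon>
    by (rule le_less_trans[OF _ that(1)]) (use that(2) in \<open>simp add: field_simps\<close>)
  have "Cauchy l"
  proof (rule CauchyI)
    fix \<epsilon> :: real assume "\<epsilon> > 0"
    then obtain M where M: "inverse (real (Suc M)) < \<epsilon> / 4"
      using reals_Archimedean[of "\<epsilon> / 4"] by auto
    have "norm (l m - l n) < \<epsilon>" if "m \<ge> M" "n \<ge> M" for m n
      using lr[of m M] lr[of n M] inv_less[OF M that(1)] inv_less[OF M that(2)] M
        norm_triangle_ineq4[of "l m - r M" "l n - r M"] by simp
    then show "\<exists>M. \<forall>m\<ge>M. \<forall>n\<ge>M. norm (l m - l n) < \<epsilon>" by blast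
  qed
  then obtain c where c: "l \<longlonglongrightarrow> c" using Cauchy_convergent_iff convergent_def by blast
  have ev: "\<exists>n. cmod (l n - c) < \<epsilon> / 4 \<and> inverse (real (Suc n)) < \<epsilon> / 4" if \<epsilon>: "\<epsilon> > 0" for \<epsilon> :: real
  proof -
    obtain M where M: "inverse (real (Suc M)) < \<epsilon> / 4"
      using reals_Archimedean[of "\<epsilon> / 4"] \<epsilon> by auto
    obtain N where N: "\<And>n. n \<ge> N \<Longrightarrow> cmod (l n - c) < \<epsilon> / 4"
      using LIMSEQ_D[OF c, of "\<epsilon> / 4"] \<epsilon> by auto
    show ?thesis using N[of "max M N"] inv_less[OF M, of "max M N"] by (intro exI[of _ "max M N"]) simp
  qed
  have "has_mean f c"
    unfolding has_mean_def
  proof (intro allI impI)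
    fix \<epsilon> :: real assume "\<epsilon> > 0"
    then obtain n where n: "cmod (l n - c) < \<epsilon> / 4" "inverse (real (Suc n)) < \<epsilon> / 4" using ev by blast
    have "cmod (left_average (xs n) f g - c) < \<epsilon>" if "g \<in> carrier G" for g
    proof -
      have "cmod (left_average (xs n) f g - l n) < inverse (real (Suc n))"
        using xs_osc[of n] that by (simp add: l_def)
      then show ?thesis
        using n \<open>\<epsilon> > 0\<close> norm_triangle_ineq[of "left_average (xs n) f g - l n" "l n - c"] by simp
    qed
    then show "\<exists>xs. xs \<noteq> [] \<and> set xs \<subseteq> carrier G \<and> (\<forall>g\<in>carrier G. cmod (left_average xs f g - c) < \<epsilon>)"
      using xs by blast
  qed
  moreover have "has_right_mean f c"
    unfolding has_right_mean_def
  proof (intro allI impI)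
    fix \<epsilon> :: real assume "\<epsilon> > 0"
    then obtain n where n: "cmod (l n - c) < \<epsilon> / 4" "inverse (real (Suc n)) < \<epsilon> / 4" using ev by blast
    have "cmod (right_average (zs n) f g - c) < \<epsilon>" if "g \<in> carrier G" for g
    proof -
      have "cmod (right_average (zs n) f g - r n) < inverse (real (Suc n))"
        using zs_osc[of n] that by (simp add: r_def)
      then show ?thesis
        using n lr[of n n] norm_triangle_ineq[of "right_average (zs n) f g - r n" "l n - c"]
          norm_triangle_ineq4[of "right_average (zs n) f g - r n + (l n - c)" "l n - r n"] by simp
    qed
    then show "\<exists>xs. xs \<noteq> [] \<and> set xs \<subseteq> carrier G \<and> (\<forall>g\<in>carrier G. cmod (right_average xs f g - c) < \<epsilon>)"
      using zs by blast
  qed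
  ultimately show ?thesis using that by blast
qed

lemma mean_eqI:
  assumes f: "almost_periodic f" and c: "has_mean f c"
  shows "mean f = c"
proof -
  have "d = c" if "has_mean f d" for d
    using mean_exists[OF f] mean_eq_right_mean c that by metis
  then show ?thesis unfolding mean_def using c by blast
qed

lemma has_mean_mean: "almost_periodic f \<Longrightarrow> has_mean f (mean f)"
  using mean_exists mean_eqI by metis

lemma has_right_mean_mean: "almost_periodic f \<Longrightarrow> has_right_mean f (mean f)"
  using mean_exists mean_eqI by metis

text \<open>The right mean of \<open>f\<close> survives a left average because the two kinds of
  averages commute, and it determines the left mean.\<close>

lemma mean_left_average:
  assumes f: "almost_periodic f" and xs: "xs \<noteq> []" "set xs \<subseteq> carrier G"
  shows "mean (left_average xs f) = mean f"
  using mean_eq_right_mean[OF has_mean_mean[OF almost_periodic_left_average[OF f xs(2)]]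
      has_right_mean_left_average[OF has_right_mean_mean[OF f] xs]] .

section \<open>Linearity, invariance and positivity of the mean\<close>

lemma mean_cong:
  assumes "\<And>g. g \<in> carrier G \<Longrightarrow> f g = h g"
  shows "mean f = mean h"
proof -
  have "left_average xs f g = left_average xs h g" if "set xs \<subseteq> carrier G" "g \<in> carrier G" for xs g
    using that assms unfolding left_average_def
    by (intro arg_cong2[where f="(/)"] arg_cong[where f=sum_list] map_cong) auto
  then have "has_mean f c \<longleftrightarrow> has_mean h c" for c
    unfolding has_mean_def by (metis (no_types, lifting))
  then show ?thesis by (simp add: mean_def)
qed

text \<open>One list has to serve both summands. The list \<open>ys\<close> is chosen for the
  average of \<open>h\<close> over \<open>xs\<close>, which has the same mean as \<open>h\<close>;
  the additional averaging preserves the estimate that \<open>xs\<close> gives for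
  \<open>f\<close>.\<close>

lemma mean_add:
  assumes f: "almost_periodic f" and h: "almost_periodic h"
  shows "mean (\<lambda>g. f g + h g) = mean f + mean h"
proof (rule mean_eqI)
  show "almost_periodic (\<lambda>g. f g + h g)" using f h by (rule almost_periodic_add)
  show "has_mean (\<lambda>g. f g + h g) (mean f + mean h)"
    unfolding has_mean_def
  proof (intro allI impI)
    fix \<epsilon> :: real assume "\<epsilon> > 0"
    then have \<epsilon>: "\<epsilon> / 2 > 0" by simp
    obtain xs where xs: "xs \<noteq> []" "set xs \<subseteq> carrier G"
      "\<And>g. g \<in> carrier G \<Longrightarrow> cmod (left_average xs f g - mean f) < \<epsilon> / 2"
      using has_meanE[OF has_mean_mean[OF f] \<epsilon>] by metis
    obtain ys where ys: "ys \<noteq> []" "set ys \<subseteq> carrier G"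
      "\<And>g. g \<in> carrier G \<Longrightarrow> cmod (left_average ys (left_average xs h) g - mean h) < \<epsilon> / 2"
      using has_meanE[OF has_mean_mean[OF almost_periodic_left_average[OF h xs(2)]] \<epsilon>]
        mean_left_average[OF h xs(1,2)] by metis
    define zs where "zs = [x \<otimes> y. y \<leftarrow> ys, x \<leftarrow> xs]"
    have zs: "zs \<noteq> []" "set zs \<subseteq> carrier G"
      using xs(1,2) ys(1,2) by (auto simp: zs_def neq_Nil_conv)
    have eq: "left_average zs u g = left_average ys (left_average xs u) g" if "g \<in> carrier G" for g u
      unfolding zs_def by (rule left_average_append_map[symmetric]) (use xs ys that in auto)
    have "cmod (left_average zs (\<lambda>g. f g + h g) g - (mean f + mean h)) < \<epsilon>" if g: "g \<in> carrier G" for g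
    proof -
      have "cmod (left_average zs f g - mean f) < \<epsilon> / 2"
        unfolding eq[OF g] by (rule left_average_nearly[OF ys(1,2) g xs(3)])
      moreover have "cmod (left_average zs h g - mean h) < \<epsilon> / 2"
        unfolding eq[OF g] by (rule ys(3)[OF g])
      ultimately show ?thesis
        using norm_triangle_ineq[of "left_average zs f g - mean f" "left_average zs h g - mean h"]
        by (simp add: left_average_add algebra_simps)
    qed
    then show "\<exists>xs. xs \<noteq> [] \<and> set xs \<subseteq> carrier G \<and>
        (\<forall>g\<in>carrier G. cmod (left_average xs (\<lambda>g. f g + h g) g - (mean f + mean h)) < \<epsilon>)"
      using zs by blast
  qed
qed

lemma mean_lipschitz:
  assumes f: "almost_periodic f" and F: "almost_periodic F"
    and "\<And>xs g. set xs \<subseteq> carrier G \<Longrightarrow> xs \<noteq> [] \<Longrightarrow> g \<in> carrier G \<Longrightarrow>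
      cmod (left_average xs F g - d) \<le> B * cmod (left_average xs f g - mean f)"
  shows "mean F = d"
proof (rule mean_eqI[OF F])
  show "has_mean F d"
    unfolding has_mean_def
  proof (intro allI impI)
    fix \<epsilon> :: real assume "\<epsilon> > 0"
    then have "\<epsilon> / (\<bar>B\<bar> + 1) > 0" by simp
    then obtain xs where xs: "xs \<noteq> []" "set xs \<subseteq> carrier G"
      "\<And>g. g \<in> carrier G \<Longrightarrow> cmod (left_average xs f g - mean f) < \<epsilon> / (\<bar>B\<bar> + 1)"
      using has_meanE[OF has_mean_mean[OF f]] by metis
    have "cmod (left_average xs F g - d) < \<epsilon>" if g: "g \<in> carrier G" for g
    proof -
      have "cmod (left_average xs F g - d) \<le> (\<bar>B\<bar> + 1) * cmod (left_average xs f g - mean f)"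
        using assms(3)[OF xs(2,1) g] mult_right_mono[of B "\<bar>B\<bar> + 1" "cmod (left_average xs f g - mean f)"]
        by force
      also have "\<dots> < \<epsilon>" using xs(3)[OF g] by (simp add: field_simps)
      finally show ?thesis .
    qed
    then show "\<exists>xs. xs \<noteq> [] \<and> set xs \<subseteq> carrier G \<and> (\<forall>g\<in>carrier G. cmod (left_average xs F g - d) < \<epsilon>)"
      using xs by blast
  qed
qed

lemma mean_cmult:
  assumes f: "almost_periodic f"
  shows "mean (\<lambda>g. c * f g) = c * mean f"
  by (rule mean_lipschitz[OF f almost_periodic_cmult[OF f], where B = "cmod c"])
    (simp add: left_average_cmult norm_mult flip: right_diff_distrib)

lemma left_average_cnj: "left_average xs (\<lambda>g. cnj (f g)) g = cnj (left_average xs f g)"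
proof -
  have "(\<Sum>x\<leftarrow>xs. cnj (f (x \<otimes> g))) = cnj (\<Sum>x\<leftarrow>xs. f (x \<otimes> g))" by (induction xs) auto
  then show ?thesis by (simp add: left_average_def)
qed

lemma mean_cnj:
  assumes f: "almost_periodic f"
  shows "mean (\<lambda>g. cnj (f g)) = cnj (mean f)"
  by (rule mean_lipschitz[OF f almost_periodic_cnj[OF f], where B = 1])
    (simp add: left_average_cnj flip: complex_cnj_diff)

text \<open>The left average of the translate at \<open>g\<close> is that of \<open>f\<close> at
  \<open>g \<otimes> a\<close>, and the approximation by the mean is uniform in
  \<open>g\<close>.\<close>

lemma mean_translate_right:
  assumes f: "almost_periodic f" and a: "a \<in> carrier G"
  shows "mean (\<lambda>g. f (g \<otimes> a)) = mean f"
proof (rule mean_eqI)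
  show "almost_periodic (\<lambda>g. f (g \<otimes> a))" using f a by (rule almost_periodic_translate_right)
  show "has_mean (\<lambda>g. f (g \<otimes> a)) (mean f)"
    unfolding has_mean_def
  proof (intro allI impI)
    fix \<epsilon> :: real assume \<epsilon>: "\<epsilon> > 0"
    obtain xs where xs: "xs \<noteq> []" "set xs \<subseteq> carrier G"
      "\<And>g. g \<in> carrier G \<Longrightarrow> cmod (left_average xs f g - mean f) < \<epsilon>"
      using has_meanE[OF has_mean_mean[OF f] \<epsilon>] by metis
    have "left_average xs (\<lambda>g. f (g \<otimes> a)) g = left_average xs f (g \<otimes> a)" if "g \<in> carrier G" for g
      unfolding left_average_def using that a xs(2)
      by (intro arg_cong2[where f="(/)"] arg_cong[where f=sum_list] map_cong) (auto simp: m_assoc)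
    then show "\<exists>xs. xs \<noteq> [] \<and> set xs \<subseteq> carrier G \<and>
        (\<forall>g\<in>carrier G. cmod (left_average xs (\<lambda>g. f (g \<otimes> a)) g - mean f) < \<epsilon>)"
      using xs a by (intro exI[of _ xs]) auto
  qed
qed

lemma mean_Re_ge:
  assumes f: "almost_periodic f" and ge: "\<And>g. g \<in> carrier G \<Longrightarrow> Re (f g) \<ge> b"
  shows "Re (mean f) \<ge> b"
proof (rule field_le_epsilon)
  fix e :: real assume e: "e > 0"
  obtain xs where xs: "xs \<noteq> []" "set xs \<subseteq> carrier G"
    "\<And>g. g \<in> carrier G \<Longrightarrow> cmod (left_average xs f g - mean f) < e"
    using has_meanE[OF has_mean_mean[OF f] e] by metis
  have "of_nat (length us) * b \<le> Re (\<Sum>x\<leftarrow>us. f (x \<otimes> \<one>))" if "set us \<subseteq> carrier G" for us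
    using that
  proof (induction us)
    case (Cons u us)
    then show ?case using ge[of u] by (simp add: algebra_simps)
  qed simp
  from this[OF xs(2)] have "b \<le> Re (left_average xs f \<one>)"
    using xs(1) by (simp add: left_average_def field_simps)
  then show "b \<le> Re (mean f) + e"
    using xs(3)[OF one_closed] abs_Re_le_cmod[of "left_average xs f \<one> - mean f"] by simp
qed

lemma mean_nonneg:
  assumes f: "almost_periodic f" and "\<And>g. g \<in> carrier G \<Longrightarrow> f g = complex_of_real (r g)"
    and "\<And>g. g \<in> carrier G \<Longrightarrow> r g \<ge> 0"
  shows "mean f = complex_of_real (Re (mean f))" "Re (mean f) \<ge> 0"
proof -
  have "cnj (mean f) = mean (\<lambda>g. cnj (f g))" using mean_cnj[OF f] by simp
  also have "\<dots> = mean f" by (rule mean_cong) (use assms in simp)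
  finally show "mean f = complex_of_real (Re (mean f))" by (simp add: complex_eq_iff)
  show "Re (mean f) \<ge> 0" by (rule mean_Re_ge[OF f]) (use assms in simp)
qed

text \<open>If \<open>g\<close> lies in the cell of the representative \<open>k\<close>, then
  \<open>f\<close> at \<open>inv k \<otimes> g\<close> is close to \<open>f \<one>\<close>. Hence
  the left average over the inverses of the representatives is everywhere at least
  \<open>r \<one> / 2\<close> divided by their number, and it has the same mean as
  \<open>f\<close>.\<close>

lemma mean_pos:
  assumes f: "almost_periodic f" and r: "\<And>g. g \<in> carrier G \<Longrightarrow> f g = complex_of_real (r g)"
    and nonneg: "\<And>g. g \<in> carrier G \<Longrightarrow> r g \<ge> 0" and pos: "r \<one> > 0"
  shows "Re (mean f) > 0"
proof -
  obtain l :: "'a \<Rightarrow> nat" where l: "finite (l ` carrier G)"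
    "\<And>k k' x y. k \<in> carrier G \<Longrightarrow> k' \<in> carrier G \<Longrightarrow> l k = l k' \<Longrightarrow> x \<in> carrier G \<Longrightarrow> y \<in> carrier G \<Longrightarrow>
      cmod (f (x \<otimes> k \<otimes> y) - f (x \<otimes> k' \<otimes> y)) < r \<one> / 2"
    using almost_periodicE[OF f, of "r \<one> / 2"] pos by auto
  obtain K where K: "K \<subseteq> carrier G" "finite K" "l ` carrier G = l ` K"
    using finite_subset_image[OF l(1) order_refl] by metis
  obtain ks where ks: "set ks = K" using K(2) finite_list by blast
  define us where "us = map (\<lambda>k. inv k) ks"
  have "K \<noteq> {}" using K(3) one_closed by blast
  then have us: "us \<noteq> []" "set us \<subseteq> carrier G"
    using K(1) ks by (auto simp: us_def)
  have "r \<one> / 2 / real (length us) \<le> Re (left_average us f g)" if g: "g \<in> carrier G" for g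
  proof -
    obtain k where k: "k \<in> set ks" "l g = l k" using K g ks by blast
    have kc: "k \<in> carrier G" using k K ks by blast
    have "cmod (f (inv k \<otimes> g) - f (inv k \<otimes> k)) < r \<one> / 2"
      using l(2)[of g k "inv k" \<one>] g k kc by simp
    then have "\<bar>r (inv k \<otimes> g) - r \<one>\<bar> < r \<one> / 2"
      using r kc g by (simp flip: of_real_diff)
    then have "r (inv k \<otimes> g) \<ge> r \<one> / 2" unfolding abs_less_iff by linarith
    have nn: "0 \<le> (\<Sum>x\<leftarrow>vs. r (x \<otimes> g))" if "set vs \<subseteq> carrier G" for vs
      using that nonneg g by (intro sum_list_nonneg) auto
    obtain as bs where ab: "us = as @ inv k # bs"
      using k(1) split_list[of "inv k" us] by (auto simp: us_def)
    have "r \<one> / 2 \<le> (\<Sum>x\<leftarrow>us. r (x \<otimes> g))"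
      using nn[of as] nn[of bs] ab us \<open>r (inv k \<otimes> g) \<ge> r \<one> / 2\<close> by simp
    moreover have "Re (\<Sum>x\<leftarrow>vs. f (x \<otimes> g)) = (\<Sum>x\<leftarrow>vs. r (x \<otimes> g))" if "set vs \<subseteq> carrier G" for vs
      using that by (induction vs) (auto simp: r g)
    ultimately show ?thesis using us by (simp add: left_average_def field_simps)
  qed
  then have "r \<one> / 2 / real (length us) \<le> Re (mean (left_average us f))"
    by (intro mean_Re_ge almost_periodic_left_average f us)
  then have "r \<one> / 2 / real (length us) \<le> Re (mean f)"
    using mean_left_average[OF f us] by simp
  moreover have "r \<one> / 2 / real (length us) > 0" using pos us by simp
  ultimately show ?thesis by linarith
qed

lemma mean_Re_le:
  assumes f: "almost_periodic f" and le: "\<And>g. g \<in> carrier G \<Longrightarrow> Re (f g) \<le> b"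
  shows "Re (mean f) \<le> b"
proof -
  have "- b \<le> Re (mean (\<lambda>g. - 1 * f g))"
    using le by (intro mean_Re_ge almost_periodic_cmult f) auto
  also have "mean (\<lambda>g. - 1 * f g) = - mean f" using mean_cmult[OF f, of "- 1"] by simp
  finally show ?thesis by simp
qed

text \<open>A unimodular factor \<open>c\<close> makes the mean of \<open>c f\<close> real and
  nonnegative; then only the real part of \<open>c f\<close> has to be compared with
  \<open>b\<close>.\<close>

lemma mean_norm_le:
  assumes f: "almost_periodic f" and b: "almost_periodic b"
    and le: "\<And>g. g \<in> carrier G \<Longrightarrow> cmod (f g) \<le> Re (b g)"
  shows "cmod (mean f) \<le> Re (mean b)"
proof (cases "mean f = 0")
  case True
  have "0 \<le> Re (mean b)"
    using le by (intro mean_Re_ge b) (meson norm_ge_zero order_trans)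
  then show ?thesis using True by simp
next
  case False
  define c where "c = cnj (mean f) / complex_of_real (cmod (mean f))"
  have "cnj (mean f) * mean f = complex_of_real (cmod (mean f)) * complex_of_real (cmod (mean f))"
    using complex_norm_square[of "mean f"] by (simp add: mult.commute power2_eq_square)
  then have c: "cmod c = 1" "c * mean f = complex_of_real (cmod (mean f))"
    using False by (simp_all add: c_def norm_divide)
  have "0 \<le> Re (mean (\<lambda>g. b g + (- c) * f g))"
  proof (rule mean_Re_ge)
    show "almost_periodic (\<lambda>g. b g + (- c) * f g)"
      by (intro almost_periodic_add almost_periodic_cmult b f)
    fix g assume g: "g \<in> carrier G"
    have "Re (c * f g) \<le> cmod (f g)"
      using complex_Re_le_cmod[of "c * f g"] c by (simp add: norm_mult)
    then show "0 \<le> Re (b g + (- c) * f g)" using le[OF g] by simp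
  qed
  also have "mean (\<lambda>g. b g + (- c) * f g) = mean b - c * mean f"
    using mean_add[OF b almost_periodic_cmult[OF f, of "- c"]] mean_cmult[OF f, of "- c"] by simp
  finally show ?thesis using c by simp
qed

text \<open>\<open>N g\<close> measures how much inserting \<open>g\<close> anywhere in the argument
  changes \<open>F\<close>. The bump \<open>max 0 (\<epsilon> - N g)\<close> equals \<epsilon> at
  the identity, so it has a positive mean and can be normalised. Where it is nonzero,
  \<open>F (g \<otimes> k)\<close> differs from \<open>F k\<close> by less than \<epsilon>,
  uniformly in \<open>k\<close>.\<close>

lemma approximate_identity:
  assumes F: "almost_periodic F" and \<epsilon>: "\<epsilon> > 0"
  obtains \<beta> where "almost_periodic \<beta>"
    "\<And>k. k \<in> carrier G \<Longrightarrow> cmod (mean (\<lambda>g. F (g \<otimes> k) * \<beta> g) - F k) \<le> \<epsilon>"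
proof -
  let ?D = "\<lambda>g (x, y). cmod (F (x \<otimes> g \<otimes> y) - F (x \<otimes> y))"
  define N where "N g = (SUP z\<in>carrier G \<times> carrier G. ?D g z)" for g
  obtain B where B: "B > 0" "\<And>g. g \<in> carrier G \<Longrightarrow> cmod (F g) \<le> B"
    using almost_periodic_bounded[OF F] by blast
  have bd: "bdd_above (?D g ` (carrier G \<times> carrier G))" if "g \<in> carrier G" for g
  proof (rule bdd_aboveI2)
    fix z assume "z \<in> carrier G \<times> carrier G"
    then obtain x y where z: "z = (x, y)" "x \<in> carrier G" "y \<in> carrier G" by blast
    then show "?D g z \<le> 2 * B"
      using B(2)[of "x \<otimes> g \<otimes> y"] B(2)[of "x \<otimes> y"] that
        norm_triangle_ineq4[of "F (x \<otimes> g \<otimes> y)" "F (x \<otimes> y)"] by simp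
  qed
  have ne: "carrier G \<times> carrier G \<noteq> {}" using one_closed by blast
  have N_ge: "cmod (F (x \<otimes> g \<otimes> y) - F (x \<otimes> y)) \<le> N g"
    if "g \<in> carrier G" "x \<in> carrier G" "y \<in> carrier G" for g x y
    using cSUP_upper[OF _ bd[OF that(1)], of "(x, y)"] that by (simp add: N_def)
  have N_le: "N g \<le> c" if "\<And>x y. x \<in> carrier G \<Longrightarrow> y \<in> carrier G \<Longrightarrow> cmod (F (x \<otimes> g \<otimes> y) - F (x \<otimes> y)) \<le> c" for g c
    unfolding N_def by (rule cSUP_least[OF ne]) (use that in auto)
  define r where "r g = max 0 (\<epsilon> - N g)" for g
  define \<beta>0 where "\<beta>0 g = complex_of_real (r g)" for g
  have ap: "almost_periodic \<beta>0"
    unfolding almost_periodic_def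
  proof (intro allI impI)
    fix e :: real assume "e > 0"
    then have "e / 2 > 0" by simp
    then obtain l :: "'a \<Rightarrow> nat" where l: "finite (l ` carrier G)"
      "\<And>k k' x y. k \<in> carrier G \<Longrightarrow> k' \<in> carrier G \<Longrightarrow> l k = l k' \<Longrightarrow> x \<in> carrier G \<Longrightarrow> y \<in> carrier G \<Longrightarrow>
        cmod (F (x \<otimes> k \<otimes> y) - F (x \<otimes> k' \<otimes> y)) < e / 2"
      using almost_periodicE[OF F] by blast
    \<comment> \<open>The supremum in \<open>N\<close> runs over factors on both sides, so
      \<open>u\<close> and \<open>v\<close> are absorbed into \<open>x\<close> and \<open>y\<close>
      and the labelling for \<open>F\<close> also serves \<open>N\<close>.\<close>
    have le: "N (u \<otimes> k \<otimes> v) \<le> N (u \<otimes> k' \<otimes> v) + e / 2"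
      if "k \<in> carrier G" "k' \<in> carrier G" "l k = l k'" "u \<in> carrier G" "v \<in> carrier G" for k k' u v
    proof (rule N_le)
      fix x y assume xy: "x \<in> carrier G" "y \<in> carrier G"
      have "cmod (F (x \<otimes> (u \<otimes> k \<otimes> v) \<otimes> y) - F (x \<otimes> (u \<otimes> k' \<otimes> v) \<otimes> y)) < e / 2"
        using l(2)[of k k' "x \<otimes> u" "v \<otimes> y"] that xy by (simp add: m_assoc)
      moreover have "cmod (F (x \<otimes> (u \<otimes> k' \<otimes> v) \<otimes> y) - F (x \<otimes> y)) \<le> N (u \<otimes> k' \<otimes> v)"
        using that xy by (intro N_ge) auto
      ultimately show "cmod (F (x \<otimes> (u \<otimes> k \<otimes> v) \<otimes> y) - F (x \<otimes> y)) \<le> N (u \<otimes> k' \<otimes> v) + e / 2"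
        using norm_triangle_ineq[of "F (x \<otimes> (u \<otimes> k \<otimes> v) \<otimes> y) - F (x \<otimes> (u \<otimes> k' \<otimes> v) \<otimes> y)"
            "F (x \<otimes> (u \<otimes> k' \<otimes> v) \<otimes> y) - F (x \<otimes> y)"] by simp
    qed
    have "cmod (\<beta>0 (x \<otimes> k \<otimes> y) - \<beta>0 (x \<otimes> k' \<otimes> y)) < e"
      if *: "k \<in> carrier G" "k' \<in> carrier G" "l k = l k'" "x \<in> carrier G" "y \<in> carrier G" for k k' x y
    proof -
      have "\<bar>N (x \<otimes> k \<otimes> y) - N (x \<otimes> k' \<otimes> y)\<bar> \<le> e / 2"
        using le[OF *] le[OF *(2,1) *(3)[symmetric] *(4,5)] by linarith
      then have "\<bar>r (x \<otimes> k \<otimes> y) - r (x \<otimes> k' \<otimes> y)\<bar> \<le> e / 2" unfolding r_def by linarith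
      then have "cmod (\<beta>0 (x \<otimes> k \<otimes> y) - \<beta>0 (x \<otimes> k' \<otimes> y)) \<le> e / 2"
        unfolding \<beta>0_def of_real_diff[symmetric] norm_of_real .
      then show ?thesis using \<open>e > 0\<close> by linarith
    qed
    then show "\<exists>l :: 'a \<Rightarrow> nat. finite (l ` carrier G) \<and>
       (\<forall>k\<in>carrier G. \<forall>k'\<in>carrier G. l k = l k' \<longrightarrow>
         (\<forall>x\<in>carrier G. \<forall>y\<in>carrier G. cmod (\<beta>0 (x \<otimes> k \<otimes> y) - \<beta>0 (x \<otimes> k' \<otimes> y)) < e))"
      using l(1) by blast
  qed
  have "N \<one> \<le> 0" by (rule N_le) simp
  then have "r \<one> > 0" using \<epsilon> by (simp add: r_def)
  moreover have "r g \<ge> 0" for g by (simp add: r_def)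
  ultimately have m: "Re (mean \<beta>0) > 0" by (intro mean_pos[OF ap]) (auto simp: \<beta>0_def)
  have m_eq: "mean \<beta>0 = complex_of_real (Re (mean \<beta>0))"
    by (rule mean_nonneg(1)[OF ap]) (auto simp: \<beta>0_def r_def)
  define \<beta> where "\<beta> g = (1 / mean \<beta>0) * \<beta>0 g" for g
  have \<beta>_real: "\<beta> g = complex_of_real (r g / Re (mean \<beta>0))" for g
    using arg_cong[OF m_eq, of "\<lambda>m. 1 / m * \<beta>0 g"] by (simp add: \<beta>_def \<beta>0_def)
  have \<beta>: "almost_periodic \<beta>" unfolding \<beta>_def by (intro almost_periodic_cmult ap)
  have \<beta>1: "mean \<beta> = 1"
    unfolding \<beta>_def using mean_cmult[OF ap, of "1 / mean \<beta>0"] m by auto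
  show ?thesis
  proof (rule that[OF \<beta>])
    fix k assume k: "k \<in> carrier G"
    have Fk: "almost_periodic (\<lambda>g. F (g \<otimes> k) * \<beta> g)"
      by (intro almost_periodic_mult almost_periodic_translate_right F \<beta> k)
    have "mean (\<lambda>g. F (g \<otimes> k) * \<beta> g + (- F k) * \<beta> g) = mean (\<lambda>g. F (g \<otimes> k) * \<beta> g) - F k"
      using mean_add[OF Fk almost_periodic_cmult[OF \<beta>, of "- F k"]] mean_cmult[OF \<beta>, of "- F k"] \<beta>1 by simp
    also have "(\<lambda>g. F (g \<otimes> k) * \<beta> g + (- F k) * \<beta> g) = (\<lambda>g. (F (g \<otimes> k) - F k) * \<beta> g)"
      by (simp add: fun_eq_iff algebra_simps)
    finally have eq: "mean (\<lambda>g. (F (g \<otimes> k) - F k) * \<beta> g) = mean (\<lambda>g. F (g \<otimes> k) * \<beta> g) - F k" .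
    have "cmod (mean (\<lambda>g. (F (g \<otimes> k) - F k) * \<beta> g)) \<le> Re (mean (\<lambda>g. complex_of_real \<epsilon> * \<beta> g))"
    proof (rule mean_norm_le)
      have "almost_periodic (\<lambda>g. F (g \<otimes> k) + (- F k))"
        by (intro almost_periodic_add almost_periodic_const almost_periodic_translate_right F k)
      then show "almost_periodic (\<lambda>g. (F (g \<otimes> k) - F k) * \<beta> g)"
        using almost_periodic_mult[OF _ \<beta>] by simp
      show "almost_periodic (\<lambda>g. complex_of_real \<epsilon> * \<beta> g)" by (intro almost_periodic_cmult \<beta>)
      fix g assume g: "g \<in> carrier G"
      have le: "cmod (F (g \<otimes> k) - F k) \<le> N g" using N_ge[OF g one_closed k] g k by simp
      have "cmod (F (g \<otimes> k) - F k) * r g \<le> \<epsilon> * r g"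
      proof (cases "N g < \<epsilon>")
        case True
        then show ?thesis using le by (intro mult_right_mono) (auto simp: r_def)
      qed (simp add: r_def)
      then have "cmod (F (g \<otimes> k) - F k) * (r g / Re (mean \<beta>0)) \<le> \<epsilon> * (r g / Re (mean \<beta>0))"
        using m by (simp add: divide_right_mono)
      moreover have "\<bar>r g / Re (mean \<beta>0)\<bar> = r g / Re (mean \<beta>0)" using m by (simp add: r_def)
      moreover have "Re (complex_of_real \<epsilon> * \<beta> g) = \<epsilon> * (r g / Re (mean \<beta>0))"
        unfolding \<beta>_real of_real_mult[symmetric] Re_complex_of_real ..
      ultimately show "cmod ((F (g \<otimes> k) - F k) * \<beta> g) \<le> Re (complex_of_real \<epsilon> * \<beta> g)"
        unfolding norm_mult by (simp only: \<beta>_real norm_of_real)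
    qed
    also have "mean (\<lambda>g. complex_of_real \<epsilon> * \<beta> g) = complex_of_real \<epsilon>"
      using mean_cmult[OF \<beta>, of "complex_of_real \<epsilon>"] \<beta>1 by simp
    finally show "cmod (mean (\<lambda>g. F (g \<otimes> k) * \<beta> g) - F k) \<le> \<epsilon>" using eq by simp
  qed
qed

end

section \<open>The completion of a semi-inner product space\<close>

text \<open>No vector space axioms are required of the operations: a semidefinite form only sees its
  values.\<close>

locale semi_inner_product =
  fixes A :: "'x set" and vadd :: "'x \<Rightarrow> 'x \<Rightarrow> 'x" (infixl \<open>\<^bold>+\<close> 65)
    and sm :: "complex \<Rightarrow> 'x \<Rightarrow> 'x" (infixr \<open>\<^bold>*\<close> 75) and ip :: "'x \<Rightarrow> 'x \<Rightarrow> complex"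
  assumes nonempty: "A \<noteq> {}"
    and add_in: "x \<in> A \<Longrightarrow> y \<in> A \<Longrightarrow> x \<^bold>+ y \<in> A"
    and sm_in: "x \<in> A \<Longrightarrow> c \<^bold>* x \<in> A"
    and ip_add_left: "x \<in> A \<Longrightarrow> y \<in> A \<Longrightarrow> z \<in> A \<Longrightarrow> ip (x \<^bold>+ y) z = ip x z + ip y z"
    and ip_sm_left: "x \<in> A \<Longrightarrow> z \<in> A \<Longrightarrow> ip (c \<^bold>* x) z = c * ip x z"
    and ip_cnj: "x \<in> A \<Longrightarrow> y \<in> A \<Longrightarrow> ip y x = cnj (ip x y)"
    and ip_nonneg: "x \<in> A \<Longrightarrow> 0 \<le> Re (ip x x)"
begin

section \<open>The seminorm of a semidefinite form\<close>

definition nrm :: "'x \<Rightarrow> real" where "nrm x = sqrt (Re (ip x x))"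

abbreviation sub :: "'x \<Rightarrow> 'x \<Rightarrow> 'x" (infixl \<open>\<^bold>-\<close> 65) where "x \<^bold>- y \<equiv> x \<^bold>+ (-1) \<^bold>* y"

lemma sub_in: "x \<in> A \<Longrightarrow> y \<in> A \<Longrightarrow> x \<^bold>- y \<in> A"
  by (simp add: add_in sm_in)

lemma ip_add_right: "x \<in> A \<Longrightarrow> y \<in> A \<Longrightarrow> z \<in> A \<Longrightarrow> ip z (x \<^bold>+ y) = ip z x + ip z y"
  using ip_cnj[of "x \<^bold>+ y" z] ip_cnj[of x z] ip_cnj[of y z] by (simp add: add_in ip_add_left)

lemma ip_sm_right: "x \<in> A \<Longrightarrow> z \<in> A \<Longrightarrow> ip z (c \<^bold>* x) = cnj c * ip z x"
  using ip_cnj[of "c \<^bold>* x" z] ip_cnj[of x z] by (simp add: sm_in ip_sm_left)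

lemma ip_self: "x \<in> A \<Longrightarrow> ip x x = complex_of_real ((nrm x)\<^sup>2)"
  using ip_cnj[of x x] ip_nonneg[of x] by (simp add: nrm_def complex_eq_iff)

lemma nrm_nonneg: "x \<in> A \<Longrightarrow> 0 \<le> nrm x"
  by (simp add: nrm_def ip_nonneg)

lemma nrm_sq: "x \<in> A \<Longrightarrow> (nrm x)\<^sup>2 = Re (ip x x)"
  by (simp add: nrm_def ip_nonneg)

lemma ip_sub_left: "x \<in> A \<Longrightarrow> y \<in> A \<Longrightarrow> z \<in> A \<Longrightarrow> ip (x \<^bold>- y) z = ip x z - ip y z"
  by (simp add: ip_add_left ip_sm_left sm_in)

lemma ip_sub_right: "x \<in> A \<Longrightarrow> y \<in> A \<Longrightarrow> z \<in> A \<Longrightarrow> ip z (x \<^bold>- y) = ip z x - ip z y"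
  by (simp add: ip_add_right ip_sm_right sm_in)

text \<open>The form is evaluated at \<open>x - t b y\<close> with \<open>b = ip x y\<close> and
  real \<open>t\<close>. For nonzero \<open>nrm y\<close> the choice
  \<open>t = 1 / (nrm y)\<^sup>2\<close> gives the inequality; the degenerate case
  \<open>nrm y = 0\<close> is excluded for nonzero \<open>b\<close> by a large
  \<open>t\<close>.\<close>

lemma cauchy_schwarz:
  assumes x: "x \<in> A" and y: "y \<in> A"
  shows "cmod (ip x y) \<le> nrm x * nrm y"
proof -
  define b where "b = ip x y"
  have yx: "ip y x = cnj b" using ip_cnj[OF x y] by (simp add: b_def)
  have *: "0 \<le> (nrm x)\<^sup>2 - 2 * t * (cmod b)\<^sup>2 + t\<^sup>2 * (cmod b)\<^sup>2 * (nrm y)\<^sup>2" for t :: real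
  proof -
    let ?c = "- complex_of_real t * b"
    have c: "?c \<^bold>* y \<in> A" using y by (rule sm_in)
    have "ip (x \<^bold>+ ?c \<^bold>* y) (x \<^bold>+ ?c \<^bold>* y)
        = ip x x + cnj ?c * b + ?c * cnj b + ?c * cnj ?c * ip y y"
      using x y c by (simp add: ip_add_left ip_add_right ip_sm_left ip_sm_right add_in yx
          flip: b_def) (simp add: algebra_simps)
    also have "\<dots> = ip x x - 2 * complex_of_real t * (b * cnj b)
        + (complex_of_real t)\<^sup>2 * (b * cnj b) * ip y y"
      by (simp add: algebra_simps power2_eq_square)
    also have "\<dots> = complex_of_real ((nrm x)\<^sup>2 - 2 * t * (cmod b)\<^sup>2 + t\<^sup>2 * (cmod b)\<^sup>2 * (nrm y)\<^sup>2)"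
      using x y by (simp add: ip_self complex_norm_square[symmetric])
    finally have "Re (ip (x \<^bold>+ ?c \<^bold>* y) (x \<^bold>+ ?c \<^bold>* y))
        = (nrm x)\<^sup>2 - 2 * t * (cmod b)\<^sup>2 + t\<^sup>2 * (cmod b)\<^sup>2 * (nrm y)\<^sup>2"
      by (simp only: Re_complex_of_real)
    then show ?thesis using ip_nonneg[OF add_in[OF x c]] by simp
  qed
  have "(cmod b)\<^sup>2 \<le> (nrm x * nrm y)\<^sup>2"
  proof (cases "nrm y = 0")
    case True
    have "b = 0"
    proof (rule ccontr)
      assume "b \<noteq> 0"
      \<comment> \<open>With \<open>nrm y = 0\<close> this \<open>t\<close> makes the right-hand
        side of the quadratic inequality equal to -1.\<close>
      then show False
        using *[of "((nrm x)\<^sup>2 + 1) / (2 * (cmod b)\<^sup>2)"] True by (simp add: field_simps)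
    qed
    then show ?thesis by simp
  next
    case False
    have "(1 / (nrm y)\<^sup>2)\<^sup>2 * (cmod b)\<^sup>2 * (nrm y)\<^sup>2 = (cmod b)\<^sup>2 / (nrm y)\<^sup>2"
      using False by (simp add: power2_eq_square)
    then have "(cmod b)\<^sup>2 / (nrm y)\<^sup>2 \<le> (nrm x)\<^sup>2"
      using *[of "1 / (nrm y)\<^sup>2"] by simp
    then show ?thesis using False by (simp add: field_simps power_mult_distrib)
  qed
  then have "cmod b \<le> nrm x * nrm y"
    by (rule power2_le_imp_le) (simp add: nrm_nonneg x y)
  then show ?thesis by (simp only: b_def)
qed

lemma nrm_triangle:
  assumes x: "x \<in> A" and y: "y \<in> A"
  shows "nrm (x \<^bold>+ y) \<le> nrm x + nrm y"
proof (rule power2_le_imp_le)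
  have "(nrm (x \<^bold>+ y))\<^sup>2 = (nrm x)\<^sup>2 + 2 * Re (ip x y) + (nrm y)\<^sup>2"
    using x y ip_cnj[OF x y] by (simp add: nrm_sq add_in ip_add_left ip_add_right)
  also have "Re (ip x y) \<le> nrm x * nrm y"
    using complex_Re_le_cmod[of "ip x y"] cauchy_schwarz[OF x y] by linarith
  finally show "(nrm (x \<^bold>+ y))\<^sup>2 \<le> (nrm x + nrm y)\<^sup>2" by (simp add: power2_sum)
  show "0 \<le> nrm x + nrm y" using nrm_nonneg x y by simp
qed

lemma nrm_sm: "x \<in> A \<Longrightarrow> nrm (c \<^bold>* x) = cmod c * nrm x"
proof -
  assume x: "x \<in> A"
  have "ip (c \<^bold>* x) (c \<^bold>* x) = (c * cnj c) * ip x x"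
    using x by (simp add: ip_sm_left ip_sm_right sm_in)
  also have "\<dots> = complex_of_real ((cmod c)\<^sup>2 * (nrm x)\<^sup>2)"
    using x by (simp add: ip_self complex_norm_square[symmetric])
  finally have "Re (ip (c \<^bold>* x) (c \<^bold>* x)) = (cmod c * nrm x)\<^sup>2"
    by (simp only: Re_complex_of_real power_mult_distrib)
  then show ?thesis
    using nrm_nonneg[OF x] by (simp add: nrm_def[of "c \<^bold>* x"])
qed

text \<open>Subtracting and adding \<open>y\<close> need not return \<open>x\<close> itself, but the
  form cannot distinguish the result from \<open>x\<close>.\<close>

lemma nrm_le_sub: "x \<in> A \<Longrightarrow> y \<in> A \<Longrightarrow> nrm x \<le> nrm (x \<^bold>- y) + nrm y"
proof -
  assume x: "x \<in> A" and y: "y \<in> A"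
  have "nrm ((x \<^bold>- y) \<^bold>+ y) = nrm x"
    using x y by (simp add: nrm_def ip_sub_left ip_sub_right ip_add_left ip_add_right sm_in add_in
        ip_sm_left ip_sm_right)
  then show ?thesis using nrm_triangle[OF sub_in[OF x y] y] by simp
qed

text \<open>A vector \<open>b\<close> is identified with the functional
  \<open>a \<mapsto> ip b a\<close>, and \<phi> belongs to the completion if it is a limit of such
  functionals in the dual norm. Null vectors all become the zero functional, so no quotient has to
  be formed.\<close>

definition approximates :: "(nat \<Rightarrow> 'x) \<Rightarrow> ('x \<Rightarrow> complex) \<Rightarrow> bool" where
  "approximates b \<phi> \<longleftrightarrow> (\<forall>n. b n \<in> A) \<and>
     (\<exists>e. e \<longlonglongrightarrow> 0 \<and> (\<forall>n. \<forall>a\<in>A. cmod (\<phi> a - ip (b n) a) \<le> e n * nrm a))"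

lemma approximates_in: "approximates b \<phi> \<Longrightarrow> b n \<in> A"
  by (simp add: approximates_def)

lemma approximatesE:
  assumes "approximates b \<phi>"
  obtains e where "e \<longlonglongrightarrow> 0" "\<And>n. e n \<ge> 0" "\<And>n a. a \<in> A \<Longrightarrow> cmod (\<phi> a - ip (b n) a) \<le> e n * nrm a"
proof -
  obtain e where e: "e \<longlonglongrightarrow> 0" "\<And>n a. a \<in> A \<Longrightarrow> cmod (\<phi> a - ip (b n) a) \<le> e n * nrm a"
    using assms unfolding approximates_def by blast
  show ?thesis
  proof (rule that[of "\<lambda>n. \<bar>e n\<bar>"])
    show "(\<lambda>n. \<bar>e n\<bar>) \<longlonglongrightarrow> 0" using tendsto_rabs[OF e(1)] by simp
    show "cmod (\<phi> a - ip (b n) a) \<le> \<bar>e n\<bar> * nrm a" if "a \<in> A" for n a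
      using e(2)[OF that, of n] mult_right_mono[OF abs_ge_self[of "e n"] nrm_nonneg[OF that]] by linarith
  qed simp
qed

lemma nrm_sub_le:
  assumes x: "x \<in> A" and y: "y \<in> A" and "\<And>a. a \<in> A \<Longrightarrow> cmod (ip x a - ip y a) \<le> d * nrm a" "d \<ge> 0"
  shows "nrm (x \<^bold>- y) \<le> d"
proof (cases "nrm (x \<^bold>- y) = 0")
  case False
  have "(nrm (x \<^bold>- y))\<^sup>2 \<le> cmod (ip x (x \<^bold>- y) - ip y (x \<^bold>- y))"
    using ip_self[OF sub_in[OF x y]] x y sub_in[OF x y]
    by (metis abs_of_nonneg ip_sub_left norm_of_real order_refl zero_le_power2)
  also have "\<dots> \<le> d * nrm (x \<^bold>- y)" using assms sub_in by blast
  finally show ?thesis using False nrm_nonneg[OF sub_in[OF x y]] by (simp add: power2_eq_square)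
qed (use assms in simp)

lemma approximates_close:
  assumes b: "approximates b \<phi>" and c: "approximates c \<phi>" and "\<epsilon> > 0"
  shows "\<exists>N. \<forall>m\<ge>N. \<forall>n\<ge>N. nrm (b m \<^bold>- c n) < \<epsilon>"
proof -
  obtain e where e: "e \<longlonglongrightarrow> 0" "\<And>n. e n \<ge> 0" "\<And>n a. a \<in> A \<Longrightarrow> cmod (\<phi> a - ip (b n) a) \<le> e n * nrm a"
    using approximatesE[OF b] by blast
  obtain d where d: "d \<longlonglongrightarrow> 0" "\<And>n. d n \<ge> 0" "\<And>n a. a \<in> A \<Longrightarrow> cmod (\<phi> a - ip (c n) a) \<le> d n * nrm a"
    using approximatesE[OF c] by blast
  have le: "nrm (b m \<^bold>- c n) \<le> e m + d n" for m n
  proof (rule nrm_sub_le)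
    show "b m \<in> A" "c n \<in> A" using b c approximates_in by auto
    show "cmod (ip (b m) a - ip (c n) a) \<le> (e m + d n) * nrm a" if "a \<in> A" for a
      using e(3)[OF that, of m] d(3)[OF that, of n] norm_triangle_ineq4[of "\<phi> a - ip (c n) a" "\<phi> a - ip (b m) a"]
      by (simp add: algebra_simps)
    show "e m + d n \<ge> 0" using e d by simp
  qed
  from \<open>\<epsilon> > 0\<close> have "\<epsilon> / 2 > 0" by simp
  then obtain N M where "\<forall>n\<ge>N. e n < \<epsilon> / 2" "\<forall>n\<ge>M. d n < \<epsilon> / 2"
    using order_tendstoD(2)[OF e(1)] order_tendstoD(2)[OF d(1)] unfolding eventually_sequentially by metis
  then have "nrm (b m \<^bold>- c n) < \<epsilon>" if "m \<ge> max N M" "n \<ge> max N M" for m n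
    using le[of m n] that by (smt (verit) field_sum_of_halves max.bounded_iff)
  then show "\<exists>N. \<forall>m\<ge>N. \<forall>n\<ge>N. nrm (b m \<^bold>- c n) < \<epsilon>" by blast
qed

lemma approximates_bounded:
  assumes b: "approximates b \<phi>"
  obtains B where "B > 0" "\<And>n. nrm (b n) \<le> B"
proof -
  obtain N where N: "\<forall>m\<ge>N. \<forall>n\<ge>N. nrm (b m \<^bold>- b n) < 1"
    using approximates_close[OF b b, of 1] by auto
  define B where "B = 1 + (\<Sum>i\<le>N. nrm (b i))"
  have le: "nrm (b i) \<le> (\<Sum>i\<le>N. nrm (b i))" if "i \<le> N" for i
    using that b by (intro member_le_sum) (auto intro: nrm_nonneg approximates_in)
  have "nrm (b n) \<le> B" for n
  proof (cases "n \<le> N")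
    case True
    then show ?thesis using le[OF True] by (simp add: B_def)
  next
    case False
    then have "nrm (b n) \<le> 1 + nrm (b N)"
      using N nrm_le_sub[of "b n" "b N"] b approximates_in by (smt (verit) nle_le)
    then show ?thesis using le[of N] by (simp add: B_def)
  qed
  moreover have "B > 0" unfolding B_def using b
    by (intro add_pos_nonneg sum_nonneg) (auto intro: nrm_nonneg approximates_in)
  ultimately show ?thesis using that by blast
qed

lemma ip_diff_le:
  assumes "x \<in> A" "x' \<in> A" "y \<in> A" "y' \<in> A"
  shows "cmod (ip x y - ip x' y') \<le> nrm (x \<^bold>- x') * nrm y + nrm x' * nrm (y \<^bold>- y')"
proof -
  have "ip x y - ip x' y' = ip (x \<^bold>- x') y + ip x' (y \<^bold>- y')"
    using assms by (simp add: ip_sub_left ip_sub_right)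
  also have "cmod \<dots> \<le> cmod (ip (x \<^bold>- x') y) + cmod (ip x' (y \<^bold>- y'))" by (rule norm_triangle_ineq)
  also have "\<dots> \<le> nrm (x \<^bold>- x') * nrm y + nrm x' * nrm (y \<^bold>- y')"
    using assms by (intro add_mono cauchy_schwarz sub_in)
  finally show ?thesis .
qed

definition appr :: "('x \<Rightarrow> complex) \<Rightarrow> nat \<Rightarrow> 'x" where
  "appr \<phi> = (SOME b. approximates b \<phi>)"

lemma approximates_appr: "approximates b \<phi> \<Longrightarrow> approximates (appr \<phi>) \<phi>"
  unfolding appr_def by (rule someI[of "\<lambda>b. approximates b \<phi>"])

definition hip :: "('x \<Rightarrow> complex) \<Rightarrow> ('x \<Rightarrow> complex) \<Rightarrow> complex" where
  "hip \<phi> \<psi> = lim (\<lambda>n. ip (appr \<phi> n) (appr \<psi> n))"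

text \<open>\<open>hip\<close> is defined through chosen sequences. The estimate
  \<open>close\<close> is used twice: once for the existence of the limit and once to pass to
  arbitrary approximating sequences.\<close>

lemma hip_tendsto:
  assumes b: "approximates b \<phi>" and c: "approximates c \<psi>"
  shows "(\<lambda>n. ip (b n) (c n)) \<longlonglongrightarrow> hip \<phi> \<psi>"
proof -
  have close: "\<exists>N. \<forall>m\<ge>N. \<forall>n\<ge>N. cmod (ip (b m) (c m) - ip (b' n) (c' n)) < \<epsilon>"
    if \<epsilon>: "\<epsilon> > 0" and b: "approximates b \<phi>" "approximates b' \<phi>" and c: "approximates c \<psi>" "approximates c' \<psi>"
    for \<epsilon> b b' c c'
  proof -
    obtain B where B: "B > 0" "\<And>n. nrm (b' n) \<le> B" using approximates_bounded[OF b(2)] by blast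
    obtain C where C: "C > 0" "\<And>n. nrm (c n) \<le> C" using approximates_bounded[OF c(1)] by blast
    have "\<epsilon> / (2 * C) > 0" "\<epsilon> / (2 * B) > 0" using \<epsilon> B C by auto
    then obtain N M where N: "\<forall>m\<ge>N. \<forall>n\<ge>N. nrm (b m \<^bold>- b' n) < \<epsilon> / (2 * C)"
      and M: "\<forall>m\<ge>M. \<forall>n\<ge>M. nrm (c m \<^bold>- c' n) < \<epsilon> / (2 * B)"
      using approximates_close[OF b] approximates_close[OF c] by metis
    have "cmod (ip (b m) (c m) - ip (b' n) (c' n)) < \<epsilon>" if mn: "m \<ge> max N M" "n \<ge> max N M" for m n
    proof -
      have in_A: "b m \<in> A" "b' n \<in> A" "c m \<in> A" "c' n \<in> A" using b c approximates_in by auto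
      have "cmod (ip (b m) (c m) - ip (b' n) (c' n))
          \<le> nrm (b m \<^bold>- b' n) * nrm (c m) + nrm (b' n) * nrm (c m \<^bold>- c' n)"
        using in_A by (rule ip_diff_le)
      also have "\<dots> \<le> nrm (b m \<^bold>- b' n) * C + B * nrm (c m \<^bold>- c' n)"
        using in_A B C by (intro add_mono mult_left_mono mult_right_mono nrm_nonneg sub_in) auto
      also have "\<dots> < \<epsilon> / (2 * C) * C + B * (\<epsilon> / (2 * B))"
        using N M mn B C by (intro add_strict_mono mult_strict_left_mono mult_strict_right_mono) auto
      also have "\<dots> = \<epsilon>" using B C by simp
      finally show ?thesis .
    qed
    then show ?thesis by blast
  qed
  note appr = approximates_appr[OF b] approximates_appr[OF c]
  have "Cauchy (\<lambda>n. ip (appr \<phi> n) (appr \<psi> n))"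
    by (rule CauchyI) (use close[OF _ appr(1) appr(1) appr(2) appr(2)] in blast)
  then have L: "(\<lambda>n. ip (appr \<phi> n) (appr \<psi> n)) \<longlonglongrightarrow> hip \<phi> \<psi>"
    unfolding hip_def by (simp add: Cauchy_convergent_iff convergent_LIMSEQ_iff)
  have "(\<lambda>n. ip (b n) (c n) - ip (appr \<phi> n) (appr \<psi> n)) \<longlonglongrightarrow> 0"
    by (rule LIMSEQ_I) (use close[OF _ b appr(1) c appr(2)] in fastforce)
  from tendsto_add[OF this L] show ?thesis by simp
qed

section \<open>The completion as a Hilbert space\<close>

definition completion :: "('x \<Rightarrow> complex) normed_module" where
  "completion = \<lparr>carrier = {\<phi> \<in> extensional A. \<exists>b. approximates b \<phi>},
     mult = (\<lambda>\<phi> \<psi>. undefined), one = undefined, zero = (\<lambda>a\<in>A. 0),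
     add = (\<lambda>\<phi> \<psi>. \<lambda>a\<in>A. \<phi> a + \<psi> a), smult = (\<lambda>c \<phi>. \<lambda>a\<in>A. c * \<phi> a),
     vnorm = (\<lambda>\<phi>. sqrt (Re (hip \<phi> \<phi>)))\<rparr>"

lemma completion_simps [simp]:
  "zero completion = (\<lambda>a\<in>A. 0)" "add completion \<phi> \<psi> = (\<lambda>a\<in>A. \<phi> a + \<psi> a)"
  "smult completion c \<phi> = (\<lambda>a\<in>A. c * \<phi> a)" "vnorm completion \<phi> = sqrt (Re (hip \<phi> \<phi>))"
  by (simp_all add: completion_def)

lemma carrier_completion: "\<phi> \<in> carrier completion \<longleftrightarrow> \<phi> \<in> extensional A \<and> (\<exists>b. approximates b \<phi>)"
  by (simp add: completion_def)

lemma completionE: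
  assumes "\<phi> \<in> carrier completion"
  obtains b where "approximates b \<phi>"
  using assms carrier_completion by blast

lemma approximates_add:
  assumes "approximates b \<phi>" "approximates c \<psi>"
  shows "approximates (\<lambda>n. b n \<^bold>+ c n) (\<lambda>a\<in>A. \<phi> a + \<psi> a)"
proof -
  obtain e where e: "e \<longlonglongrightarrow> 0" "\<And>n a. a \<in> A \<Longrightarrow> cmod (\<phi> a - ip (b n) a) \<le> e n * nrm a"
    using approximatesE[OF assms(1)] by metis
  obtain d where d: "d \<longlonglongrightarrow> 0" "\<And>n a. a \<in> A \<Longrightarrow> cmod (\<psi> a - ip (c n) a) \<le> d n * nrm a"
    using approximatesE[OF assms(2)] by metis
  have *: "b n \<in> A" "c n \<in> A" for n using assms approximates_in by auto
  have "cmod ((\<lambda>a\<in>A. \<phi> a + \<psi> a) a - ip (b n \<^bold>+ c n) a) \<le> (e n + d n) * nrm a" if "a \<in> A" for n a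
    using e(2)[OF that, of n] d(2)[OF that, of n] that * norm_triangle_ineq[of "\<phi> a - ip (b n) a" "\<psi> a - ip (c n) a"]
    by (simp add: ip_add_left algebra_simps)
  moreover have "(\<lambda>n. e n + d n) \<longlonglongrightarrow> 0" using tendsto_add[OF e(1) d(1)] by simp
  ultimately show ?thesis unfolding approximates_def using * add_in by blast
qed

lemma approximates_sm:
  assumes "approximates b \<phi>"
  shows "approximates (\<lambda>n. z \<^bold>* b n) (\<lambda>a\<in>A. z * \<phi> a)"
proof -
  obtain e where e: "e \<longlonglongrightarrow> 0" "\<And>n a. a \<in> A \<Longrightarrow> cmod (\<phi> a - ip (b n) a) \<le> e n * nrm a"
    using approximatesE[OF assms(1)] by metis
  have *: "b n \<in> A" for n using assms approximates_in by auto
  have "cmod ((\<lambda>a\<in>A. z * \<phi> a) a - ip (z \<^bold>* b n) a) \<le> (cmod z * e n) * nrm a" if "a \<in> A" for n a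
  proof -
    have "cmod (z * (\<phi> a - ip (b n) a)) \<le> cmod z * (e n * nrm a)"
      using e(2)[OF that, of n] by (simp add: norm_mult mult_left_mono)
    then show ?thesis using that * by (simp add: ip_sm_left algebra_simps)
  qed
  moreover have "(\<lambda>n. cmod z * e n) \<longlonglongrightarrow> 0" using tendsto_mult[OF tendsto_const e(1)] by simp
  ultimately show ?thesis unfolding approximates_def using * sm_in by blast
qed

definition emb :: "'x \<Rightarrow> 'x \<Rightarrow> complex" where "emb b = (\<lambda>a\<in>A. ip b a)"

lemma approximates_emb: "b \<in> A \<Longrightarrow> approximates (\<lambda>n. b) (emb b)"
  unfolding approximates_def emb_def by (auto intro!: exI[of _ "\<lambda>n. 0"])

lemma emb_in: "b \<in> A \<Longrightarrow> emb b \<in> carrier completion"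
  using approximates_emb[of b] by (auto simp: carrier_completion emb_def)

lemma add_completion_in: "\<phi> \<in> carrier completion \<Longrightarrow> \<psi> \<in> carrier completion \<Longrightarrow>
    (\<lambda>a\<in>A. \<phi> a + \<psi> a) \<in> carrier completion"
  unfolding carrier_completion by (metis approximates_add restrict_extensional)

lemma sm_completion_in: "\<phi> \<in> carrier completion \<Longrightarrow> (\<lambda>a\<in>A. z * \<phi> a) \<in> carrier completion"
  unfolding carrier_completion by (metis approximates_sm restrict_extensional)

lemma zero_completion_in: "(\<lambda>a\<in>A. 0) \<in> carrier completion"
proof -
  obtain a where "a \<in> A" using nonempty by blast
  from sm_completion_in[OF emb_in[OF this], of 0] show ?thesis by simp
qed

lemma module_completion: "module complex_field completion"
proof (rule moduleI[OF cring_complex_field])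
  have ext: "\<phi> \<in> extensional A" if "\<phi> \<in> carrier completion" for \<phi>
    using that by (simp add: carrier_completion)
  show "abelian_group completion"
  proof (rule abelian_groupI)
    fix \<phi> assume \<phi>: "\<phi> \<in> carrier completion"
    show "\<exists>\<psi>\<in>carrier completion. \<psi> \<oplus>\<^bsub>completion\<^esub> \<phi> = \<zero>\<^bsub>completion\<^esub>"
      using sm_completion_in[OF \<phi>, of "-1"] by (intro bexI[of _ "\<lambda>a\<in>A. -1 * \<phi> a"]) auto
    show "\<zero>\<^bsub>completion\<^esub> \<oplus>\<^bsub>completion\<^esub> \<phi> = \<phi>"
      using ext[OF \<phi>] by (auto simp: extensional_def)
  qed (auto simp: add_completion_in zero_completion_in add.commute add.assoc)
  show "\<one>\<^bsub>complex_field\<^esub> \<odot>\<^bsub>completion\<^esub> \<phi> = \<phi>" if "\<phi> \<in> carrier completion" for \<phi>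
    using ext[OF that] by (auto simp: extensional_def)
qed (auto simp: sm_completion_in algebra_simps)

text \<open>Read as an instance of the same locale, the completion inherits Cauchy--Schwarz, the
  triangle inequality and homogeneity for \<open>hip\<close>. All axioms are limits of those on
  \<open>A\<close>.\<close>

lemma semi_inner_product_completion:
  "semi_inner_product (carrier completion) (add completion) (smult completion) hip"
proof
  show "carrier completion \<noteq> {}" using zero_completion_in by blast
  fix \<phi> \<psi> \<omega> and c :: complex
  assume "\<phi> \<in> carrier completion" "\<psi> \<in> carrier completion"
  then obtain b d where b: "approximates b \<phi>" and d: "approximates d \<psi>"
    by (metis completionE)
  have bA: "b n \<in> A" "d n \<in> A" for n using b d approximates_in by auto
  show "add completion \<phi> \<psi> \<in> carrier completion" "smult completion c \<phi> \<in> carrier completion"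
    using \<open>\<phi> \<in> carrier completion\<close> \<open>\<psi> \<in> carrier completion\<close>
    by (simp_all add: add_completion_in sm_completion_in)
  show "hip (\<phi> \<oplus>\<^bsub>completion\<^esub> \<psi>) \<omega> = hip \<phi> \<omega> + hip \<psi> \<omega>" if \<omega>: "\<omega> \<in> carrier completion"
  proof -
    obtain w where w: "approximates w \<omega>" using completionE[OF \<omega>] by blast
    have "(\<lambda>n. ip (b n) (w n) + ip (d n) (w n)) \<longlonglongrightarrow> hip \<phi> \<omega> + hip \<psi> \<omega>"
      by (intro tendsto_add hip_tendsto b d w)
    moreover have "(\<lambda>n. ip (b n) (w n) + ip (d n) (w n)) \<longlonglongrightarrow> hip (\<phi> \<oplus>\<^bsub>completion\<^esub> \<psi>) \<omega>"
      using hip_tendsto[OF approximates_add[OF b d] w] bA approximates_in[OF w] by (simp add: ip_add_left)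
    ultimately show ?thesis using LIMSEQ_unique by blast
  qed
  show "hip (c \<odot>\<^bsub>completion\<^esub> \<phi>) \<psi> = c * hip \<phi> \<psi>"
  proof -
    have "(\<lambda>n. c * ip (b n) (d n)) \<longlonglongrightarrow> c * hip \<phi> \<psi>"
      by (intro tendsto_mult tendsto_const hip_tendsto b d)
    moreover have "(\<lambda>n. c * ip (b n) (d n)) \<longlonglongrightarrow> hip (c \<odot>\<^bsub>completion\<^esub> \<phi>) \<psi>"
      using hip_tendsto[OF approximates_sm[OF b] d] bA by (simp add: ip_sm_left)
    ultimately show ?thesis using LIMSEQ_unique by blast
  qed
  show "hip \<psi> \<phi> = cnj (hip \<phi> \<psi>)"
  proof -
    have "ip (d n) (b n) = cnj (ip (b n) (d n))" for n using ip_cnj bA by blast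
    then have "(\<lambda>n. ip (d n) (b n)) \<longlonglongrightarrow> cnj (hip \<phi> \<psi>)"
      using tendsto_cnj[OF hip_tendsto[OF b d]] by simp
    then show ?thesis using hip_tendsto[OF d b] LIMSEQ_unique by blast
  qed
  show "0 \<le> Re (hip \<phi> \<phi>)"
    by (rule tendsto_lowerbound[OF tendsto_Re[OF hip_tendsto[OF b b]]]) (auto simp: ip_nonneg bA)
qed

interpretation H: semi_inner_product "carrier completion" "add completion" "smult completion" hip
  by (rule semi_inner_product_completion)

lemma vnorm_completion: "vnorm completion = H.nrm"
  by (simp add: fun_eq_iff H.nrm_def)

lemma nrm_tendsto:
  assumes "approximates b \<phi>"
  shows "(\<lambda>n. nrm (b n)) \<longlonglongrightarrow> H.nrm \<phi>"
  unfolding nrm_def H.nrm_def by (intro tendsto_intros hip_tendsto assms)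

lemma eval_tendsto:
  assumes "approximates b \<phi>" "a \<in> A"
  shows "(\<lambda>n. ip (b n) a) \<longlonglongrightarrow> \<phi> a"
proof -
  obtain e where e: "e \<longlonglongrightarrow> 0" "\<And>n a. a \<in> A \<Longrightarrow> cmod (\<phi> a - ip (b n) a) \<le> e n * nrm a"
    using approximatesE[OF assms(1)] by metis
  have "(\<lambda>n. e n * nrm a) \<longlonglongrightarrow> 0" using tendsto_mult[OF e(1) tendsto_const[of "nrm a"]] by simp
  then have "(\<lambda>n. ip (b n) a - \<phi> a) \<longlonglongrightarrow> 0"
    by (rule Lim_null_comparison[rotated]) (use e(2)[OF assms(2)] in \<open>simp add: norm_minus_commute\<close>)
  then show ?thesis by (simp add: LIM_zero_iff)
qed

lemma eval_le:
  assumes \<phi>: "\<phi> \<in> carrier completion" and a: "a \<in> A"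
  shows "cmod (\<phi> a) \<le> H.nrm \<phi> * nrm a"
proof -
  obtain b where b: "approximates b \<phi>" using \<phi> completionE by blast
  show ?thesis
  proof (rule tendsto_le[OF sequentially_bot])
    show "(\<lambda>n. nrm (b n) * nrm a) \<longlonglongrightarrow> H.nrm \<phi> * nrm a"
      by (intro tendsto_intros nrm_tendsto b)
    show "(\<lambda>n. cmod (ip (b n) a)) \<longlonglongrightarrow> cmod (\<phi> a)" by (intro tendsto_norm eval_tendsto b a)
    show "\<forall>\<^sub>F n in sequentially. cmod (ip (b n) a) \<le> nrm (b n) * nrm a"
      using cauchy_schwarz approximates_in[OF b] a by simp
  qed
qed

text \<open>Testing \<phi> at its own approximants \<open>b n\<close> gives
  \<open>(nrm (b n))\<^sup>2 \<le> (C + e n) * nrm (b n)\<close>, and the limit can be divided by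
  the norm of \<phi>. With \<open>eval_le\<close> this identifies the norm of \<phi> as its norm as
  a functional.\<close>

lemma nrm_completion_le:
  assumes \<phi>: "\<phi> \<in> carrier completion" and C: "C \<ge> 0" and le: "\<And>a. a \<in> A \<Longrightarrow> cmod (\<phi> a) \<le> C * nrm a"
  shows "H.nrm \<phi> \<le> C"
proof (cases "H.nrm \<phi> = 0")
  case False
  obtain b where b: "approximates b \<phi>" using \<phi> completionE by blast
  obtain e where e: "e \<longlonglongrightarrow> 0" "\<And>n. e n \<ge> 0" "\<And>n a. a \<in> A \<Longrightarrow> cmod (\<phi> a - ip (b n) a) \<le> e n * nrm a"
    using approximatesE[OF b] by blast
  have bA: "b n \<in> A" for n using b approximates_in by blast
  have "(nrm (b n))\<^sup>2 \<le> C * nrm (b n) + e n * nrm (b n)" for n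
  proof -
    have "(nrm (b n))\<^sup>2 = cmod (ip (b n) (b n))" by (simp add: ip_self[OF bA] flip: of_real_power)
    also have "\<dots> \<le> cmod (\<phi> (b n)) + cmod (\<phi> (b n) - ip (b n) (b n))"
      using norm_triangle_ineq4[of "\<phi> (b n)" "\<phi> (b n) - ip (b n) (b n)"] by simp
    finally show ?thesis using le[OF bA[of n]] e(3)[OF bA[of n], of n] by linarith
  qed
  moreover have "(\<lambda>n. (nrm (b n))\<^sup>2) \<longlonglongrightarrow> (H.nrm \<phi>)\<^sup>2" by (intro tendsto_intros nrm_tendsto b)
  moreover have "(\<lambda>n. C * nrm (b n) + e n * nrm (b n)) \<longlonglongrightarrow> C * H.nrm \<phi> + 0 * H.nrm \<phi>"
    by (intro tendsto_intros nrm_tendsto b e)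
  ultimately have "(H.nrm \<phi>)\<^sup>2 \<le> C * H.nrm \<phi>"
    using LIMSEQ_le by fastforce
  then show ?thesis using False H.nrm_nonneg[OF \<phi>] by (simp add: power2_eq_square)
qed (use C in simp)

lemma normed_space_completion: "complex_normed_space completion"
proof (intro complex_normed_space.intro module_completion complex_normed_space_axioms.intro)
  fix \<phi> assume \<phi>: "\<phi> \<in> carrier completion"
  show "vnorm completion \<phi> = 0 \<longleftrightarrow> \<phi> = \<zero>\<^bsub>completion\<^esub>"
  proof
    assume "vnorm completion \<phi> = 0"
    then have "\<phi> a = 0" if "a \<in> A" for a
      using eval_le[OF \<phi> that] by (simp add: vnorm_completion)
    moreover have "\<phi> \<in> extensional A" using \<phi> by (simp add: carrier_completion)
    ultimately show "\<phi> = \<zero>\<^bsub>completion\<^esub>" by (auto simp: extensional_def)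
  next
    assume "\<phi> = \<zero>\<^bsub>completion\<^esub>"
    then have "H.nrm \<phi> \<le> 0" using \<phi> by (intro nrm_completion_le) auto
    then show "vnorm completion \<phi> = 0" using H.nrm_nonneg[OF \<phi>] unfolding vnorm_completion by simp
  qed
  show "vnorm completion (c \<odot>\<^bsub>completion\<^esub> \<phi>) = cmod c * vnorm completion \<phi>" for c
    unfolding vnorm_completion by (rule H.nrm_sm[OF \<phi>])
  show "vnorm completion (\<phi> \<oplus>\<^bsub>completion\<^esub> \<psi>) \<le> vnorm completion \<phi> + vnorm completion \<psi>"
    if "\<psi> \<in> carrier completion" for \<psi>
    unfolding vnorm_completion by (rule H.nrm_triangle[OF \<phi> that])
qed

sublocale NC: complex_normed_space completion
  by (rule normed_space_completion)

lemma minus_completion: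
  assumes "\<phi> \<in> carrier completion" "\<psi> \<in> carrier completion"
  shows "\<phi> \<ominus>\<^bsub>completion\<^esub> \<psi> = (\<lambda>a\<in>A. \<phi> a - \<psi> a)"
  using NC.diff_smult[OF assms] by auto

text \<open>A Cauchy sequence of functionals converges pointwise, with an error at most \<epsilon>
  times \<open>nrm a\<close>. Approximants of its members, taken far enough out, then approximate
  the pointwise limit, which therefore belongs to the completion.\<close>

lemma complete_completion: "complex_banach_space completion"
proof (rule NC.complex_banach_spaceI)
  fix \<sigma> :: "nat \<Rightarrow> 'x \<Rightarrow> complex"
  assume \<sigma>: "range \<sigma> \<subseteq> carrier completion"
    and Cauchy: "\<And>\<epsilon>. \<epsilon> > 0 \<Longrightarrow> \<exists>N. \<forall>m\<ge>N. \<forall>n\<ge>N. vnorm completion (\<sigma> m \<ominus>\<^bsub>completion\<^esub> \<sigma> n) < \<epsilon>"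
  have \<sigma>in: "\<sigma> n \<in> carrier completion" for n using \<sigma> by blast
  have diff: "cmod (\<sigma> m a - \<sigma> n a) \<le> vnorm completion (\<sigma> m \<ominus>\<^bsub>completion\<^esub> \<sigma> n) * nrm a" if "a \<in> A" for m n a
    using eval_le[OF NC.diff_in[OF \<sigma>in \<sigma>in] that, of m n] that
    unfolding vnorm_completion by (simp add: minus_completion \<sigma>in)
  have conv: "convergent (\<lambda>n. \<sigma> n a)" if a: "a \<in> A" for a
  proof -
    have "Cauchy (\<lambda>n. \<sigma> n a)"
    proof (rule CauchyI)
      fix e :: real assume "e > 0"
      then have "e / (nrm a + 1) > 0" using nrm_nonneg[OF a] by simp
      then obtain N where N: "\<forall>m\<ge>N. \<forall>n\<ge>N. vnorm completion (\<sigma> m \<ominus>\<^bsub>completion\<^esub> \<sigma> n) < e / (nrm a + 1)"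
        using Cauchy by blast
      have "norm (\<sigma> m a - \<sigma> n a) < e" if "m \<ge> N" "n \<ge> N" for m n
      proof -
        have "cmod (\<sigma> m a - \<sigma> n a) \<le> vnorm completion (\<sigma> m \<ominus>\<^bsub>completion\<^esub> \<sigma> n) * nrm a"
          by (rule diff[OF a])
        also have "\<dots> \<le> vnorm completion (\<sigma> m \<ominus>\<^bsub>completion\<^esub> \<sigma> n) * (nrm a + 1)"
          using NC.vnorm_nonneg[OF NC.diff_in[OF \<sigma>in \<sigma>in]] by (intro mult_left_mono) auto
        also have "\<dots> < e / (nrm a + 1) * (nrm a + 1)"
          using N that nrm_nonneg[OF a] by (intro mult_strict_right_mono) auto
        also have "\<dots> = e" using nrm_nonneg[OF a] by simp
        finally show ?thesis .
      qed
      then show "\<exists>M. \<forall>m\<ge>M. \<forall>n\<ge>M. norm (\<sigma> m a - \<sigma> n a) < e" by blast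
    qed
    then show ?thesis by (simp add: Cauchy_convergent_iff)
  qed
  define \<phi> where "\<phi> = (\<lambda>a\<in>A. lim (\<lambda>n. \<sigma> n a))"
  have lim: "(\<lambda>n. \<sigma> n a) \<longlonglongrightarrow> \<phi> a" if "a \<in> A" for a
    using conv[OF that] that by (simp add: \<phi>_def convergent_LIMSEQ_iff)
  have unif: "\<exists>N. \<forall>n\<ge>N. \<forall>a\<in>A. cmod (\<sigma> n a - \<phi> a) \<le> \<epsilon> * nrm a" if \<epsilon>: "\<epsilon> > 0" for \<epsilon>
  proof -
    obtain N where N: "\<forall>m\<ge>N. \<forall>n\<ge>N. vnorm completion (\<sigma> m \<ominus>\<^bsub>completion\<^esub> \<sigma> n) < \<epsilon>"
      using Cauchy[OF \<epsilon>] by blast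
    have "cmod (\<sigma> n a - \<phi> a) \<le> \<epsilon> * nrm a" if n: "n \<ge> N" and a: "a \<in> A" for n a
    proof (rule tendsto_le[OF sequentially_bot tendsto_const])
      show "(\<lambda>m. cmod (\<sigma> n a - \<sigma> m a)) \<longlonglongrightarrow> cmod (\<sigma> n a - \<phi> a)"
        by (intro tendsto_intros lim a)
      have "cmod (\<sigma> n a - \<sigma> m a) \<le> \<epsilon> * nrm a" if "m \<ge> N" for m
      proof -
        have "vnorm completion (\<sigma> n \<ominus>\<^bsub>completion\<^esub> \<sigma> m) \<le> \<epsilon>" using N n that by (meson less_imp_le)
        from mult_right_mono[OF this nrm_nonneg[OF a]] diff[OF a, of n m] show ?thesis by linarith
      qed
      then show "\<forall>\<^sub>F m in sequentially. cmod (\<sigma> n a - \<sigma> m a) \<le> \<epsilon> * nrm a"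
        unfolding eventually_sequentially by blast
    qed
    then show ?thesis by blast
  qed
  have "\<exists>b\<in>A. \<forall>a\<in>A. cmod (\<phi> a - ip b a) \<le> inverse (real (Suc n)) * nrm a" for n
  proof -
    \<comment> \<open>One half of the error is spent between \<phi> and \<open>\<sigma> N\<close>,
      the other between \<open>\<sigma> N\<close> and a vector of \<open>A\<close>.\<close>
    define e where "e = inverse (real (Suc n)) / 2"
    have e: "e > 0" by (simp add: e_def)
    obtain N where N: "\<forall>a\<in>A. cmod (\<sigma> N a - \<phi> a) \<le> e * nrm a" using unif[OF e] by blast
    obtain b where b: "approximates b (\<sigma> N)" using completionE[OF \<sigma>in] by blast
    obtain d where d: "d \<longlonglongrightarrow> 0" "\<And>n a. a \<in> A \<Longrightarrow> cmod (\<sigma> N a - ip (b n) a) \<le> d n * nrm a"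
      using approximatesE[OF b] by metis
    obtain k where k: "d k < e"
      using order_tendstoD(2)[OF d(1) e] unfolding eventually_sequentially by blast
    have "cmod (\<phi> a - ip (b k) a) \<le> inverse (real (Suc n)) * nrm a" if a: "a \<in> A" for a
    proof -
      have "cmod (\<phi> a - ip (b k) a) \<le> cmod (\<sigma> N a - ip (b k) a) + cmod (\<sigma> N a - \<phi> a)"
        using norm_triangle_ineq4[of "\<sigma> N a - ip (b k) a" "\<sigma> N a - \<phi> a"] by simp
      also have "\<dots> \<le> e * nrm a + e * nrm a"
        using d(2)[OF a, of k] N a mult_right_mono[OF less_imp_le[OF k] nrm_nonneg[OF a]] by (intro add_mono) auto
      also have "\<dots> = inverse (real (Suc n)) * nrm a" by (simp add: e_def)
      finally show ?thesis .
    qed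
    then show ?thesis using approximates_in[OF b] by blast
  qed
  then obtain b where b: "\<And>n. b n \<in> A" "\<And>n a. a \<in> A \<Longrightarrow> cmod (\<phi> a - ip (b n) a) \<le> inverse (real (Suc n)) * nrm a"
    by metis
  have "approximates b \<phi>"
    unfolding approximates_def using b LIMSEQ_inverse_real_of_nat by blast
  then have \<phi>: "\<phi> \<in> carrier completion" by (auto simp: carrier_completion \<phi>_def)
  show "\<exists>x\<in>carrier completion. \<forall>\<epsilon>>0. \<exists>N. \<forall>n\<ge>N. vnorm completion (\<sigma> n \<ominus>\<^bsub>completion\<^esub> x) < \<epsilon>"
  proof (intro bexI[OF _ \<phi>] allI impI)
    fix \<epsilon> :: real assume "\<epsilon> > 0"
    then obtain N where N: "\<forall>n\<ge>N. \<forall>a\<in>A. cmod (\<sigma> n a - \<phi> a) \<le> \<epsilon> / 2 * nrm a"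
      using unif[of "\<epsilon> / 2"] by auto
    have "vnorm completion (\<sigma> n \<ominus>\<^bsub>completion\<^esub> \<phi>) \<le> \<epsilon> / 2" if "n \<ge> N" for n
      unfolding vnorm_completion
      using N that \<open>\<epsilon> > 0\<close> \<phi> \<sigma>in by (intro nrm_completion_le NC.diff_in) (auto simp: minus_completion)
    then show "\<exists>N. \<forall>n\<ge>N. vnorm completion (\<sigma> n \<ominus>\<^bsub>completion\<^esub> \<phi>) < \<epsilon>"
      using \<open>\<epsilon> > 0\<close> by (intro exI[of _ N]) fastforce
  qed
qed

theorem hilbert_completion: "complex_hilbert_space completion hip"
proof (intro complex_hilbert_space.intro complete_completion complex_hilbert_space_axioms.intro)
  show "hip \<phi> \<phi> = complex_of_real ((vnorm completion \<phi>)\<^sup>2)" if "\<phi> \<in> carrier completion" for \<phi>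
    unfolding vnorm_completion by (rule H.ip_self[OF that])
qed (fact H.ip_add_left H.ip_sm_left H.ip_cnj)+

section \<open>Extension of functionals and isometries to the completion\<close>

lemma hip_emb: "b \<in> A \<Longrightarrow> c \<in> A \<Longrightarrow> hip (emb b) (emb c) = ip b c"
  using hip_tendsto[OF approximates_emb approximates_emb, of b c] LIMSEQ_unique tendsto_const by blast

lemma vnorm_emb: "b \<in> A \<Longrightarrow> vnorm completion (emb b) = nrm b"
  by (simp add: hip_emb nrm_def)

lemma emb_add: "b \<in> A \<Longrightarrow> c \<in> A \<Longrightarrow> emb (b \<^bold>+ c) = emb b \<oplus>\<^bsub>completion\<^esub> emb c"
  by (auto simp: emb_def ip_add_left)

lemma emb_sm: "b \<in> A \<Longrightarrow> emb (z \<^bold>* b) = z \<odot>\<^bsub>completion\<^esub> emb b"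
  by (auto simp: emb_def ip_sm_left)

lemma emb_dense:
  assumes \<phi>: "\<phi> \<in> carrier completion" and \<epsilon>: "\<epsilon> > 0"
  obtains b where "b \<in> A" "vnorm completion (\<phi> \<ominus>\<^bsub>completion\<^esub> emb b) < \<epsilon>"
proof -
  obtain b where b: "approximates b \<phi>" using completionE[OF \<phi>] by blast
  obtain e where e: "e \<longlonglongrightarrow> 0" "\<And>n. e n \<ge> 0" "\<And>n a. a \<in> A \<Longrightarrow> cmod (\<phi> a - ip (b n) a) \<le> e n * nrm a"
    using approximatesE[OF b] by blast
  obtain k where k: "e k < \<epsilon>" using order_tendstoD(2)[OF e(1) \<epsilon>] unfolding eventually_sequentially by blast
  have bk: "b k \<in> A" using b approximates_in by blast
  have "vnorm completion (\<phi> \<ominus>\<^bsub>completion\<^esub> emb (b k)) \<le> e k"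
    unfolding vnorm_completion
  proof (rule nrm_completion_le[OF NC.diff_in[OF \<phi> emb_in[OF bk]] e(2)])
    show "cmod ((\<phi> \<ominus>\<^bsub>completion\<^esub> emb (b k)) a) \<le> e k * nrm a" if "a \<in> A" for a
      using e(3)[OF that, of k] that unfolding minus_completion[OF \<phi> emb_in[OF bk]] by (simp add: emb_def)
  qed
  then show ?thesis using that[of "b k"] bk k by simp
qed

text \<open>Extension by continuity along approximating sequences. It later turns the integration of
  coefficients against an approximate identity into an element of the dual of the
  completion.\<close>

lemma extend_functional:
  assumes add: "\<And>x y. x \<in> A \<Longrightarrow> y \<in> A \<Longrightarrow> l (x \<^bold>+ y) = l x + l y"
    and sm: "\<And>c x. x \<in> A \<Longrightarrow> l (c \<^bold>* x) = c * l x"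
    and bound: "\<And>x. x \<in> A \<Longrightarrow> cmod (l x) \<le> C * nrm x" and C: "C \<ge> 0"
  obtains h where "h \<in> dual completion" "\<And>b. b \<in> A \<Longrightarrow> h (emb b) = l b"
proof -
  have sub: "l (x \<^bold>- y) = l x - l y" if "x \<in> A" "y \<in> A" for x y
    using that by (simp add: add sm sm_in)
  have close: "\<exists>N. \<forall>m\<ge>N. \<forall>n\<ge>N. cmod (l (b m) - l (c n)) < \<epsilon>"
    if \<epsilon>: "\<epsilon> > 0" and b: "approximates b \<phi>" and c: "approximates c \<phi>" for \<epsilon> b c \<phi>
  proof -
    have "\<epsilon> / (C + 1) > 0" using \<epsilon> C by simp
    then obtain N where N: "\<forall>m\<ge>N. \<forall>n\<ge>N. nrm (b m \<^bold>- c n) < \<epsilon> / (C + 1)"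
      using approximates_close[OF b c] by blast
    have "cmod (l (b m) - l (c n)) < \<epsilon>" if mn: "m \<ge> N" "n \<ge> N" for m n
    proof -
      have in_A: "b m \<in> A" "c n \<in> A" using b c approximates_in by auto
      have "cmod (l (b m) - l (c n)) \<le> C * nrm (b m \<^bold>- c n)"
        using bound[OF sub_in[OF in_A]] sub[OF in_A] by simp
      also have "\<dots> \<le> (C + 1) * nrm (b m \<^bold>- c n)"
        using nrm_nonneg[OF sub_in[OF in_A]] by (intro mult_right_mono) auto
      also have "\<dots> < (C + 1) * (\<epsilon> / (C + 1))" using N mn C by (intro mult_strict_left_mono) auto
      also have "\<dots> = \<epsilon>" using C by simp
      finally show ?thesis .
    qed
    then show ?thesis by blast
  qed
  define h where "h = (\<lambda>\<phi>\<in>carrier completion. lim (\<lambda>n. l (appr \<phi> n)))"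
  have h_lim: "(\<lambda>n. l (b n)) \<longlonglongrightarrow> h \<phi>" if \<phi>: "\<phi> \<in> carrier completion" and b: "approximates b \<phi>" for b \<phi>
  proof -
    note appr = approximates_appr[OF b]
    have "Cauchy (\<lambda>n. l (appr \<phi> n))"
      by (rule CauchyI) (use close[OF _ appr appr] in blast)
    then have L: "(\<lambda>n. l (appr \<phi> n)) \<longlonglongrightarrow> h \<phi>"
      using \<phi> by (simp add: h_def Cauchy_convergent_iff convergent_LIMSEQ_iff)
    have "(\<lambda>n. l (b n) - l (appr \<phi> n)) \<longlonglongrightarrow> 0"
      by (rule LIMSEQ_I) (use close[OF _ b appr] in fastforce)
    from tendsto_add[OF this L] show ?thesis by simp
  qed
  have "h (\<phi> \<oplus>\<^bsub>completion\<^esub> \<psi>) = h \<phi> + h \<psi>" if \<phi>: "\<phi> \<in> carrier completion" and \<psi>: "\<psi> \<in> carrier completion" for \<phi> \<psi>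
  proof -
    obtain b where b: "approximates b \<phi>" using completionE[OF \<phi>] by blast
    obtain c where c: "approximates c \<psi>" using completionE[OF \<psi>] by blast
    have "(\<lambda>n. l (b n \<^bold>+ c n)) \<longlonglongrightarrow> h (\<phi> \<oplus>\<^bsub>completion\<^esub> \<psi>)"
      using h_lim[OF add_completion_in[OF \<phi> \<psi>] approximates_add[OF b c]] by simp
    moreover have "(\<lambda>n. l (b n \<^bold>+ c n)) \<longlonglongrightarrow> h \<phi> + h \<psi>"
      using tendsto_add[OF h_lim[OF \<phi> b] h_lim[OF \<psi> c]] b c approximates_in by (simp add: add)
    ultimately show ?thesis using LIMSEQ_unique by blast
  qed
  moreover have "h (z \<odot>\<^bsub>completion\<^esub> \<phi>) = z * h \<phi>" if \<phi>: "\<phi> \<in> carrier completion" for z \<phi>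
  proof -
    obtain b where b: "approximates b \<phi>" using completionE[OF \<phi>] by blast
    have "(\<lambda>n. l (z \<^bold>* b n)) \<longlonglongrightarrow> h (z \<odot>\<^bsub>completion\<^esub> \<phi>)"
      using h_lim[OF sm_completion_in[OF \<phi>] approximates_sm[OF b]] by simp
    moreover have "(\<lambda>n. l (z \<^bold>* b n)) \<longlonglongrightarrow> z * h \<phi>"
      using tendsto_mult[OF tendsto_const h_lim[OF \<phi> b]] b approximates_in by (simp add: sm)
    ultimately show ?thesis using LIMSEQ_unique by blast
  qed
  moreover have "cmod (h \<phi>) \<le> C * vnorm completion \<phi>" if \<phi>: "\<phi> \<in> carrier completion" for \<phi>
  proof -
    obtain b where b: "approximates b \<phi>" using completionE[OF \<phi>] by blast
    show ?thesis unfolding vnorm_completion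
    proof (rule tendsto_le[OF sequentially_bot])
      show "(\<lambda>n. C * nrm (b n)) \<longlonglongrightarrow> C * H.nrm \<phi>" by (intro tendsto_intros nrm_tendsto b)
      show "(\<lambda>n. cmod (l (b n))) \<longlonglongrightarrow> cmod (h \<phi>)" by (intro tendsto_norm h_lim \<phi> b)
      show "\<forall>\<^sub>F n in sequentially. cmod (l (b n)) \<le> C * nrm (b n)"
        using bound approximates_in[OF b] by simp
    qed
  qed
  moreover have "h \<in> extensional (carrier completion)" by (simp add: h_def)
  ultimately have "h \<in> dual completion" unfolding dual_iff by blast
  moreover have "h (emb b) = l b" if "b \<in> A" for b
    using h_lim[OF emb_in approximates_emb] that LIMSEQ_unique tendsto_const by blast
  ultimately show ?thesis using that by blast
qed

text \<open>On functionals, precomposition with \<open>r\<close> extends the inverse of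
  \<open>r\<close>, not \<open>r\<close>: if the inverse \<open>r'\<close> is also the adjoint, then
  \<open>lift r\<close> sends \<open>emb b\<close> to \<open>emb (r' b)\<close>.\<close>

definition lift :: "('x \<Rightarrow> 'x) \<Rightarrow> ('x \<Rightarrow> complex) \<Rightarrow> 'x \<Rightarrow> complex" where
  "lift r = (\<lambda>\<phi>\<in>carrier completion. \<lambda>a\<in>A. \<phi> (r a))"

context
  fixes r r' :: "'x \<Rightarrow> 'x"
  assumes r_in: "\<And>a. a \<in> A \<Longrightarrow> r a \<in> A" and r'_in: "\<And>a. a \<in> A \<Longrightarrow> r' a \<in> A"
    and rr': "\<And>a. a \<in> A \<Longrightarrow> r (r' a) = a" and r'r: "\<And>a. a \<in> A \<Longrightarrow> r' (r a) = a"
    and adjoint: "\<And>a b. a \<in> A \<Longrightarrow> b \<in> A \<Longrightarrow> ip (r' a) b = ip a (r b)"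
begin

lemma nrm_r: "a \<in> A \<Longrightarrow> nrm (r a) = nrm a"
  using adjoint[of "r a" a] by (simp add: nrm_def r_in r'r)

lemma approximates_lift:
  assumes b: "approximates b \<phi>"
  shows "approximates (\<lambda>n. r' (b n)) (\<lambda>a\<in>A. \<phi> (r a))"
proof -
  obtain e where e: "e \<longlonglongrightarrow> 0" "\<And>n a. a \<in> A \<Longrightarrow> cmod (\<phi> a - ip (b n) a) \<le> e n * nrm a"
    using approximatesE[OF b] by metis
  have bA: "b n \<in> A" for n using b approximates_in by blast
  have "cmod ((\<lambda>a\<in>A. \<phi> (r a)) a - ip (r' (b n)) a) \<le> e n * nrm a" if "a \<in> A" for a n
    using e(2)[OF r_in[OF that], of n] that bA by (simp add: adjoint nrm_r)
  then show ?thesis unfolding approximates_def using e(1) bA r'_in by blast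
qed

lemma lift_in: "\<phi> \<in> carrier completion \<Longrightarrow> lift r \<phi> \<in> carrier completion"
  using approximates_lift by (auto simp: lift_def carrier_completion)

lemma hip_lift:
  assumes \<phi>: "\<phi> \<in> carrier completion" and \<psi>: "\<psi> \<in> carrier completion"
  shows "hip (lift r \<phi>) (lift r \<psi>) = hip \<phi> \<psi>"
proof -
  obtain b where b: "approximates b \<phi>" using completionE[OF \<phi>] by blast
  obtain c where c: "approximates c \<psi>" using completionE[OF \<psi>] by blast
  have "ip (r' (b n)) (r' (c n)) = ip (b n) (c n)" for n
    using adjoint[of "b n" "r' (c n)"] b c approximates_in by (simp add: r'_in rr')
  then have "(\<lambda>n. ip (b n) (c n)) \<longlonglongrightarrow> hip (lift r \<phi>) (lift r \<psi>)"
    using hip_tendsto[OF approximates_lift[OF b] approximates_lift[OF c]] \<phi> \<psi> by (simp add: lift_def)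
  then show ?thesis using hip_tendsto[OF b c] LIMSEQ_unique by blast
qed

lemma lift_bounded: "lift r \<in> bounded_maps completion completion"
  unfolding bounded_maps_def
proof (intro CollectI conjI ballI allI)
  show "lift r \<in> carrier completion \<rightarrow>\<^sub>E carrier completion"
    using lift_in by (auto simp: lift_def)
  show "\<exists>C. \<forall>\<phi>\<in>carrier completion. vnorm completion (lift r \<phi>) \<le> C * vnorm completion \<phi>"
    by (intro exI[of _ 1]) (simp add: hip_lift)
qed (auto simp: lift_def add_completion_in sm_completion_in r_in)

lemma lift_emb: "b \<in> A \<Longrightarrow> lift r (emb b) = emb (r' b)"
  by (auto simp: lift_def emb_in) (auto simp: emb_def adjoint r_in)

end

text \<open>Precomposition reverses the order of composition; the inverses in the definition of
  \<open>U\<close> reverse it once more.\<close>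

lemma lift_compose:
  assumes "\<And>a. a \<in> A \<Longrightarrow> r (q a) = t a" "\<And>a. a \<in> A \<Longrightarrow> q a \<in> A" "\<phi> \<in> carrier completion"
    "lift r \<phi> \<in> carrier completion"
  shows "lift q (lift r \<phi>) = lift t \<phi>"
  using assms by (auto simp: lift_def[of q] lift_def[of t] lift_def[of r])

lemma lift_ident:
  assumes "\<And>a. a \<in> A \<Longrightarrow> r a = a" "\<phi> \<in> carrier completion"
  shows "lift r \<phi> = \<phi>"
  using assms by (auto simp: lift_def carrier_completion extensional_def)

end

text \<open>The form is set up on all almost periodic functions, because the approximate identity
  must be paired with coefficients without being known to be one.\<close>

lemma (in group) semi_inner_product_mean:
  "semi_inner_product {f. almost_periodic f} (\<lambda>f h g. f g + h g) (\<lambda>c f g. c * f g)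
     (\<lambda>f h. mean (\<lambda>g. f g * cnj (h g)))"
proof
  show "{f. almost_periodic f} \<noteq> {}" using almost_periodic_const by blast
  fix f h :: "'a \<Rightarrow> complex" and c
  assume "f \<in> {f. almost_periodic f}" "h \<in> {f. almost_periodic f}"
  then have f: "almost_periodic f" and h: "almost_periodic h" by auto
  show "(\<lambda>g. f g + h g) \<in> {f. almost_periodic f}" "(\<lambda>g. c * f g) \<in> {f. almost_periodic f}"
    using f h by (auto intro: almost_periodic_add almost_periodic_cmult)
  show "mean (\<lambda>g. (f g + h g) * cnj (k g)) = mean (\<lambda>g. f g * cnj (k g)) + mean (\<lambda>g. h g * cnj (k g))"
    if "k \<in> {f. almost_periodic f}" for k
    using mean_add[of "\<lambda>g. f g * cnj (k g)" "\<lambda>g. h g * cnj (k g)"] f h that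
    by (simp add: almost_periodic_mult almost_periodic_cnj distrib_right)
  show "mean (\<lambda>g. c * f g * cnj (h g)) = c * mean (\<lambda>g. f g * cnj (h g))"
    using mean_cmult[of "\<lambda>g. f g * cnj (h g)" c] f h
    by (simp add: almost_periodic_mult almost_periodic_cnj mult.assoc)
  show "mean (\<lambda>g. h g * cnj (f g)) = cnj (mean (\<lambda>g. f g * cnj (h g)))"
    using mean_cnj[of "\<lambda>g. f g * cnj (h g)"] f h
    by (simp add: almost_periodic_mult almost_periodic_cnj mult.commute)
  show "0 \<le> Re (mean (\<lambda>g. f g * cnj (f g)))"
    using f by (intro mean_Re_ge almost_periodic_mult almost_periodic_cnj) (simp_all add: complex_mult_cnj)
qed

section \<open>Bounded sets of operators and separability\<close>

text \<open>Banach--Steinhaus: pointwise boundedness makes the closed sets \<open>D n\<close> cover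
  the space, so one of them contains a ball.\<close>

lemma (in complex_banach_space) uniform_boundedness:
  assumes F: "F \<subseteq> bounded_maps X X"
    and bd: "\<And>x. x \<in> carrier X \<Longrightarrow> \<exists>M. \<forall>T\<in>F. vnorm X (T x) \<le> M"
  obtains C where "C > 0" "\<And>T x. T \<in> F \<Longrightarrow> x \<in> carrier X \<Longrightarrow> vnorm X (T x) \<le> C * vnorm X x"
proof -
  interpret MS: Metric_space "carrier X" "vdist X" by (rule Metric_space_vdist)
  define D where "D n = {x \<in> carrier X. \<forall>T\<in>F. vnorm X (T x) \<le> real n}" for n :: nat
  have Tin: "T x \<in> carrier X" if "T \<in> F" "x \<in> carrier X" for T x
    using that F bounded_map_in by blast
  have closed: "closedin MS.mtopology (D n)" for n
    unfolding MS.metric_closedin_iff_sequentially_closed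
  proof (intro conjI allI impI)
    show "D n \<subseteq> carrier X" by (auto simp: D_def)
    fix \<sigma> x assume *: "range \<sigma> \<subseteq> D n \<and> limitin MS.mtopology \<sigma> x sequentially"
    then have x: "x \<in> carrier X" and lim: "\<And>e. e > 0 \<Longrightarrow> \<exists>N. \<forall>n\<ge>N. \<sigma> n \<in> carrier X \<and> vdist X (\<sigma> n) x < e"
      unfolding MS.limit_metric_sequentially by auto
    have "vnorm X (T x) \<le> real n" if T: "T \<in> F" for T
    proof (rule field_le_epsilon)
      fix e :: real assume e: "e > 0"
      obtain C where C: "C > 0" "\<And>x. x \<in> carrier X \<Longrightarrow> vnorm X (T x) \<le> C * vnorm X x"
        using bounded_map_bound T F by blast
      have "e / C > 0" using e C by simp
      then obtain k where k: "\<sigma> k \<in> carrier X" "vdist X (\<sigma> k) x < e / C" using lim by blast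
      then have d: "vnorm X (x \<ominus> \<sigma> k) < e / C"
        using x by (simp add: vdist_def vnorm_diff_commute[of x])
      have "\<sigma> k \<in> D n" using * by blast
      then have Tk: "vnorm X (T (\<sigma> k)) \<le> real n" using T by (simp add: D_def)
      have "vnorm X (T x) \<le> vnorm X (T x \<ominus> T (\<sigma> k)) + vnorm X (T (\<sigma> k))"
        using x k T Tin by (intro vnorm_le_diff)
      also have "T x \<ominus> T (\<sigma> k) = T (x \<ominus> \<sigma> k)" using bounded_map_diff[of T x "\<sigma> k"] T F x k by auto
      also have "vnorm X (T (x \<ominus> \<sigma> k)) \<le> C * vnorm X (x \<ominus> \<sigma> k)" using C x k by auto
      also have "\<dots> \<le> C * (e / C)" using C d by (intro mult_left_mono) auto
      also have "\<dots> = e" using C by simp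
      finally show "vnorm X (T x) \<le> real n + e" using Tk by linarith
    qed
    then show "x \<in> D n" using x by (simp add: D_def)
  qed
  have "\<exists>n. MS.mtopology interior_of (D n) \<noteq> {}"
  proof (rule ccontr)
    assume *: "\<nexists>n. MS.mtopology interior_of (D n) \<noteq> {}"
    have "MS.mtopology interior_of \<Union>(range D) = {}"
      by (rule MS.metric_Baire_category_alt) (use complete closed * in auto)
    moreover have "\<Union>(range D) = carrier X"
    proof (intro equalityI subsetI)
      fix x assume x: "x \<in> carrier X"
      then obtain M where M: "\<forall>T\<in>F. vnorm X (T x) \<le> M" using bd by blast
      obtain n :: nat where "M \<le> real n" using real_arch_simple by blast
      then have "x \<in> D n" using M x by (force simp: D_def)
      then show "x \<in> \<Union>(range D)" by blast
    qed (auto simp: D_def)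
    ultimately have "carrier X = {}" using interior_of_topspace[of MS.mtopology] by simp
    then show False by blast
  qed
  then obtain n x0 where "x0 \<in> MS.mtopology interior_of (D n)" by blast
  then obtain U where U: "openin MS.mtopology U" "x0 \<in> U" "U \<subseteq> D n" unfolding interior_of_def by blast
  then obtain r where r: "r > 0" "MS.mball x0 r \<subseteq> U" unfolding MS.openin_mtopology by blast
  have x0: "x0 \<in> carrier X" "x0 \<in> D n" using U by (auto simp: D_def)
  \<comment> \<open>A vector \<open>z\<close> of norm \<open>r / 2\<close> satisfies
    \<open>T z = T (x0 \<oplus> z) \<ominus> T x0\<close>, hence has an image of norm at most
    \<open>2 n\<close>; rescaling gives \<open>4 n / r\<close>. The summand 1 keeps the constant
    positive when \<open>n = 0\<close>.\<close>
  define C where "C = 4 * real n / r + 1"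
  have C: "C > 0" using r by (simp add: C_def add_nonneg_pos)
  have "vnorm X (T y) \<le> C * vnorm X y" if T: "T \<in> F" and y: "y \<in> carrier X" for T y
  proof (cases "vnorm X y = 0")
    case True
    then have "y = \<zero>" using y vnorm_eq_zero_iff by blast
    moreover have "T \<zero> = \<zero>" using bounded_map_smult[of T X \<zero> 0] T F Tin[OF T, of \<zero>] by auto
    ultimately show ?thesis by simp
  next
    case False
    then have ny: "vnorm X y > 0" using vnorm_nonneg[OF y] by linarith
    define t where "t = r / (2 * vnorm X y)"
    have t: "t > 0" using r ny by (simp add: t_def)
    define z where "z = complex_of_real t \<odot> y"
    have z: "z \<in> carrier X" using y by (simp add: z_def)
    have nz: "vnorm X z = r / 2" using y ny t by (simp add: z_def vnorm_smult norm_of_real) (simp add: t_def)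
    have "(x0 \<oplus> z) \<ominus> x0 = z" using x0 z by (metis M.a_comm add_diff_add diff_self M.r_zero diff_zero M.zero_closed)
    then have "vdist X x0 (x0 \<oplus> z) < r"
      using x0 z nz r by (simp add: vdist_def vnorm_diff_commute[of x0])
    then have "x0 \<oplus> z \<in> MS.mball x0 r" using x0 z by simp
    then have "x0 \<oplus> z \<in> D n" using U r by blast
    then have 1: "vnorm X (T (x0 \<oplus> z)) \<le> real n" "vnorm X (T x0) \<le> real n" using x0 T by (auto simp: D_def)
    have "T z = T ((x0 \<oplus> z) \<ominus> x0)" using \<open>(x0 \<oplus> z) \<ominus> x0 = z\<close> by simp
    also have "\<dots> = T (x0 \<oplus> z) \<ominus> T x0" using bounded_map_diff[of T "x0 \<oplus> z" x0] T F x0 z by auto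
    finally have "vnorm X (T z) \<le> vnorm X (T (x0 \<oplus> z)) + vnorm X (T x0)"
      using vnorm_triangle[of "T (x0 \<oplus> z)" "\<ominus> T x0"] Tin[OF T] x0 z by (simp add: a_minus_def vnorm_minus)
    then have "vnorm X (T z) \<le> 2 * real n" using 1 by linarith
    moreover have "T z = complex_of_real t \<odot> T y"
      unfolding z_def using bounded_map_smult T F y by blast
    ultimately have "t * vnorm X (T y) \<le> 2 * real n" using Tin[OF T y] t by (simp add: vnorm_smult)
    then have "vnorm X (T y) \<le> 4 * real n / r * vnorm X y"
      using r ny by (simp add: t_def field_simps)
    also have "\<dots> \<le> C * vnorm X y" using ny by (intro mult_right_mono) (auto simp: C_def)
    finally show ?thesis .
  qed
  then show ?thesis using that C by blast
qed

section \<open>Linear combinations and norm separability\<close>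

context complex_normed_space
begin

text \<open>For \<open>Q = UNIV\<close> this is the linear span of \<open>Y\<close>; a countable
  dense \<open>Q\<close> and a countable \<open>Y\<close> give a countable set that is norm dense in
  that span.\<close>

inductive_set combinations :: "complex set \<Rightarrow> 'a set \<Rightarrow> 'a set" for Q Y where
  zero: "\<zero> \<in> combinations Q Y"
| step: "c \<in> Q \<Longrightarrow> y \<in> Y \<Longrightarrow> v \<in> combinations Q Y \<Longrightarrow> c \<odot> y \<oplus> v \<in> combinations Q Y"

lemma combinations_in:
  assumes Y: "Y \<subseteq> carrier X" and v: "v \<in> combinations Q Y"
  shows "v \<in> carrier X"
  using v by (induction rule: combinations.induct) (use Y in auto)

lemma countable_combinations:
  assumes "countable Q" "countable Y"
  shows "countable (combinations Q Y)"
proof (rule countable_subset)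
  let ?f = "\<lambda>l. foldr (\<lambda>(c, y) v. c \<odot> y \<oplus> v) l \<zero>"
  show "countable (?f ` lists (Q \<times> Y))" using assms by auto
  show "combinations Q Y \<subseteq> ?f ` lists (Q \<times> Y)"
  proof
    fix v assume "v \<in> combinations Q Y"
    then show "v \<in> ?f ` lists (Q \<times> Y)"
    proof (induction rule: combinations.induct)
      case zero
      then show ?case by (intro image_eqI[of _ _ "[]"]) auto
    next
      case (step c y v)
      then obtain l where "l \<in> lists (Q \<times> Y)" "v = ?f l" by blast
      then show ?case using step by (intro image_eqI[of _ _ "(c, y) # l"]) auto
    qed
  qed
qed

lemma combinations_smult:
  assumes Y: "Y \<subseteq> carrier X" and v: "v \<in> combinations UNIV Y"
  shows "a \<odot> v \<in> combinations UNIV Y"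
  using v
proof (induction rule: combinations.induct)
  case zero
  then show ?case by (simp add: combinations.zero)
next
  case (step c y v)
  then have "a \<odot> (c \<odot> y \<oplus> v) = (a * c) \<odot> y \<oplus> a \<odot> v"
    using Y combinations_in[of Y v] by (simp add: smult_add_right smult_mult subset_iff)
  then show ?case using step by (simp add: combinations.step)
qed

lemma combinations_add:
  assumes Y: "Y \<subseteq> carrier X" and v: "v \<in> combinations Q Y" and w: "w \<in> combinations Q Y"
  shows "v \<oplus> w \<in> combinations Q Y"
  using v
proof (induction rule: combinations.induct)
  case zero
  then show ?case using combinations_in[OF Y w] w by simp
next
  case (step c y v)
  then have "(c \<odot> y \<oplus> v) \<oplus> w = c \<odot> y \<oplus> (v \<oplus> w)"
    using Y combinations_in[of Y v] combinations_in[of Y w] w by (simp add: M.a_assoc subset_iff)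
  then show ?case using step by (simp add: combinations.step)
qed

lemma combinations_dense:
  assumes Y: "Y \<subseteq> carrier X" and Q: "closure Q = UNIV"
    and v: "v \<in> combinations UNIV Y" and \<epsilon>: "\<epsilon> > 0"
  shows "\<exists>w\<in>combinations Q Y. vnorm X (v \<ominus> w) < \<epsilon>"
  using v \<epsilon>
proof (induction arbitrary: \<epsilon> rule: combinations.induct)
  case zero
  then show ?case by (intro bexI[of _ \<zero>]) (auto simp: combinations.zero)
next
  case (step c y v)
  then obtain w where w: "w \<in> combinations Q Y" "vnorm X (v \<ominus> w) < \<epsilon> / 2"
    by (meson half_gt_zero)
  have in_X: "y \<in> carrier X" "v \<in> carrier X" "w \<in> carrier X"
    using step w Y combinations_in by auto
  \<comment> \<open>Replacing one scalar may cost half of the error; the other half is left to the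
    remaining combination. The summand 1 avoids division by zero.\<close>
  have "\<epsilon> / (2 * (vnorm X y + 1)) > 0" using step.prems in_X by (simp add: add_nonneg_pos)
  moreover have "c \<in> closure Q" using Q by simp
  ultimately obtain q where q: "q \<in> Q" "dist q c < \<epsilon> / (2 * (vnorm X y + 1))"
    by (meson closure_approachable)
  have "c \<odot> y \<ominus> q \<odot> y = (c - q) \<odot> y"
    using in_X smult_add_left[of y c "- q"] by (simp add: diff_smult smult_mult)
  then have "(c \<odot> y \<oplus> v) \<ominus> (q \<odot> y \<oplus> w) = (c - q) \<odot> y \<oplus> (v \<ominus> w)"
    using in_X by (simp add: add_diff_add)
  then have "vnorm X ((c \<odot> y \<oplus> v) \<ominus> (q \<odot> y \<oplus> w)) \<le> cmod (c - q) * vnorm X y + vnorm X (v \<ominus> w)"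
    using in_X vnorm_triangle[of "(c - q) \<odot> y" "v \<ominus> w"] by (simp add: vnorm_smult)
  also have "cmod (c - q) * vnorm X y \<le> cmod (c - q) * (vnorm X y + 1)"
    by (intro mult_left_mono) auto
  also have "\<dots> < \<epsilon> / (2 * (vnorm X y + 1)) * (vnorm X y + 1)"
    using q in_X by (intro mult_strict_right_mono) (auto simp: dist_norm norm_minus_commute add_nonneg_pos)
  also have "\<dots> = \<epsilon> / 2" using vnorm_nonneg[OF in_X(1)] by (simp add: field_simps)
  finally show ?case using w q step by (intro bexI[of _ "q \<odot> y \<oplus> w"]) (auto intro: combinations.step)
qed

text \<open>If \<open>T x\<close> had positive distance from the span of the vectors
  \<open>S x\<close>, a functional would vanish on the span but not at \<open>T x\<close>, and the
  weak neighbourhood of \<open>T\<close> on which it stays nonzero at \<open>x\<close> would miss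
  \<Gamma>. Hence the orbit under the weak closure of a countable set is norm separable.\<close>

lemma wot_closure_combinations:
  assumes \<Gamma>: "\<Gamma> \<subseteq> bounded_maps X X" and T: "T \<in> weak_operator_topology X closure_of \<Gamma>"
    and x: "x \<in> carrier X" and \<epsilon>: "\<epsilon> > 0"
  shows "\<exists>v\<in>combinations UNIV ((\<lambda>S. S x) ` \<Gamma>). vnorm X (T x \<ominus> v) < \<epsilon>"
proof (rule ccontr)
  assume *: "\<not> ?thesis"
  let ?Y = "(\<lambda>S. S x) ` \<Gamma>"
  have Tb: "T \<in> bounded_maps X X" using T by (simp add: in_closure_of)
  have Y: "?Y \<subseteq> carrier X" using \<Gamma> x bounded_map_in by blast
  obtain f where f: "f \<in> dual X" "\<And>v. v \<in> combinations UNIV ?Y \<Longrightarrow> f v = 0" "f (T x) \<noteq> 0"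
  proof (rule annihilating_functional[of "combinations UNIV ?Y" "T x" \<epsilon>])
    show "combinations UNIV ?Y \<subseteq> carrier X" using combinations_in[OF Y] by blast
    show "combinations UNIV ?Y \<noteq> {}" using combinations.zero by blast
    show "\<epsilon> \<le> vnorm X (T x \<ominus> v)" if "v \<in> combinations UNIV ?Y" for v using * that by fastforce
  qed (use Y combinations_add combinations_smult bounded_map_in[OF Tb x] \<epsilon> in auto)
  define W where "W = {S \<in> topspace (weak_operator_topology X). f (S x) \<in> - {0}}"
  have "openin (weak_operator_topology X) W"
    unfolding W_def by (rule openin_continuous_map_preimage[OF continuous_map_wot_eval[OF x f(1)]])
      (simp add: open_Compl)
  moreover have "T \<in> W" using Tb f by (simp add: W_def)
  ultimately have "\<exists>S. S \<in> \<Gamma> \<and> S \<in> W" using T by (simp add: in_closure_of)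
  then obtain S where S: "S \<in> \<Gamma>" "S \<in> W" by blast
  then have fS: "f (S x) \<noteq> 0" by (simp add: W_def)
  have "S x \<in> carrier X" using S(1) Y by blast
  moreover have "1 \<odot> S x \<oplus> \<zero> \<in> combinations UNIV ?Y"
    by (intro combinations.step combinations.zero imageI S(1) UNIV_I)
  ultimately have "S x \<in> combinations UNIV ?Y" by simp
  then show False using f(2) fS by blast
qed

text \<open>A factor on the left is absorbed into the functional, a factor on the right into the
  vector; in both cases a coefficient of the variable operator remains.\<close>

lemma semitop_semigroup_wot: "semitop_semigroup (weak_operator_topology X) (compose (carrier X))"
proof
  show "Hausdorff_space (weak_operator_topology X)" by (rule Hausdorff_wot)
  fix S T U assume "S \<in> topspace (weak_operator_topology X)" "T \<in> topspace (weak_operator_topology X)"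
  then have S: "S \<in> bounded_maps X X" and T: "T \<in> bounded_maps X X" by auto
  show "compose (carrier X) S T \<in> topspace (weak_operator_topology X)"
    using bounded_map_compose[OF S T] by simp
  show "compose (carrier X) (compose (carrier X) S T) U = compose (carrier X) S (compose (carrier X) T U)"
    if "U \<in> topspace (weak_operator_topology X)"
    using that bounded_map_in[of U X] by (auto simp: compose_def)
next
  fix S assume "S \<in> topspace (weak_operator_topology X)"
  then have S: "S \<in> bounded_maps X X" by simp
  show "continuous_map (weak_operator_topology X) (weak_operator_topology X) (compose (carrier X) S)"
    unfolding continuous_map_wot_iff
  proof (intro conjI ballI)
    fix x f assume x: "x \<in> carrier X" and f: "f \<in> dual X"
    show "continuous_map (weak_operator_topology X) euclidean (\<lambda>T. f (compose (carrier X) S T x))"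
      by (rule continuous_map_eq[OF continuous_map_wot_eval[OF x dual_compose[OF f S]]])
        (use x bounded_map_in in \<open>auto simp: compose_def\<close>)
  qed (use bounded_map_compose[OF S] in auto)
  show "continuous_map (weak_operator_topology X) (weak_operator_topology X) (\<lambda>T. compose (carrier X) T S)"
    unfolding continuous_map_wot_iff
  proof (intro conjI ballI)
    fix x f assume x: "x \<in> carrier X" and f: "f \<in> dual X"
    show "continuous_map (weak_operator_topology X) euclidean (\<lambda>T. f (compose (carrier X) T S x))"
      using continuous_map_wot_eval[OF bounded_map_in[OF S x] f] x by (simp add: compose_def)
  qed (use bounded_map_compose[OF _ S] in auto)
qed

end

section \<open>The group of a JdLG-admissible representation\<close>

locale jdlg_representation = complex_banach_space X for X :: "'a normed_module" (structure) +
  fixes \<pi> :: "'s::semitopological_semigroup \<Rightarrow> 'a \<Rightarrow> 'a"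
  assumes admissible: "JdLG_admissible X \<pi>"
begin

abbreviation comp :: "('a \<Rightarrow> 'a) \<Rightarrow> ('a \<Rightarrow> 'a) \<Rightarrow> 'a \<Rightarrow> 'a" (infixl \<open>\<bullet>\<close> 70) where
  "S \<bullet> T \<equiv> compose (carrier X) S T"

abbreviation wot :: "('a \<Rightarrow> 'a) topology" where "wot \<equiv> weak_operator_topology X"

abbreviation \<S> :: "('a \<Rightarrow> 'a) set" where "\<S> \<equiv> op_closure X \<pi>"

definition p :: "'a \<Rightarrow> 'a" where "p = (THE p. minimal_idempotent X \<S> p)"

definition K :: "('a \<Rightarrow> 'a) set" where
  "K = (SOME K. two_sided_ideal X \<S> K \<and> (\<forall>I. two_sided_ideal X \<S> I \<longrightarrow> K \<subseteq> I) \<and> p \<in> K)"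

definition G :: "('a \<Rightarrow> 'a) monoid" where "G = \<lparr>carrier = K, mult = compose (carrier X), one = p\<rparr>"

sublocale W: semitop_semigroup wot "compose (carrier X)"
  by (rule semitop_semigroup_wot)

lemma carrier_G [simp]: "carrier G = K" and mult_G [simp]: "x \<otimes>\<^bsub>G\<^esub> y = x \<bullet> y" and one_G [simp]: "\<one>\<^bsub>G\<^esub> = p"
  by (simp_all add: G_def)

lemma rep: "representation X \<pi>"
  using admissible by (simp add: JdLG_admissible_def)

lemma pi_bounded: "\<pi> s \<in> bounded_maps X X"
  using rep by (simp add: representation_def)

lemma pi_mult: "\<pi> (s * t) = \<pi> s \<bullet> \<pi> t"
  using rep by (simp add: representation_def)

lemma \<S>_compact: "compactin wot \<S>"
  using admissible by (simp add: JdLG_admissible_def)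

lemma \<S>_bounded: "u \<in> \<S> \<Longrightarrow> u \<in> bounded_maps X X"
  using \<S>_compact compactin_subset_topspace by fastforce

lemma pi_in_\<S>: "\<pi> s \<in> \<S>"
proof -
  have "range \<pi> \<subseteq> topspace wot" using pi_bounded by auto
  then show ?thesis unfolding op_closure_def using closure_of_subset by blast
qed

lemma \<S>_closed: "u \<in> \<S> \<Longrightarrow> v \<in> \<S> \<Longrightarrow> u \<bullet> v \<in> \<S>"
  unfolding op_closure_def
proof (rule W.closure_of_mult_closed)
  show "range \<pi> \<subseteq> topspace wot" using pi_bounded by auto
  show "S \<bullet> T \<in> range \<pi>" if "S \<in> range \<pi>" "T \<in> range \<pi>" for S T
    using that by (auto simp flip: pi_mult)
qed

lemma minimal_idempotent_p: "minimal_idempotent X \<S> p"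
  unfolding p_def using admissible unfolding JdLG_admissible_def by (metis theI')

lemma minimal_idempotent_unique: "minimal_idempotent X \<S> q \<Longrightarrow> q = p"
  using admissible minimal_idempotent_p unfolding JdLG_admissible_def by blast

lemma K: "two_sided_ideal X \<S> K" "two_sided_ideal X \<S> I \<Longrightarrow> K \<subseteq> I" "p \<in> K"
proof -
  have "\<exists>K. two_sided_ideal X \<S> K \<and> (\<forall>I. two_sided_ideal X \<S> I \<longrightarrow> K \<subseteq> I) \<and> p \<in> K"
    using minimal_idempotent_p by (simp add: minimal_idempotent_def)
  from someI_ex[OF this] show "two_sided_ideal X \<S> K" "two_sided_ideal X \<S> I \<Longrightarrow> K \<subseteq> I" "p \<in> K"
    unfolding K_def[symmetric] by blast+
qed

lemma K_subset: "K \<subseteq> \<S>"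
  using K(1) by (simp add: two_sided_ideal_def)

lemma K_ideal: "u \<in> \<S> \<Longrightarrow> v \<in> K \<Longrightarrow> u \<bullet> v \<in> K" "u \<in> \<S> \<Longrightarrow> v \<in> K \<Longrightarrow> v \<bullet> u \<in> K"
  using K(1) by (auto simp: two_sided_ideal_def)

lemma pp: "p \<bullet> p = p"
  using minimal_idempotent_p by (simp add: minimal_idempotent_def)

lemma idempotent_unique: "e \<in> K \<Longrightarrow> e \<bullet> e = e \<Longrightarrow> e = p"
proof (rule minimal_idempotent_unique)
  assume "e \<in> K" "e \<bullet> e = e"
  then show "minimal_idempotent X \<S> e" unfolding minimal_idempotent_def using K by blast
qed

lemma K_least: "I \<noteq> {} \<Longrightarrow> I \<subseteq> \<S> \<Longrightarrow> (\<And>u v. u \<in> \<S> \<Longrightarrow> v \<in> I \<Longrightarrow> u \<bullet> v \<in> I \<and> v \<bullet> u \<in> I) \<Longrightarrow> K \<subseteq> I"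
  by (rule K(2)) (simp add: two_sided_ideal_def)

lemma group_G: "group G" and K_compact: "compactin wot K" and p_central: "u \<in> \<S> \<Longrightarrow> p \<bullet> u = u \<bullet> p"
  using W.minimal_ideal_group[OF \<S>_compact \<S>_closed K_subset K_ideal K_least K(3) pp idempotent_unique]
  unfolding G_def by blast+

sublocale G: group G
  by (rule group_G)

lemma K_bounded: "g \<in> K \<Longrightarrow> g \<in> bounded_maps X X"
  using K_subset \<S>_bounded by blast

lemma K_in: "g \<in> K \<Longrightarrow> x \<in> carrier X \<Longrightarrow> g x \<in> carrier X"
  using K_bounded bounded_map_in by blast

lemma K_diff: "g \<in> K \<Longrightarrow> x \<in> carrier X \<Longrightarrow> y \<in> carrier X \<Longrightarrow> g (x \<ominus> y) = g x \<ominus> g y"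
  using K_bounded bounded_map_diff by blast

lemma K_add: "g \<in> K \<Longrightarrow> x \<in> carrier X \<Longrightarrow> y \<in> carrier X \<Longrightarrow> g (x \<oplus> y) = g x \<oplus> g y"
  using K_bounded bounded_map_add by blast

lemma K_smult: "g \<in> K \<Longrightarrow> x \<in> carrier X \<Longrightarrow> g (c \<odot> x) = c \<odot> g x"
  using K_bounded bounded_map_smult by blast

lemma K_mult: "g \<in> K \<Longrightarrow> h \<in> K \<Longrightarrow> g \<bullet> h \<in> K"
  using G.m_closed by simp

lemma K_inv: "g \<in> K \<Longrightarrow> inv\<^bsub>G\<^esub> g \<in> K" "g \<in> K \<Longrightarrow> inv\<^bsub>G\<^esub> g \<bullet> g = p" "g \<in> K \<Longrightarrow> g \<bullet> inv\<^bsub>G\<^esub> g = p"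
  using G.inv_closed[of g] G.l_inv[of g] G.r_inv[of g] by simp_all

lemma comp_apply: "x \<in> carrier X \<Longrightarrow> (S \<bullet> T) x = S (T x)"
  by (simp add: compose_eq)

section \<open>The reversible part as the range of \<open>p\<close>\<close>

definition R :: "'a set" where "R = reversible_part X \<pi>"

text \<open>Reversibility for \<open>u = p\<close> gives \<open>x = v (p x)\<close>, and since
  \<open>p\<close> is central and idempotent this vector is fixed by \<open>p\<close>. Conversely,
  on vectors fixed by \<open>p\<close> each \<open>u\<close> acts like \<open>u p\<close>, which is
  invertible in the group \<open>K\<close>.\<close>

lemma R_iff: "x \<in> R \<longleftrightarrow> x \<in> carrier X \<and> p x = x"
proof
  assume "x \<in> R"
  then have x: "x \<in> carrier X" and "\<forall>u\<in>\<S>. \<exists>v\<in>\<S>. v (u x) = x" by (auto simp: R_def reversible_part_def)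
  then obtain v where v: "v \<in> \<S>" "v (p x) = x" using K(3) K_subset by blast
  have "p (v (p x)) = ((p \<bullet> v) \<bullet> p) x" using x K_in[OF K(3) x] by (simp add: comp_apply)
  also have "(p \<bullet> v) \<bullet> p = (v \<bullet> p) \<bullet> p" using p_central[OF v(1)] by simp
  also have "\<dots> = v \<bullet> p"
    using W.m_assoc[of v p p] v K_bounded[OF K(3)] \<S>_bounded pp by simp
  finally show "x \<in> carrier X \<and> p x = x" using x v by (simp add: comp_apply)
next
  assume x: "x \<in> carrier X \<and> p x = x"
  have "\<exists>v\<in>\<S>. v (u x) = x" if u: "u \<in> \<S>" for u
  proof -
    have up: "u \<bullet> p \<in> K" using K_ideal(1)[OF u K(3)] .
    have "(inv\<^bsub>G\<^esub> (u \<bullet> p)) ((u \<bullet> p) x) = p x"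
      using K_inv(2)[OF up] x by (metis comp_apply)
    then have "(inv\<^bsub>G\<^esub> (u \<bullet> p)) (u x) = x" using x by (simp add: comp_apply)
    then show ?thesis using K_inv(1)[OF up] K_subset by blast
  qed
  then show "x \<in> R" using x by (simp add: R_def reversible_part_def)
qed

lemma R_subset: "R \<subseteq> carrier X"
  using R_iff by blast

lemma K_R: "g \<in> K \<Longrightarrow> x \<in> carrier X \<Longrightarrow> g x \<in> R"
  using G.l_one[of g] K_in by (simp add: R_iff) (metis comp_apply)

lemma K_inv_apply:
  assumes "g \<in> K" "x \<in> R"
  shows "(inv\<^bsub>G\<^esub> g) (g x) = x" "g ((inv\<^bsub>G\<^esub> g) x) = x"
  using K_inv(2,3)[OF assms(1)] assms(2) R_iff by (metis comp_apply)+

text \<open>Multiplication by \<open>p\<close> moves the semigroup homomorphically into the group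
  \<open>K\<close>, where inverses exist, without changing the action on \<open>R\<close>.\<close>

definition h :: "'s \<Rightarrow> 'a \<Rightarrow> 'a" where "h s = p \<bullet> \<pi> s"

lemma h_in: "h s \<in> K"
  unfolding h_def using K_ideal(2)[OF pi_in_\<S> K(3)] .

lemma h_apply: "x \<in> R \<Longrightarrow> h s x = \<pi> s x"
  unfolding h_def using p_central[OF pi_in_\<S>] R_iff by (metis comp_apply)

lemma h_mult: "h (s * t) = h s \<bullet> h t"
proof -
  have b: "\<pi> s \<in> topspace wot" "\<pi> t \<in> topspace wot" "p \<in> topspace wot"
    using pi_bounded K_bounded[OF K(3)] by auto
  have "h s \<bullet> h t = (p \<bullet> \<pi> s) \<bullet> (p \<bullet> \<pi> t)" by (simp add: h_def)
  also have "\<dots> = (p \<bullet> \<pi> s \<bullet> p) \<bullet> \<pi> t" using b W.m_closed by (simp add: W.m_assoc)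
  also have "p \<bullet> \<pi> s \<bullet> p = p \<bullet> \<pi> s"
    using b p_central[OF pi_in_\<S>[of s]] pp W.m_assoc[of p "\<pi> s" p] W.m_assoc[of p p "\<pi> s"] by simp
  also have "(p \<bullet> \<pi> s) \<bullet> \<pi> t = h (s * t)" using b by (simp add: h_def pi_mult W.m_assoc)
  finally show ?thesis by simp
qed

lemma pi_R: "x \<in> R \<Longrightarrow> \<pi> s x \<in> R"
  using K_R[OF h_in] h_apply R_subset by (metis subsetD)

section \<open>Uniform bounds and total boundedness of orbits\<close>

lemma orbit_bounded:
  assumes x: "x \<in> carrier X"
  shows "\<exists>M. \<forall>g\<in>K. vnorm X (g x) \<le> M"
proof -
  \<comment> \<open>These weakly closed sets cover \<open>K\<close>, so by Baire and compactness
    every \<open>g\<close> has some \<open>k\<close> in a finite set with \<open>k g\<close> in one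
    fixed \<open>C n\<close>. Undoing \<open>k\<close> costs only one of finitely many operator
    norms.\<close>
  define C where "C n = {T \<in> bounded_maps X X. vnorm X (T x \<ominus> \<zero>) \<le> real n}" for n :: nat
  have cover: "K \<subseteq> (\<Union>n. C n)"
  proof
    fix g assume g: "g \<in> K"
    obtain n :: nat where "vnorm X (g x) \<le> real n" using real_arch_simple by blast
    then show "g \<in> (\<Union>n. C n)" using g K_bounded K_in x by (auto simp: C_def)
  qed
  have ne: "K \<noteq> {}" using K(3) by blast
  have one: "g \<bullet> p = g" if "g \<in> K" for g using G.r_one[of g] that by simp
  have inv: "\<exists>v\<in>K. v \<bullet> g = p" if "g \<in> K" for g using K_inv that by blast
  have closed: "closedin wot (C n)" for n
    unfolding C_def using x by (intro closedin_wot_ball) auto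
  obtain n F where F: "finite F" "F \<subseteq> K" "K \<subseteq> (\<Union>h\<in>F. {g. h \<bullet> g \<in> C n})"
    using W.compact_group_countable_closed_cover[OF K_compact ne K_mult one inv closed cover] by metis
  have "\<exists>B>0. \<forall>y\<in>carrier X. vnorm X ((inv\<^bsub>G\<^esub> k) y) \<le> B * vnorm X y" if "k \<in> K" for k
    using bounded_map_bound[OF K_bounded[OF K_inv(1)[OF that]]] by metis
  then obtain B where B: "\<And>k. k \<in> K \<Longrightarrow> B k > 0"
    "\<And>k y. k \<in> K \<Longrightarrow> y \<in> carrier X \<Longrightarrow> vnorm X ((inv\<^bsub>G\<^esub> k) y) \<le> B k * vnorm X y"
    by metis
  have "vnorm X (g x) \<le> (\<Sum>k\<in>F. B k) * real n" if g: "g \<in> K" for g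
  proof -
    obtain k where k: "k \<in> F" "k \<bullet> g \<in> C n" using F g by blast
    then have kK: "k \<in> K" using F by blast
    have kg: "vnorm X (k (g x)) \<le> real n"
      using k x K_in[OF kK K_in[OF g x]] by (simp add: C_def comp_apply)
    have "vnorm X (g x) = vnorm X ((inv\<^bsub>G\<^esub> k) (k (g x)))"
      using K_inv_apply[OF kK K_R[OF g x]] by simp
    also have "\<dots> \<le> B k * vnorm X (k (g x))" using kK g x K_in by (intro B) auto
    also have "\<dots> \<le> B k * real n" using kg B(1)[OF kK] by (intro mult_left_mono) auto
    also have "\<dots> \<le> (\<Sum>k\<in>F. B k) * real n"
      using F k B by (intro mult_right_mono member_le_sum) (auto intro: less_imp_le)
    finally show ?thesis .
  qed
  then show ?thesis by blast
qed

definition bnd :: real where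
  "bnd = (SOME C. C > 0 \<and> (\<forall>g\<in>K. \<forall>x\<in>carrier X. vnorm X (g x) \<le> C * vnorm X x))"

lemma bnd: "bnd > 0" "g \<in> K \<Longrightarrow> x \<in> carrier X \<Longrightarrow> vnorm X (g x) \<le> bnd * vnorm X x"
proof -
  have "K \<subseteq> bounded_maps X X" using K_bounded by blast
  then have "\<exists>C>0. \<forall>g\<in>K. \<forall>x\<in>carrier X. vnorm X (g x) \<le> C * vnorm X x"
    using uniform_boundedness[OF _ orbit_bounded] by metis
  from someI_ex[OF this] show "bnd > 0" "g \<in> K \<Longrightarrow> x \<in> carrier X \<Longrightarrow> vnorm X (g x) \<le> bnd * vnorm X x"
    unfolding bnd_def by auto
qed

text \<open>A separated sequence in an orbit generates a compact group whose orbit is norm separable;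
  covering that group by countably many preimages of small norm balls, which are weakly closed,
  contradicts Baire's theorem.\<close>

lemma orbit_totally_bounded:
  assumes x: "x \<in> carrier X" and \<epsilon>: "\<epsilon> > 0"
  shows "\<exists>F. finite F \<and> F \<subseteq> K \<and> (\<forall>g\<in>K. \<exists>f\<in>F. vnorm X (g x \<ominus> f x) < \<epsilon>)"
proof (rule ccontr)
  assume "\<not> ?thesis"
  then have "\<forall>F. \<exists>g. finite F \<and> F \<subseteq> K \<longrightarrow> g \<in> K \<and> (\<forall>f\<in>F. \<epsilon> \<le> vnorm X (g x \<ominus> f x))"
    by (meson not_le)
  then obtain pick where "\<And>F. finite F \<and> F \<subseteq> K \<longrightarrow> pick F \<in> K \<and> (\<forall>f\<in>F. \<epsilon> \<le> vnorm X (pick F x \<ominus> f x))"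
    by metis
  then have pick: "\<And>F. finite F \<Longrightarrow> F \<subseteq> K \<Longrightarrow> pick F \<in> K"
    "\<And>F f. finite F \<Longrightarrow> F \<subseteq> K \<Longrightarrow> f \<in> F \<Longrightarrow> \<epsilon> \<le> vnorm X (pick F x \<ominus> f x)" by blast+
  \<comment> \<open>Greedy choice: \<open>fs n\<close> contains the first \<open>n\<close> members
    of an \<epsilon>-separated sequence in the orbit.\<close>
  define fs where "fs = rec_nat {} (\<lambda>_ F. insert (pick F) F)"
  have fs_Suc: "fs (Suc n) = insert (pick (fs n)) (fs n)" and fs_0: "fs 0 = {}" for n by (simp_all add: fs_def)
  have fs: "finite (fs n) \<and> fs n \<subseteq> K" for n
  proof (induction n)
    case (Suc n)
    then show ?case using pick(1)[of "fs n"] unfolding fs_Suc by blast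
  qed (simp add: fs_0)
  define \<sigma> where "\<sigma> n = pick (fs n)" for n
  have \<sigma>K: "\<sigma> n \<in> K" for n unfolding \<sigma>_def using pick(1) fs by metis
  have \<sigma>_in: "\<sigma> m \<in> fs n" if "m < n" for m n
    using that by (induction n) (auto simp: fs_Suc \<sigma>_def less_Suc_eq)
  have sep: "\<epsilon> \<le> vnorm X (\<sigma> n x \<ominus> \<sigma> m x)" if "m < n" for m n
    unfolding \<sigma>_def[of n] using pick(2)[OF _ _ \<sigma>_in[OF that]] fs by metis
  \<comment> \<open>The finite products of the \<open>\<sigma> n\<close>, with \<open>p\<close> as
    the empty one, form a countable semigroup. Countability is what makes the orbit of its closure
    separable.\<close>
  define word where "word ns = foldr (\<lambda>n g. \<sigma> n \<bullet> g) ns p" for ns :: "nat list"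
  have word_in: "word ns \<in> K" for ns by (induction ns) (auto simp: word_def K(3) K_mult \<sigma>K)
  have word_append: "word (ns @ ms) = word ns \<bullet> word ms" for ns ms
  proof (induction ns)
    case Nil
    then show ?case using G.l_one[of "word ms"] word_in[of ms] by (simp add: word_def)
  next
    case (Cons n ns)
    then show ?case using G.m_assoc[of "\<sigma> n" "word ns" "word ms"] \<sigma>K word_in by (simp add: word_def)
  qed
  define \<Gamma> where "\<Gamma> = range word"
  have \<Gamma>K: "\<Gamma> \<subseteq> K" using word_in by (auto simp: \<Gamma>_def)
  have \<Gamma>t: "\<Gamma> \<subseteq> topspace wot" using \<Gamma>K K_bounded by auto
  have "\<sigma> n = word [n]" for n using G.r_one[of "\<sigma> n"] \<sigma>K by (simp add: word_def)
  then have \<sigma>\<Gamma>: "\<sigma> n \<in> \<Gamma>" for n by (auto simp: \<Gamma>_def)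
  define A where "A = wot closure_of \<Gamma>"
  have \<Gamma>A: "\<Gamma> \<subseteq> A" unfolding A_def using \<Gamma>t by (rule closure_of_subset)
  have AK: "A \<subseteq> K"
    unfolding A_def using \<Gamma>K W.compactin_closedin[OF K_compact] by (rule closure_of_minimal)
  have Ac: "compactin wot A"
    using closed_compactin[OF K_compact AK] by (simp add: A_def)
  have A_closed: "u \<bullet> v \<in> A" if "u \<in> A" "v \<in> A" for u v
    using that unfolding A_def
    by (intro W.closure_of_mult_closed[OF \<Gamma>t]) (auto simp: \<Gamma>_def simp flip: word_append)
  have ne: "A \<noteq> {}" using \<Gamma>A \<sigma>\<Gamma> by blast
  have one: "a \<bullet> p = a" if "a \<in> A" for a using G.r_one[of a] that AK by auto
  \<comment> \<open>The closure of this semigroup is automatically closed under inversion: the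
    compact semigroup \<open>A a\<close> contains an idempotent, and \<open>p\<close> is the only
    one in \<open>K\<close>.\<close>
  have inv: "\<exists>v\<in>A. v \<bullet> a = p" if a: "a \<in> A" for a
  proof -
    obtain v where v: "v \<in> A" "(v \<bullet> a) \<bullet> (v \<bullet> a) = v \<bullet> a"
      using W.idempotent_multiple[OF Ac A_closed a] by metis
    then have "v \<bullet> a = p" using idempotent_unique A_closed a AK by blast
    then show ?thesis using v by blast
  qed
  obtain Q :: "complex set" where "countable Q" and Q: "\<And>V. open V \<Longrightarrow> V \<noteq> {} \<Longrightarrow> \<exists>q\<in>Q. q \<in> V"
    using countable_dense_setE by metis
  have "z \<in> closure Q" for z
    unfolding closure_approachable
  proof (intro allI impI)
    fix e :: real assume "e > 0"
    then show "\<exists>q\<in>Q. dist q z < e" using Q[of "ball z e"] by (auto simp: dist_commute)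
  qed
  then have Q: "countable Q" "closure Q = UNIV" using \<open>countable Q\<close> by auto
  define Y where "Y = (\<lambda>S. S x) ` \<Gamma>"
  have Y: "Y \<subseteq> carrier X" using \<Gamma>K K_in x by (auto simp: Y_def)
  have "countable Y" by (simp add: Y_def \<Gamma>_def)
  then have "countable (combinations Q Y)" using Q countable_combinations by blast
  then obtain d :: "nat \<Rightarrow> 'a" where d: "range d = combinations Q Y"
    using combinations.zero uncountable_def by (metis empty_iff)
  have dX: "d n \<in> carrier X" for n using d combinations_in[OF Y] by blast
  \<comment> \<open>Two points of one ball are at most \<open>2 * \<delta>\<close> apart, and
    undoing \<open>f\<close> multiplies this by at most \<open>bnd\<close>; the result \<epsilon> /
    2 contradicts the separation.\<close>
  define \<delta> where "\<delta> = \<epsilon> / (4 * bnd)"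
  have \<delta>: "\<delta> > 0" using \<epsilon> bnd by (simp add: \<delta>_def)
  define C where "C n = {T \<in> bounded_maps X X. vnorm X (T x \<ominus> d n) \<le> \<delta>}" for n
  have closed: "closedin wot (C n)" for n unfolding C_def by (rule closedin_wot_ball[OF x dX])
  have cover: "A \<subseteq> (\<Union>n. C n)"
  proof
    fix a assume a: "a \<in> A"
    then have ab: "a \<in> bounded_maps X X" using AK K_bounded by blast
    have "\<delta> / 2 > 0" using \<delta> by simp
    have "\<Gamma> \<subseteq> bounded_maps X X" using \<Gamma>t by simp
    then obtain v where v: "v \<in> combinations UNIV Y" "vnorm X (a x \<ominus> v) < \<delta> / 2"
      using wot_closure_combinations[OF _ _ x \<open>\<delta> / 2 > 0\<close>, of \<Gamma> a] a unfolding A_def Y_def by blast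
    obtain w where w: "w \<in> combinations Q Y" "vnorm X (v \<ominus> w) < \<delta> / 2"
      using combinations_dense[OF Y Q(2) v(1) \<open>\<delta> / 2 > 0\<close>] by blast
    obtain n where n: "w = d n" using d w by blast
    have "vnorm X (a x \<ominus> w) \<le> vnorm X (a x \<ominus> v) + vnorm X (v \<ominus> w)"
      using combinations_in[OF Y] v w bounded_map_in[OF ab x] by (intro vnorm_diff_triangle) auto
    then have "vnorm X (a x \<ominus> d n) \<le> \<delta>" using v w n by simp
    then show "a \<in> (\<Union>n. C n)" using ab by (auto simp: C_def)
  qed
  obtain n F where F: "finite F" "F \<subseteq> A" "A \<subseteq> (\<Union>h\<in>F. {g. h \<bullet> g \<in> C n})"
    using W.compact_group_countable_closed_cover[OF Ac ne A_closed one inv closed cover] by metis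
  \<comment> \<open>Pigeonhole principle: among finitely many translations one sends infinitely many
    of the \<open>\<sigma> k x\<close> into the same small ball.\<close>
  have "\<exists>f\<in>F. infinite {k. f \<bullet> \<sigma> k \<in> C n}"
  proof (rule ccontr)
    assume "\<not> ?thesis"
    then have "finite (\<Union>f\<in>F. {k. f \<bullet> \<sigma> k \<in> C n})" using F(1) by blast
    moreover have "(\<Union>f\<in>F. {k. f \<bullet> \<sigma> k \<in> C n}) = UNIV"
      using F(3) \<sigma>\<Gamma> \<Gamma>A by (auto simp: subset_iff)
    ultimately show False by simp
  qed
  then obtain f where f: "f \<in> F" "infinite {k. f \<bullet> \<sigma> k \<in> C n}" by blast
  obtain m where m: "f \<bullet> \<sigma> m \<in> C n" using f(2) infinite_imp_nonempty by blast
  obtain k where k: "m < k" "f \<bullet> \<sigma> k \<in> C n" using f(2) unfolding infinite_nat_iff_unbounded by blast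
  have fK: "f \<in> K" using f F AK by blast
  have in_X: "f (\<sigma> k x) \<in> carrier X" "f (\<sigma> m x) \<in> carrier X" "\<sigma> k x \<in> carrier X" "\<sigma> m x \<in> carrier X"
    using fK \<sigma>K K_in x by auto
  have "vnorm X (f (\<sigma> k x) \<ominus> f (\<sigma> m x)) \<le> vnorm X (f (\<sigma> k x) \<ominus> d n) + vnorm X (d n \<ominus> f (\<sigma> m x))"
    using in_X dX by (intro vnorm_diff_triangle)
  also have "\<dots> \<le> \<delta> + \<delta>"
    using k m x in_X dX vnorm_diff_commute[of "d n" "f (\<sigma> m x)"] by (simp add: C_def comp_apply)
  finally have le: "vnorm X (f (\<sigma> k x) \<ominus> f (\<sigma> m x)) \<le> \<delta> + \<delta>" .
  have "\<epsilon> \<le> vnorm X (\<sigma> k x \<ominus> \<sigma> m x)" by (rule sep[OF k(1)])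
  also have "\<sigma> k x \<ominus> \<sigma> m x = (inv\<^bsub>G\<^esub> f) (f (\<sigma> k x) \<ominus> f (\<sigma> m x))"
    using K_diff[OF K_inv(1)[OF fK] in_X(1,2)] K_inv_apply[OF fK K_R[OF \<sigma>K x]] by simp
  also have "vnorm X \<dots> \<le> bnd * vnorm X (f (\<sigma> k x) \<ominus> f (\<sigma> m x))"
    using in_X by (intro bnd K_inv fK) auto
  also have "\<dots> \<le> bnd * (\<delta> + \<delta>)" using le bnd by (intro mult_left_mono) auto
  also have "\<dots> = \<epsilon> / 2" using bnd by (simp add: \<delta>_def)
  finally show False using \<epsilon> by simp
qed

text \<open>\<open>F\<close> is a finite net of the orbit of \<open>x\<close>, and for each
  \<open>f\<close> in \<open>F\<close> the set \<open>H f\<close> is one for the orbit of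
  \<open>f x\<close>. The label of \<open>k\<close> records which member of \<open>H f\<close> is
  near \<open>k (f x)\<close>, for all \<open>f\<close> at once. Any \<open>v x\<close> is near some
  \<open>f x\<close>, so equal labels force \<open>k (v x)\<close> and \<open>k' (v x)\<close> to be
  close.\<close>

lemma vector_almost_periodic:
  assumes x: "x \<in> carrier X" and \<epsilon>: "\<epsilon> > 0"
  obtains l :: "('a \<Rightarrow> 'a) \<Rightarrow> nat" where "finite (l ` K)"
    "\<And>k k' u v. k \<in> K \<Longrightarrow> k' \<in> K \<Longrightarrow> l k = l k' \<Longrightarrow> u \<in> K \<Longrightarrow> v \<in> K \<Longrightarrow>
      vnorm X (u (k (v x)) \<ominus> u (k' (v x))) < \<epsilon>"
proof -
  \<comment> \<open>Replacing \<open>v x\<close> by \<open>f x\<close> costs \<open>bnd * e\<close>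
    for each of \<open>k\<close> and \<open>k'\<close>, the two net errors cost
    \<open>2 * e\<close>, and applying \<open>u\<close> multiplies the total by \<open>bnd\<close>.
    The summand 1 makes the final inequality strict.\<close>
  define e where "e = \<epsilon> / (bnd * (2 * bnd + 2) + 1)"
  have den: "bnd * (2 * bnd + 2) + 1 > 0" using bnd by (simp add: add_nonneg_pos)
  have e: "e > 0" using \<epsilon> den by (simp add: e_def)
  obtain F where F: "finite F" "F \<subseteq> K" "\<And>g. g \<in> K \<Longrightarrow> \<exists>f\<in>F. vnorm X (g x \<ominus> f x) < e"
    using orbit_totally_bounded[OF x e] by blast
  have "\<exists>H. finite H \<and> H \<subseteq> K \<and> (\<forall>g\<in>K. \<exists>h\<in>H. vnorm X (g (f x) \<ominus> h (f x)) < e)" if "f \<in> F" for f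
    using orbit_totally_bounded[of "f x", OF _ e] K_in that F x by blast
  then obtain H where H: "\<And>f. f \<in> F \<Longrightarrow> finite (H f)" "\<And>f. f \<in> F \<Longrightarrow> H f \<subseteq> K"
    "\<And>f g. f \<in> F \<Longrightarrow> g \<in> K \<Longrightarrow> \<exists>h\<in>H f. vnorm X (g (f x) \<ominus> h (f x)) < e"
    by metis
  then obtain c where c: "\<And>f g. f \<in> F \<Longrightarrow> g \<in> K \<Longrightarrow> c f g \<in> H f"
    "\<And>f g. f \<in> F \<Longrightarrow> g \<in> K \<Longrightarrow> vnorm X (g (f x) \<ominus> c f g (f x)) < e" by metis
  define L where "L k = (\<lambda>f\<in>F. c f k)" for k
  have "L ` K \<subseteq> PiE F H" using c by (auto simp: L_def)
  then have finL: "finite (L ` K)" using F H by (meson finite_PiE finite_subset)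
  define l where "l k = to_nat_on (L ` K) (L k)" for k
  have "l ` K = to_nat_on (L ` K) ` (L ` K)" by (auto simp: l_def)
  then have "finite (l ` K)" using finL by simp
  moreover have "vnorm X (u (k (v x)) \<ominus> u (k' (v x))) < \<epsilon>"
    if k: "k \<in> K" "k' \<in> K" "l k = l k'" and u: "u \<in> K" and v: "v \<in> K" for k k' u v
  proof -
    have "L k = L k'"
      using k finL inj_on_to_nat_on[OF countable_finite[OF finL]] by (auto simp: l_def dest: inj_onD)
    obtain f where f: "f \<in> F" "vnorm X (v x \<ominus> f x) < e" using F(3)[OF v] by blast
    have fK: "f \<in> K" using f F by blast
    have ceq: "c f k = c f k'" using \<open>L k = L k'\<close> f by (metis L_def restrict_apply')
    let ?y = "f x" and ?z = "v x"
    have in_X: "?y \<in> carrier X" "?z \<in> carrier X" using fK v x K_in by auto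
    have cK: "c f k \<in> K" using c(1) f k H(2) by blast
    have in_X2: "k ?y \<in> carrier X" "k ?z \<in> carrier X" "k' ?y \<in> carrier X" "k' ?z \<in> carrier X"
        "c f k ?y \<in> carrier X"
      using in_X k cK K_in by auto
    have b: "vnorm X (g ?z \<ominus> g ?y) \<le> bnd * e" if "g \<in> K" for g
    proof -
      have "vnorm X (g ?z \<ominus> g ?y) = vnorm X (g (?z \<ominus> ?y))" using K_diff that in_X by simp
      also have "\<dots> \<le> bnd * vnorm X (?z \<ominus> ?y)" using that in_X by (intro bnd) auto
      also have "\<dots> \<le> bnd * e" using f bnd by (intro mult_left_mono) auto
      finally show ?thesis .
    qed
    have 1: "vnorm X (k ?z \<ominus> k' ?z) \<le> vnorm X (k ?z \<ominus> k ?y) + vnorm X (k ?y \<ominus> k' ?z)"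
      using in_X2 by (intro vnorm_diff_triangle)
    have 2: "vnorm X (k ?y \<ominus> k' ?z) \<le> vnorm X (k ?y \<ominus> c f k ?y) + vnorm X (c f k ?y \<ominus> k' ?z)"
      using in_X2 by (intro vnorm_diff_triangle)
    have 3: "vnorm X (c f k ?y \<ominus> k' ?z) \<le> vnorm X (c f k ?y \<ominus> k' ?y) + vnorm X (k' ?y \<ominus> k' ?z)"
      using in_X2 by (intro vnorm_diff_triangle)
    have 4: "vnorm X (k ?y \<ominus> c f k ?y) < e" using c(2)[OF f(1) k(1)] .
    have 5: "vnorm X (c f k ?y \<ominus> k' ?y) < e"
      using c(2)[OF f(1) k(2)] ceq vnorm_diff_commute[OF in_X2(3) in_X2(5)] by simp
    have 6: "vnorm X (k' ?y \<ominus> k' ?z) \<le> bnd * e" using b[OF k(2)] vnorm_diff_commute[OF in_X2(3,4)] by simp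
    have le: "vnorm X (k ?z \<ominus> k' ?z) \<le> (2 * bnd + 2) * e"
      using 1 2 3 4 5 6 b[OF k(1)] by (simp add: algebra_simps)
    have "vnorm X (u (k ?z) \<ominus> u (k' ?z)) = vnorm X (u (k ?z \<ominus> k' ?z))" using K_diff u in_X2 by simp
    also have "\<dots> \<le> bnd * vnorm X (k ?z \<ominus> k' ?z)" using u in_X2 by (intro bnd) auto
    also have "\<dots> \<le> bnd * ((2 * bnd + 2) * e)" using le bnd by (intro mult_left_mono) auto
    also have "\<dots> < (bnd * (2 * bnd + 2) + 1) * e" using e by (simp add: algebra_simps)
    also have "\<dots> = \<epsilon>" using den by (simp add: e_def)
    finally show ?thesis .
  qed
  ultimately show ?thesis using that by blast
qed

lemma coefficient_almost_periodic:
  assumes f: "f \<in> dual X" and x: "x \<in> carrier X"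
  shows "G.almost_periodic (\<lambda>g. f (g x))"
  unfolding G.almost_periodic_def
proof (intro allI impI)
  fix \<epsilon> :: real assume \<epsilon>: "\<epsilon> > 0"
  obtain B where B: "B > 0" "\<And>x. x \<in> carrier X \<Longrightarrow> cmod (f x) \<le> B * vnorm X x" using dual_bound[OF f] by blast
  have "\<epsilon> / B > 0" using \<epsilon> B by simp
  then obtain l :: "('a \<Rightarrow> 'a) \<Rightarrow> nat" where l: "finite (l ` K)"
    "\<And>k k' u v. k \<in> K \<Longrightarrow> k' \<in> K \<Longrightarrow> l k = l k' \<Longrightarrow> u \<in> K \<Longrightarrow> v \<in> K \<Longrightarrow>
      vnorm X (u (k (v x)) \<ominus> u (k' (v x))) < \<epsilon> / B"
    using vector_almost_periodic[OF x] by blast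
  have "cmod (f ((u \<bullet> k \<bullet> v) x) - f ((u \<bullet> k' \<bullet> v) x)) < \<epsilon>"
    if *: "k \<in> K" "k' \<in> K" "l k = l k'" "u \<in> K" "v \<in> K" for k k' u v
  proof -
    have in_X: "u (k (v x)) \<in> carrier X" "u (k' (v x)) \<in> carrier X" using * x K_in by auto
    have "cmod (f (u (k (v x))) - f (u (k' (v x)))) \<le> B * vnorm X (u (k (v x)) \<ominus> u (k' (v x)))"
      using B(2)[of "u (k (v x)) \<ominus> u (k' (v x))"] in_X by (simp add: dual_diff[OF f])
    also have "\<dots> < B * (\<epsilon> / B)" using l(2)[OF *] B by (intro mult_strict_left_mono) auto
    also have "\<dots> = \<epsilon>" using B by simp
    finally show ?thesis using x K_in[OF *(5) x] by (simp add: comp_apply)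
  qed
  then show "\<exists>l :: ('a \<Rightarrow> 'a) \<Rightarrow> nat. finite (l ` carrier G) \<and>
     (\<forall>k\<in>carrier G. \<forall>k'\<in>carrier G. l k = l k' \<longrightarrow> (\<forall>u\<in>carrier G. \<forall>v\<in>carrier G.
       cmod (f ((u \<otimes>\<^bsub>G\<^esub> k \<otimes>\<^bsub>G\<^esub> v) x) - f ((u \<otimes>\<^bsub>G\<^esub> k' \<otimes>\<^bsub>G\<^esub> v) x)) < \<epsilon>))"
    using l(1) by (intro exI[of _ l]) simp
qed

lemma R_submodule:
  "\<zero> \<in> R" "x \<in> R \<Longrightarrow> y \<in> R \<Longrightarrow> x \<oplus> y \<in> R" "x \<in> R \<Longrightarrow> c \<odot> x \<in> R"
proof -
  show "\<zero> \<in> R" using K_smult[OF K(3), of \<zero> 0] K_in[OF K(3), of \<zero>] by (simp add: R_iff)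
  show "x \<in> R \<Longrightarrow> y \<in> R \<Longrightarrow> x \<oplus> y \<in> R" by (simp add: R_iff K_add[OF K(3)])
  show "x \<in> R \<Longrightarrow> c \<odot> x \<in> R" by (simp add: R_iff K_smult[OF K(3)])
qed

text \<open>Composition with the projection \<open>p\<close> onto \<open>R\<close> extends a
  functional from \<open>R\<close> at the price of a factor \<open>bnd\<close>. It carries the weak
  continuity of \<pi> over to functionals given only on \<open>R\<close>.\<close>

lemma dual_extend:
  assumes add: "\<And>x y. x \<in> R \<Longrightarrow> y \<in> R \<Longrightarrow> f (x \<oplus> y) = f x + f y"
    and smult: "\<And>c x. x \<in> R \<Longrightarrow> f (c \<odot> x) = c * f x"
    and bound: "\<And>x. x \<in> R \<Longrightarrow> cmod (f x) \<le> B * vnorm X x" and B: "B \<ge> 0"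
  shows "(\<lambda>x\<in>carrier X. f (p x)) \<in> dual X"
  unfolding dual_iff
proof (intro conjI ballI allI exI[of _ "B * bnd"])
  fix x assume x: "x \<in> carrier X"
  have pR: "p x \<in> R" using K_R[OF K(3) x] .
  have "cmod (f (p x)) \<le> B * vnorm X (p x)" by (rule bound[OF pR])
  also have "\<dots> \<le> B * (bnd * vnorm X x)" using bnd(2)[OF K(3) x] B by (rule mult_left_mono)
  finally show "cmod ((\<lambda>x\<in>carrier X. f (p x)) x) \<le> B * bnd * vnorm X x" using x by simp
qed (use K_R[OF K(3)] in \<open>simp_all add: K_add[OF K(3)] K_smult[OF K(3)] add smult\<close>)

section \<open>Hilbert spaces: averaging the inner product\<close>

text \<open>The norm is a parameter because in the Hilbert case the norm of the averaged inner
  product replaces the given one.\<close>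

lemma normed_space_R:
  assumes "\<And>x. x \<in> R \<Longrightarrow> n x = 0 \<longleftrightarrow> x = \<zero>" "\<And>x y. x \<in> R \<Longrightarrow> y \<in> R \<Longrightarrow> n (x \<oplus> y) \<le> n x + n y"
    and "\<And>c x. x \<in> R \<Longrightarrow> n (c \<odot> x) = cmod c * n x"
  shows "complex_normed_space (X\<lparr>carrier := R, vnorm := n\<rparr>)"
proof (intro complex_normed_space.intro complex_normed_space_axioms.intro)
  have in_X: "x \<in> carrier X" if "x \<in> R" for x using that R_subset by blast
  show "module complex_field (X\<lparr>carrier := R, vnorm := n\<rparr>)"
  proof (rule moduleI[OF cring_complex_field])
    show "abelian_group (X\<lparr>carrier := R, vnorm := n\<rparr>)"
    proof (rule abelian_groupI)
      fix x assume "x \<in> carrier (X\<lparr>carrier := R, vnorm := n\<rparr>)"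
      then have x: "x \<in> R" by simp
      have "(-1) \<odot> x \<oplus> x = \<zero>" using minus_smult[OF in_X[OF x]] in_X[OF x] by (metis M.l_neg)
      then show "\<exists>y\<in>carrier (X\<lparr>carrier := R, vnorm := n\<rparr>).
          y \<oplus>\<^bsub>X\<lparr>carrier := R, vnorm := n\<rparr>\<^esub> x = \<zero>\<^bsub>X\<lparr>carrier := R, vnorm := n\<rparr>\<^esub>"
        using R_submodule(3)[OF x] by auto
    qed (simp_all add: R_submodule in_X M.add.m_ac)
  qed (simp_all add: R_submodule in_X smult_add_left smult_add_right smult_mult)
qed (simp_all add: assms)

lemma minus_R:
  assumes "complex_normed_space (X\<lparr>carrier := R, vnorm := n\<rparr>)" "x \<in> R" "y \<in> R"
  shows "x \<ominus>\<^bsub>X\<lparr>carrier := R, vnorm := n\<rparr>\<^esub> y = x \<ominus> y"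
  using complex_normed_space.diff_smult[OF assms(1), of x y] diff_smult[of x y] assms R_subset by (auto simp: subset_iff)

lemma identity_fixes: "(\<And>s. e * s = s \<and> s * e = s) \<Longrightarrow> \<pi> e = restrict id (carrier X)"
  using rep by (simp add: representation_def)

lemma pi_continuous:
  assumes "x \<in> carrier X" "f \<in> dual X"
  shows "continuous_on UNIV (\<lambda>s. f (\<pi> s x))"
proof -
  have "continuous_map euclidean wot \<pi>" using rep by (simp add: representation_def)
  then have "continuous_map euclidean euclidean (\<lambda>s. f (\<pi> s x))"
    using assms unfolding continuous_map_wot_iff by blast
  then show ?thesis by simp
qed

lemma pi_add: "x \<in> carrier X \<Longrightarrow> y \<in> carrier X \<Longrightarrow> \<pi> s (x \<oplus> y) = \<pi> s x \<oplus> \<pi> s y"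
  and pi_smult: "x \<in> carrier X \<Longrightarrow> \<pi> s (c \<odot> x) = c \<odot> \<pi> s x"
  using bounded_map_add[OF pi_bounded] bounded_map_smult[OF pi_bounded] by blast+

lemma hilbert_case:
  fixes ip :: "'a \<Rightarrow> 'a \<Rightarrow> complex"
  assumes "complex_hilbert_space X ip"
  shows "\<exists>(H :: 'a normed_module) ip U. unitary_representation H ip U \<and>
    equivalent_rep (reversible_space X \<pi>) (reversible_rep X \<pi>) H U"
proof -
  interpret E: complex_hilbert_space X ip by fact
  interpret EI: semi_inner_product "carrier X" "add X" "smult X" ip
  proof
    show "carrier X \<noteq> {}" by blast
    show "ip y x = cnj (ip x y)" if "x \<in> carrier X" "y \<in> carrier X" for x y
      using that by (rule E.ip_cnj)
  qed (simp_all add: E.ip_add E.ip_smult E.ip_self)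
  have EI_nrm: "EI.nrm x = vnorm X x" if "x \<in> carrier X" for x
    using that by (simp add: EI.nrm_def E.ip_self)
  have in_X: "x \<in> carrier X" if "x \<in> R" for x using that R_subset by blast
  have bd: "vnorm X (g x) \<le> bnd * vnorm X x" if "g \<in> K" "x \<in> carrier X" for g x
    using that by (rule bnd)
  \<comment> \<open>The common refinement of the labellings for the orbits of \<open>x\<close> and
    \<open>y\<close> works, since these orbits are bounded and the inner product is uniformly
    continuous on bounded sets.\<close>
  have ap: "G.almost_periodic (\<lambda>g. ip (g x) (g y))" if x: "x \<in> carrier X" and y: "y \<in> carrier X" for x y
    unfolding G.almost_periodic_def
  proof (intro allI impI)
    fix \<epsilon> :: real assume \<epsilon>: "\<epsilon> > 0"
    define B where "B = bnd * vnorm X x + bnd * vnorm X y + 1"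
    have nn: "bnd * vnorm X x \<ge> 0" "bnd * vnorm X y \<ge> 0" using bnd(1) x y by auto
    have B: "B > 0" using nn unfolding B_def by linarith
    define e where "e = \<epsilon> / (2 * B)"
    have e: "e > 0" using \<epsilon> B by (simp add: e_def)
    obtain l1 :: "('a \<Rightarrow> 'a) \<Rightarrow> nat" where l1: "finite (l1 ` K)"
      "\<And>k k' u v. k \<in> K \<Longrightarrow> k' \<in> K \<Longrightarrow> l1 k = l1 k' \<Longrightarrow> u \<in> K \<Longrightarrow> v \<in> K \<Longrightarrow>
        vnorm X (u (k (v x)) \<ominus> u (k' (v x))) < e"
      using vector_almost_periodic[OF x e] by blast
    obtain l2 :: "('a \<Rightarrow> 'a) \<Rightarrow> nat" where l2: "finite (l2 ` K)"
      "\<And>k k' u v. k \<in> K \<Longrightarrow> k' \<in> K \<Longrightarrow> l2 k = l2 k' \<Longrightarrow> u \<in> K \<Longrightarrow> v \<in> K \<Longrightarrow>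
        vnorm X (u (k (v y)) \<ominus> u (k' (v y))) < e"
      using vector_almost_periodic[OF y e] by blast
    define l where "l k = prod_encode (l1 k, l2 k)" for k
    have "l ` K \<subseteq> prod_encode ` (l1 ` K \<times> l2 ` K)" by (auto simp: l_def)
    then have fin: "finite (l ` K)" by (rule finite_subset) (use l1 l2 in auto)
    have "cmod (ip ((u \<bullet> k \<bullet> v) x) ((u \<bullet> k \<bullet> v) y) - ip ((u \<bullet> k' \<bullet> v) x) ((u \<bullet> k' \<bullet> v) y)) < \<epsilon>"
      if k: "k \<in> K" "k' \<in> K" "l k = l k'" and u: "u \<in> K" and v: "v \<in> K" for k k' u v
    proof -
      have lk: "l1 k = l1 k'" "l2 k = l2 k'" using k(3) by (auto simp: l_def dest: inj_onD[OF inj_prod_encode])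
      let ?g = "u \<bullet> k \<bullet> v" and ?h = "u \<bullet> k' \<bullet> v"
      have gK: "?g \<in> K" "?h \<in> K" using k u v K_mult by auto
      have gx: "?g z = u (k (v z))" "?h z = u (k' (v z))" if "z \<in> carrier X" for z
        using that v K_in by (simp_all add: comp_apply)
      have zX: "?g x \<in> carrier X" "?h x \<in> carrier X" "?g y \<in> carrier X" "?h y \<in> carrier X"
        using K_in gK x y by auto
      have "cmod (ip (?g x) (?g y) - ip (?h x) (?h y))
          \<le> EI.nrm (?g x \<oplus> (-1) \<odot> ?h x) * EI.nrm (?g y) + EI.nrm (?h x) * EI.nrm (?g y \<oplus> (-1) \<odot> ?h y)"
        by (rule EI.ip_diff_le[OF zX])
      also have "\<dots> = vnorm X (?g x \<ominus> ?h x) * vnorm X (?g y) + vnorm X (?h x) * vnorm X (?g y \<ominus> ?h y)"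
        using zX by (simp add: EI_nrm diff_smult)
      also have "\<dots> \<le> e * (bnd * vnorm X y) + (bnd * vnorm X x) * e"
      proof (intro add_mono mult_mono)
        show "vnorm X (?g x \<ominus> ?h x) \<le> e" using l1(2)[OF k(1,2) lk(1) u v] gx[OF x] by simp
        show "vnorm X (?g y \<ominus> ?h y) \<le> e" using l2(2)[OF k(1,2) lk(2) u v] gx[OF y] by simp
        show "vnorm X (?g y) \<le> bnd * vnorm X y" "vnorm X (?h x) \<le> bnd * vnorm X x" 
          using bd gK x y by auto
      qed (use e zX nn in auto)
      also have "\<dots> \<le> e * B" using e by (simp add: B_def algebra_simps)
      also have "\<dots> < \<epsilon>" using \<epsilon> B by (simp add: e_def)
      finally show ?thesis .
    qed
    then show "\<exists>l :: ('a \<Rightarrow> 'a) \<Rightarrow> nat. finite (l ` carrier G) \<and>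
       (\<forall>k\<in>carrier G. \<forall>k'\<in>carrier G. l k = l k' \<longrightarrow> (\<forall>u\<in>carrier G. \<forall>v\<in>carrier G.
         cmod (ip ((u \<otimes>\<^bsub>G\<^esub> k \<otimes>\<^bsub>G\<^esub> v) x) ((u \<otimes>\<^bsub>G\<^esub> k \<otimes>\<^bsub>G\<^esub> v) y)
           - ip ((u \<otimes>\<^bsub>G\<^esub> k' \<otimes>\<^bsub>G\<^esub> v) x) ((u \<otimes>\<^bsub>G\<^esub> k' \<otimes>\<^bsub>G\<^esub> v) y)) < \<epsilon>))"
      using fin by (intro exI[of _ l]) simp
  qed
  define ip' where "ip' x y = G.mean (\<lambda>g. ip (g x) (g y))" for x y
  interpret I: semi_inner_product R "add X" "smult X" ip'
  proof
    show "R \<noteq> {}" using R_submodule(1) by blast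
    fix x y and c :: complex assume x: "x \<in> R" and y: "y \<in> R"
    show "x \<oplus> y \<in> R" "c \<odot> x \<in> R" using R_submodule x y by auto
    show "ip' (x \<oplus> y) z = ip' x z + ip' y z" if z: "z \<in> R" for z
    proof -
      have "ip' (x \<oplus> y) z = G.mean (\<lambda>g. ip (g x) (g z) + ip (g y) (g z))"
        unfolding ip'_def using in_X x y z by (intro G.mean_cong) (simp add: K_add K_in E.ip_add)
      then show ?thesis
        unfolding ip'_def using G.mean_add[OF ap ap] in_X x y z by simp
    qed
    show "ip' (c \<odot> x) y = c * ip' x y"
    proof -
      have "ip' (c \<odot> x) y = G.mean (\<lambda>g. c * ip (g x) (g y))"
        unfolding ip'_def using in_X x y by (intro G.mean_cong) (simp add: K_smult K_in E.ip_smult)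
      then show ?thesis unfolding ip'_def using G.mean_cmult[OF ap] in_X x y by simp
    qed
    show "ip' y x = cnj (ip' x y)"
    proof -
      have "ip' y x = G.mean (\<lambda>g. cnj (ip (g x) (g y)))"
        unfolding ip'_def using in_X x y by (intro G.mean_cong E.ip_cnj) (simp_all add: K_in)
      then show ?thesis unfolding ip'_def using G.mean_cnj[OF ap] in_X x y by simp
    qed
    show "0 \<le> Re (ip' x x)"
      unfolding ip'_def using in_X x by (intro G.mean_Re_ge ap) (simp_all add: K_in E.ip_self)
  qed
  have upper: "I.nrm x \<le> bnd * vnorm X x" if x: "x \<in> R" for x
  proof (rule power2_le_imp_le)
    have "Re (ip' x x) \<le> (bnd * vnorm X x)\<^sup>2"
      unfolding ip'_def
    proof (rule G.mean_Re_le[OF ap])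
      fix g assume "g \<in> carrier G"
      then have g: "g \<in> K" by simp
      have "(vnorm X (g x))\<^sup>2 \<le> (bnd * vnorm X x)\<^sup>2"
        using bd[OF g] K_in[OF g] x in_X by (intro power_mono) auto
      then show "Re (ip (g x) (g x)) \<le> (bnd * vnorm X x)\<^sup>2" using K_in[OF g] x in_X by (simp add: E.ip_self)
    qed (use x in_X in auto)
    then show "(I.nrm x)\<^sup>2 \<le> (bnd * vnorm X x)\<^sup>2" using I.nrm_sq[OF x] by simp
    show "0 \<le> bnd * vnorm X x" using bnd(1) in_X[OF x] by simp
  qed
  \<comment> \<open>Here invertibility enters: \<open>x\<close> is the image of \<open>g x\<close>
    under the inverse of \<open>g\<close>, so no \<open>g\<close> shrinks \<open>x\<close> by more
    than the factor \<open>bnd\<close>.\<close>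
  have lower: "vnorm X x \<le> bnd * I.nrm x" if x: "x \<in> R" for x
  proof -
    have "(vnorm X x / bnd)\<^sup>2 \<le> Re (ip' x x)"
      unfolding ip'_def
    proof (rule G.mean_Re_ge[OF ap])
      fix g assume "g \<in> carrier G"
      then have g: "g \<in> K" by simp
      have "vnorm X x \<le> bnd * vnorm X (g x)"
        using bd[OF K_inv(1)[OF g] K_in[OF g in_X[OF x]]] K_inv_apply(1)[OF g x] by simp
      then have "vnorm X x / bnd \<le> vnorm X (g x)" using bnd(1) by (simp add: field_simps)
      then have "(vnorm X x / bnd)\<^sup>2 \<le> (vnorm X (g x))\<^sup>2"
        using bnd(1) in_X[OF x] by (intro power_mono) auto
      then show "(vnorm X x / bnd)\<^sup>2 \<le> Re (ip (g x) (g x))" using K_in[OF g] x in_X by (simp add: E.ip_self)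
    qed (use x in_X in auto)
    then have "(vnorm X x / bnd)\<^sup>2 \<le> (I.nrm x)\<^sup>2" using I.nrm_sq[OF x] by simp
    then have "vnorm X x / bnd \<le> I.nrm x" using I.nrm_nonneg[OF x] by (rule power2_le_imp_le)
    then show ?thesis using bnd(1) by (simp add: field_simps)
  qed
  define H where "H = X\<lparr>carrier := R, vnorm := I.nrm\<rparr>"
  have H_simps: "carrier H = R" "add H = add X" "smult H = smult X" "zero H = zero X" "vnorm H = I.nrm"
    by (simp_all add: H_def)
  have nH: "complex_normed_space H"
    unfolding H_def
  proof (rule normed_space_R)
    fix x assume x: "x \<in> R"
    have "I.nrm x = 0 \<longleftrightarrow> vnorm X x = 0"
    proof
      assume "I.nrm x = 0"
      then show "vnorm X x = 0" using lower[OF x] vnorm_nonneg[OF in_X[OF x]] by simp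
    next
      assume "vnorm X x = 0"
      then show "I.nrm x = 0" using upper[OF x] I.nrm_nonneg[OF x] by simp
    qed
    then show "I.nrm x = 0 \<longleftrightarrow> x = \<zero>" using vnorm_eq_zero_iff[OF in_X[OF x]] by simp
    show "I.nrm (c \<odot> x) = cmod c * I.nrm x" for c by (rule I.nrm_sm[OF x])
    show "I.nrm (x \<oplus> y) \<le> I.nrm x + I.nrm y" if "y \<in> R" for y by (rule I.nrm_triangle[OF x that])
  qed
  interpret NH: complex_normed_space H by (rule nH)
  have minus: "x \<ominus>\<^bsub>H\<^esub> y = x \<ominus> y" if "x \<in> R" "y \<in> R" for x y
    using minus_R[OF nH[unfolded H_def] that] by (simp add: H_def)
  have R_diff: "x \<ominus> y \<in> R" if "x \<in> R" "y \<in> R" for x y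
    using NH.diff_in[of x y] that by (simp add: minus H_simps)
  have banach: "complex_banach_space H"
  proof (rule NH.complex_banach_spaceI)
    fix \<sigma> :: "nat \<Rightarrow> 'a"
    assume "range \<sigma> \<subseteq> carrier H"
      and Cauchy: "\<And>\<epsilon>. \<epsilon> > 0 \<Longrightarrow> \<exists>N. \<forall>m\<ge>N. \<forall>n\<ge>N. vnorm H (\<sigma> m \<ominus>\<^bsub>H\<^esub> \<sigma> n) < \<epsilon>"
    then have \<sigma>: "\<sigma> n \<in> R" for n by (auto simp: H_simps)
    have "\<exists>N. \<forall>m\<ge>N. \<forall>n\<ge>N. vnorm X (\<sigma> m \<ominus> \<sigma> n) < \<epsilon>" if "\<epsilon> > 0" for \<epsilon>
    proof -
      have "\<epsilon> / bnd > 0" using that bnd(1) by simp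
      then obtain N where N: "\<forall>m\<ge>N. \<forall>n\<ge>N. vnorm H (\<sigma> m \<ominus>\<^bsub>H\<^esub> \<sigma> n) < \<epsilon> / bnd" using Cauchy by blast
      have "vnorm X (\<sigma> m \<ominus> \<sigma> n) < \<epsilon>" if "m \<ge> N" "n \<ge> N" for m n
      proof -
        have "I.nrm (\<sigma> m \<ominus> \<sigma> n) < \<epsilon> / bnd" using N that by (simp add: H_simps(5) minus \<sigma>)
        then have "bnd * I.nrm (\<sigma> m \<ominus> \<sigma> n) < \<epsilon>" using bnd(1) by (simp add: field_simps)
        then show ?thesis using lower[OF R_diff[OF \<sigma> \<sigma>], of m n] by linarith
      qed
      then show ?thesis by blast
    qed
    then have "\<forall>\<epsilon>>0. \<exists>N. \<forall>m\<ge>N. \<forall>n\<ge>N. vnorm X (\<sigma> m \<ominus> \<sigma> n) < \<epsilon>" by simp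
    moreover have "range \<sigma> \<subseteq> carrier X" using \<sigma> in_X by blast
    ultimately have "\<exists>x\<in>carrier X. \<forall>\<epsilon>>0. \<exists>N. \<forall>n\<ge>N. vnorm X (\<sigma> n \<ominus> x) < \<epsilon>"
      using complete[unfolded mcomplete_iff, THEN spec, of \<sigma>] by simp
    then obtain x where x: "x \<in> carrier X" and lim: "\<And>\<epsilon>. \<epsilon> > 0 \<Longrightarrow> \<exists>N. \<forall>n\<ge>N. vnorm X (\<sigma> n \<ominus> x) < \<epsilon>"
      by auto
    \<comment> \<open>The limit stays in \<open>R\<close> because the bounded operator
      \<open>p\<close> fixes every \<open>\<sigma> n\<close>.\<close>
    have "vnorm X (p x \<ominus> x) \<le> 0"
    proof (rule field_le_epsilon)
      fix \<epsilon> :: real assume "\<epsilon> > 0"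
      then have "\<epsilon> / (bnd + 1) > 0" using bnd(1) by simp
      then obtain n where n: "vnorm X (\<sigma> n \<ominus> x) < \<epsilon> / (bnd + 1)" using lim by blast
      have \<sigma>X: "\<sigma> n \<in> carrier X" using \<sigma> in_X by blast
      have px: "p x \<in> carrier X" using K_in[OF K(3) x] .
      have "vnorm X (p x \<ominus> x) \<le> vnorm X (p x \<ominus> \<sigma> n) + vnorm X (\<sigma> n \<ominus> x)"
        using px \<sigma>X x by (intro vnorm_diff_triangle)
      also have "p x \<ominus> \<sigma> n = p (x \<ominus> \<sigma> n)" using K_diff[OF K(3) x \<sigma>X] \<sigma>[of n] R_iff by simp
      also have "vnorm X (p (x \<ominus> \<sigma> n)) \<le> bnd * vnorm X (x \<ominus> \<sigma> n)"
        using x \<sigma>X by (intro bnd K(3)) auto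
      also have "vnorm X (x \<ominus> \<sigma> n) = vnorm X (\<sigma> n \<ominus> x)" using vnorm_diff_commute x \<sigma>X by blast
      also have "bnd * vnorm X (\<sigma> n \<ominus> x) + vnorm X (\<sigma> n \<ominus> x) = (bnd + 1) * vnorm X (\<sigma> n \<ominus> x)"
        by (simp add: algebra_simps)
      also have "\<dots> \<le> (bnd + 1) * (\<epsilon> / (bnd + 1))" using n bnd(1) by (intro mult_left_mono) auto
      also have "\<dots> = \<epsilon>" using bnd(1) by simp
      finally show "vnorm X (p x \<ominus> x) \<le> 0 + \<epsilon>" by simp
    qed
    then have "p x = x"
      using x K_in[OF K(3) x] vnorm_nonneg[of "p x \<ominus> x"] vnorm_eq_zero_iff[of "p x \<ominus> x"] diff_eq_zero_iff
      by (metis diff_in order_antisym)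
    then have xR: "x \<in> R" using x R_iff by blast
    show "\<exists>x\<in>carrier H. \<forall>\<epsilon>>0. \<exists>N. \<forall>n\<ge>N. vnorm H (\<sigma> n \<ominus>\<^bsub>H\<^esub> x) < \<epsilon>"
    proof (intro bexI[of _ x] allI impI)
      fix \<epsilon> :: real assume "\<epsilon> > 0"
      then have "\<epsilon> / bnd > 0" using bnd(1) by simp
      then obtain N where N: "\<forall>n\<ge>N. vnorm X (\<sigma> n \<ominus> x) < \<epsilon> / bnd" using lim by blast
      have "vnorm H (\<sigma> n \<ominus>\<^bsub>H\<^esub> x) < \<epsilon>" if "n \<ge> N" for n
      proof -
        have "bnd * vnorm X (\<sigma> n \<ominus> x) < \<epsilon>" using N that bnd(1) by (simp add: field_simps)
        then show ?thesis using upper[OF R_diff[OF \<sigma> xR], of n] by (simp add: H_simps(5) minus \<sigma> xR)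
      qed
      then show "\<exists>N. \<forall>n\<ge>N. vnorm H (\<sigma> n \<ominus>\<^bsub>H\<^esub> x) < \<epsilon>" by blast
    qed (use xR in \<open>simp add: H_simps\<close>)
  qed
  have hilbert: "complex_hilbert_space H ip'"
  proof (intro complex_hilbert_space.intro banach complex_hilbert_space_axioms.intro)
    show "ip' y x = cnj (ip' x y)" if "x \<in> carrier H" "y \<in> carrier H" for x y
      using that unfolding H_simps by (rule I.ip_cnj)
  qed (simp_all add: H_simps I.ip_add_left I.ip_sm_left I.ip_self)
  define U where "U s = restrict (\<pi> s) R" for s
  have U_R: "U s x \<in> R" "U s x = h s x" if "x \<in> R" for s x using that pi_R h_apply by (simp_all add: U_def)
  \<comment> \<open>On \<open>R\<close> the operator \<open>U s\<close> is \<open>h s\<close>, so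
    applying it inside the mean is a right translation of the integrand by
    \<open>h s\<close>.\<close>
  have U_ip: "ip' (U s x) (U s y) = ip' x y" if x: "x \<in> R" and y: "y \<in> R" for s x y
  proof -
    have "ip' (U s x) (U s y) = G.mean (\<lambda>g. ip ((g \<otimes>\<^bsub>G\<^esub> h s) x) ((g \<otimes>\<^bsub>G\<^esub> h s) y))"
      unfolding ip'_def using U_R(2) x y in_X by (simp add: comp_apply)
    also have "\<dots> = ip' x y"
      unfolding ip'_def using G.mean_translate_right[OF ap[OF in_X[OF x] in_X[OF y]]] h_in by simp
    finally show ?thesis .
  qed
  have U_nrm: "I.nrm (U s x) = I.nrm x" if "x \<in> R" for s x using U_ip that by (simp add: I.nrm_def)
  have U_bounded: "U s \<in> bounded_maps H H" for s
    unfolding bounded_maps_def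
  proof (intro CollectI conjI ballI allI)
    show "U s \<in> carrier H \<rightarrow>\<^sub>E carrier H" using pi_R by (auto simp: U_def H_simps)
    show "\<exists>C. \<forall>x\<in>carrier H. vnorm H (U s x) \<le> C * vnorm H x"
      by (intro exI[of _ 1]) (simp add: H_simps U_nrm)
  qed (use R_submodule pi_add pi_smult in_X in \<open>simp_all add: U_def H_simps\<close>)
  have rep_H: "representation H U"
    unfolding representation_def
  proof (intro conjI allI impI)
    show "U s \<in> bounded_maps H H" for s by (rule U_bounded)
    show "U (s * t) = compose (carrier H) (U s) (U t)" for s t
    proof
      fix x
      show "U (s * t) x = compose (carrier H) (U s) (U t) x"
      proof (cases "x \<in> R")
        case True
        then show ?thesis using in_X[OF True] pi_R[OF True] by (simp add: compose_def H_simps U_def pi_mult)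
      qed (simp add: compose_def H_simps U_def)
    qed
    show "U e = restrict id (carrier H)" if "\<forall>s. e * s = s \<and> s * e = s" for e
    proof -
      have "\<pi> e = restrict id (carrier X)" by (rule identity_fixes) (use that in blast)
      then show ?thesis using in_X by (auto simp: U_def H_simps restrict_def fun_eq_iff)
    qed
    show "continuous_map euclidean (weak_operator_topology H) U"
      unfolding NH.continuous_map_wot_iff
    proof (intro conjI ballI)
      show "U \<in> topspace euclidean \<rightarrow> bounded_maps H H" using U_bounded by blast
      fix x f assume "x \<in> carrier H" and f: "f \<in> dual H"
      then have x: "x \<in> R" by (simp add: H_simps)
      obtain B where B: "B > 0" "\<And>x. x \<in> carrier H \<Longrightarrow> cmod (f x) \<le> B * vnorm H x"
        using NH.dual_bound[OF f] by blast
      \<comment> \<open>A functional bounded for the new norm is bounded for the old one by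
        \<open>upper\<close>; extended through \<open>p\<close>, it becomes accessible to the weak
        continuity of \<pi>.\<close>
      have F: "(\<lambda>x\<in>carrier X. f (p x)) \<in> dual X"
      proof (rule dual_extend[where B = "B * bnd"])
        fix x assume x: "x \<in> R"
        have "cmod (f x) \<le> B * I.nrm x" using B(2)[of x] x by (simp add: H_simps)
        also have "\<dots> \<le> B * (bnd * vnorm X x)" using upper[OF x] B(1) by (intro mult_left_mono) auto
        finally show "cmod (f x) \<le> B * bnd * vnorm X x" by simp
      qed (use f B bnd(1) NH.dual_add[OF f] NH.dual_smult[OF f] in \<open>auto simp: H_simps\<close>)
      have "f (U s x) = (\<lambda>x\<in>carrier X. f (p x)) (\<pi> s x)" for s
        using x pi_R[OF x, of s] by (simp add: U_def R_iff)
      then show "continuous_map euclidean euclidean (\<lambda>s. f (U s x))"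
        using pi_continuous[OF in_X[OF x] F] by simp
    qed
  qed
  have unitary: "unitary_representation H ip' U"
    unfolding unitary_representation_def
  proof (intro conjI allI hilbert rep_H ballI)
    show "U s ` carrier H = carrier H" for s
    proof
      show "U s ` carrier H \<subseteq> carrier H" using U_R(1) by (auto simp: H_simps)
      show "carrier H \<subseteq> U s ` carrier H"
      proof
        fix y assume "y \<in> carrier H"
        then have y: "y \<in> R" by (simp add: H_simps)
        have iy: "(inv\<^bsub>G\<^esub> h s) y \<in> R" using K_R[OF K_inv(1)[OF h_in] in_X[OF y]] .
        then have "U s ((inv\<^bsub>G\<^esub> h s) y) = y" using U_R(2) K_inv_apply(2)[OF h_in y] by simp
        then show "y \<in> U s ` carrier H" using iy by (metis H_simps(1) image_eqI)
      qed
    qed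
    show "ip' (U s x) (U s y) = ip' x y" if "x \<in> carrier H" "y \<in> carrier H" for s x y
      using U_ip that by (simp add: H_simps)
  qed
  \<comment> \<open>Only the inner product has changed, so the identity of \<open>R\<close> is the
    intertwiner; \<open>upper\<close> and \<open>lower\<close> make it bounded in both
    directions.\<close>
  let ?id = "restrict id R"
  have R_simps: "carrier (reversible_space X \<pi>) = R" "add (reversible_space X \<pi>) = add X"
    "smult (reversible_space X \<pi>) = smult X" "vnorm (reversible_space X \<pi>) = vnorm X"
    by (simp_all add: reversible_space_def R_def)
  have "?id \<in> bounded_maps (reversible_space X \<pi>) H" "?id \<in> bounded_maps H (reversible_space X \<pi>)"
    unfolding bounded_maps_def using upper lower R_submodule by (auto simp: R_simps H_simps)
  then have "equivalent_rep (reversible_space X \<pi>) (reversible_rep X \<pi>) H U"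
    unfolding equivalent_rep_def
    by (intro bexI[of _ ?id]) (auto simp: R_simps H_simps U_def reversible_rep_def pi_R simp flip: R_def)
  then show ?thesis using unitary by blast
qed

section \<open>Banach spaces: the regular representation on the coefficients\<close>

text \<open>A finite sum of coefficients is kept as explicit data. Right translation acts on the
  vectors in the list, and functionals on the completion are later evaluated entry by entry.\<close>

definition coefficient :: "(('a \<Rightarrow> complex) \<times> 'a) list \<Rightarrow> ('a \<Rightarrow> 'a) \<Rightarrow> complex" where
  "coefficient l T = (\<Sum>(f, x)\<leftarrow>l. f (T x))"

definition data :: "(('a \<Rightarrow> complex) \<times> 'a) list set" where
  "data = {l. set l \<subseteq> dual X \<times> R}"

definition on_S :: "(('a \<Rightarrow> complex) \<times> 'a) list \<Rightarrow> 's \<Rightarrow> complex" where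
  "on_S l s = coefficient l (\<pi> s)"

definition A :: "('s \<Rightarrow> complex) set" where "A = on_S ` data"

text \<open>The weakly continuous extension of a coefficient from \<pi>(S) to \<S>; the choice of a
  representing list is immaterial by \<open>coefficient_eq\<close>.\<close>

definition ext :: "('s \<Rightarrow> complex) \<Rightarrow> ('a \<Rightarrow> 'a) \<Rightarrow> complex" where
  "ext a = coefficient (SOME l. l \<in> data \<and> on_S l = a)"

lemma coefficient_Nil [simp]: "coefficient [] T = 0"
  and coefficient_Cons [simp]: "coefficient ((f, x) # l) T = f (T x) + coefficient l T"
  and coefficient_append [simp]: "coefficient (l @ l') T = coefficient l T + coefficient l' T"
  by (simp_all add: coefficient_def)

lemma data_Nil [simp]: "[] \<in> data"
  and data_Cons [simp]: "(f, x) # l \<in> data \<longleftrightarrow> f \<in> dual X \<and> x \<in> R \<and> l \<in> data"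
  and data_append [simp]: "l @ l' \<in> data \<longleftrightarrow> l \<in> data \<and> l' \<in> data"
  by (auto simp: data_def)

lemma continuous_coefficient: "l \<in> data \<Longrightarrow> continuous_map wot euclidean (coefficient l)"
proof (induction l)
  case (Cons fx l)
  obtain f x where fx: "fx = (f, x)" by (cases fx)
  have "continuous_map wot euclidean (\<lambda>T. f (T x))"
    using Cons.prems R_subset fx by (intro continuous_map_wot_eval) auto
  then show ?case using Cons fx by (auto intro: continuous_map_add)
next
  case Nil
  have "coefficient [] = (\<lambda>T. 0)" by (simp add: fun_eq_iff)
  then show ?case by simp
qed

text \<open>A coefficient is weakly continuous on \<open>\<S>\<close>, hence determined by its values on \<open>\<pi>(S)\<close>.\<close>

lemma coefficient_eq:
  assumes l: "l \<in> data" "l' \<in> data" and eq: "on_S l = on_S l'" and T: "T \<in> \<S>"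
  shows "coefficient l T = coefficient l' T"
proof -
  have "continuous_map wot euclidean (\<lambda>T. coefficient l T - coefficient l' T)"
    using l by (intro continuous_map_diff continuous_coefficient)
  then have "closedin wot {T \<in> topspace wot. coefficient l T - coefficient l' T \<in> {0}}"
    by (rule closedin_continuous_map_preimage) simp
  moreover have "range \<pi> \<subseteq> {T \<in> topspace wot. coefficient l T - coefficient l' T \<in> {0}}"
    using eq pi_bounded by (auto simp: on_S_def fun_eq_iff)
  ultimately have "\<S> \<subseteq> {T \<in> topspace wot. coefficient l T - coefficient l' T \<in> {0}}"
    unfolding op_closure_def by (intro closure_of_minimal)
  then show ?thesis using T by auto
qed

lemma A_E:
  assumes "a \<in> A"
  obtains l where "l \<in> data" "a = on_S l"
  using assms by (auto simp: A_def)

lemma ext_on_S: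
  assumes l: "l \<in> data" and T: "T \<in> \<S>"
  shows "ext (on_S l) T = coefficient l T"
proof -
  have "\<exists>l'. l' \<in> data \<and> on_S l' = on_S l" using l by blast
  from someI_ex[OF this] show ?thesis
    unfolding ext_def by (intro coefficient_eq) (use l T in auto)
qed

section \<open>Linear structure and right translation of coefficients\<close>

lemma on_S_append: "on_S (l @ l') = (\<lambda>s. on_S l s + on_S l' s)"
  by (simp add: on_S_def fun_eq_iff)

definition scale :: "complex \<Rightarrow> (('a \<Rightarrow> complex) \<times> 'a) list \<Rightarrow> (('a \<Rightarrow> complex) \<times> 'a) list" where
  "scale c l = map (\<lambda>(f, x). (f, c \<odot> x)) l"

definition act :: "('a \<Rightarrow> 'a) \<Rightarrow> (('a \<Rightarrow> complex) \<times> 'a) list \<Rightarrow> (('a \<Rightarrow> complex) \<times> 'a) list" where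
  "act g l = map (\<lambda>(f, x). (f, g x)) l"

lemma scale_data: "l \<in> data \<Longrightarrow> scale c l \<in> data"
  by (auto simp: scale_def data_def R_submodule)

lemma act_data: "g \<in> K \<Longrightarrow> l \<in> data \<Longrightarrow> act g l \<in> data"
  using K_R R_subset by (auto simp: act_def data_def)

lemma coefficient_scale:
  assumes "l \<in> data" "T \<in> bounded_maps X X"
  shows "coefficient (scale c l) T = c * coefficient l T"
  using assms(1)
proof (induction l)
  case (Cons fx l)
  obtain f x where fx: "fx = (f, x)" by (cases fx)
  have x: "x \<in> carrier X" and f: "f \<in> dual X" using Cons.prems fx R_subset by auto
  have "f (T (c \<odot> x)) = c * f (T x)"
    using bounded_map_smult[OF assms(2) x] dual_smult[OF f bounded_map_in[OF assms(2) x]] by simp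
  then show ?case using Cons fx by (simp add: scale_def algebra_simps)
qed (simp add: scale_def)

lemma coefficient_act: "l \<in> data \<Longrightarrow> coefficient (act g l) T = coefficient l (T \<bullet> g)"
proof (induction l)
  case (Cons fx l)
  obtain f x where fx: "fx = (f, x)" by (cases fx)
  then show ?case using Cons R_subset by (auto simp: act_def comp_apply)
qed (simp add: act_def)

lemma on_S_scale: "l \<in> data \<Longrightarrow> on_S (scale c l) = (\<lambda>s. c * on_S l s)"
  using coefficient_scale pi_bounded by (simp add: on_S_def fun_eq_iff)

lemma A_add: "a \<in> A \<Longrightarrow> b \<in> A \<Longrightarrow> (\<lambda>s. a s + b s) \<in> A"
  by (auto elim!: A_E simp: A_def simp flip: on_S_append)

lemma A_scale: "a \<in> A \<Longrightarrow> (\<lambda>s. c * a s) \<in> A"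
  by (auto elim!: A_E simp: A_def scale_data simp flip: on_S_scale)

lemma ext_add: "a \<in> A \<Longrightarrow> b \<in> A \<Longrightarrow> T \<in> \<S> \<Longrightarrow> ext (\<lambda>s. a s + b s) T = ext a T + ext b T"
  by (auto elim!: A_E simp: ext_on_S simp flip: on_S_append)

lemma ext_scale: "a \<in> A \<Longrightarrow> T \<in> \<S> \<Longrightarrow> ext (\<lambda>s. c * a s) T = c * ext a T"
  by (auto elim!: A_E simp: ext_on_S scale_data coefficient_scale \<S>_bounded simp flip: on_S_scale)

text \<open>\<open>\<pi> s \<bullet> g\<close> generally lies outside \<pi>(S), so right translation
  of a function on \<open>S\<close> by an element of \<open>K\<close> has to pass through the
  extension to \<S>.\<close>

definition rt :: "('a \<Rightarrow> 'a) \<Rightarrow> ('s \<Rightarrow> complex) \<Rightarrow> 's \<Rightarrow> complex" where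
  "rt g a = (\<lambda>s. ext a (\<pi> s \<bullet> g))"

lemma rt_on_S:
  assumes "g \<in> K" "l \<in> data"
  shows "rt g (on_S l) = on_S (act g l)"
proof
  fix s
  have "\<pi> s \<bullet> g \<in> \<S>" using \<S>_closed pi_in_\<S> K_subset assms(1) by blast
  then show "rt g (on_S l) s = on_S (act g l) s"
    using assms by (simp add: rt_def ext_on_S on_S_def coefficient_act)
qed

lemma rt_in: "g \<in> K \<Longrightarrow> a \<in> A \<Longrightarrow> rt g a \<in> A"
  by (auto elim!: A_E simp: rt_on_S A_def act_data)

lemma ext_rt: "g \<in> K \<Longrightarrow> a \<in> A \<Longrightarrow> T \<in> \<S> \<Longrightarrow> ext (rt g a) T = ext a (T \<bullet> g)"
  using \<S>_closed[of T g] K_subset by (auto elim!: A_E simp: rt_on_S ext_on_S act_data coefficient_act)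

lemma rt_rt:
  assumes "g \<in> K" "k \<in> K" "a \<in> A"
  shows "rt g (rt k a) = rt (g \<bullet> k) a"
proof
  fix s
  have "\<pi> s \<bullet> g \<in> \<S>" using \<S>_closed pi_in_\<S> K_subset assms(1) by blast
  then have "rt g (rt k a) s = ext a (\<pi> s \<bullet> g \<bullet> k)" by (simp add: rt_def[of g] ext_rt assms)
  also have "\<pi> s \<bullet> g \<bullet> k = \<pi> s \<bullet> (g \<bullet> k)"
    using W.m_assoc[of "\<pi> s" g k] pi_bounded K_bounded assms by simp
  finally show "rt g (rt k a) s = rt (g \<bullet> k) a s" by (simp add: rt_def)
qed

lemma rt_p:
  assumes "a \<in> A"
  shows "rt p a = a"
proof -
  obtain l where l: "l \<in> data" "a = on_S l" using A_E[OF assms] .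
  have "act p l = l" using l(1) R_iff by (auto simp: act_def data_def intro!: map_idI)
  then show ?thesis using rt_on_S[OF K(3) l(1)] l by simp
qed

lemma rt_inv: "g \<in> K \<Longrightarrow> a \<in> A \<Longrightarrow> rt (inv\<^bsub>G\<^esub> g) (rt g a) = a" "g \<in> K \<Longrightarrow> a \<in> A \<Longrightarrow> rt g (rt (inv\<^bsub>G\<^esub> g) a) = a"
  using K_inv by (simp_all add: rt_rt rt_p)

lemma ext_almost_periodic:
  assumes "a \<in> A"
  shows "G.almost_periodic (ext a)"
proof -
  obtain l where l: "l \<in> data" "a = on_S l" using A_E[OF assms] .
  have "G.almost_periodic (\<lambda>g. \<Sum>fx\<leftarrow>l. fst fx (g (snd fx)))"
  proof (rule G.almost_periodic_sum_list)
    fix fx assume "fx \<in> set l"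
    then have "fx \<in> dual X \<times> R" using l(1) by (auto simp: data_def)
    then have "fst fx \<in> dual X" "snd fx \<in> carrier X" using R_subset by auto
    then show "G.almost_periodic (\<lambda>g. fst fx (g (snd fx)))" by (rule coefficient_almost_periodic)
  qed
  then show ?thesis
  proof (rule G.almost_periodic_cong)
    fix g assume "g \<in> carrier G"
    then have "g \<in> \<S>" using K_subset by auto
    then show "(\<Sum>fx\<leftarrow>l. fst fx (g (snd fx))) = ext a g"
      using l by (simp add: ext_on_S coefficient_def case_prod_unfold)
  qed
qed

section \<open>The invariant inner product on coefficients\<close>

definition ip0 :: "('s \<Rightarrow> complex) \<Rightarrow> ('s \<Rightarrow> complex) \<Rightarrow> complex" where
  "ip0 a b = G.mean (\<lambda>g. ext a g * cnj (ext b g))"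

sublocale MM: semi_inner_product "{f. G.almost_periodic f}" "\<lambda>f k g. f g + k g" "\<lambda>c f g. c * f g"
    "\<lambda>f k. G.mean (\<lambda>g. f g * cnj (k g))"
  by (rule G.semi_inner_product_mean)

sublocale AA: semi_inner_product A "\<lambda>a b s. a s + b s" "\<lambda>c a s. c * a s" ip0
proof
  show "A \<noteq> {}" using data_Nil unfolding A_def by blast
  fix a b :: "'s \<Rightarrow> complex" and c :: complex
  assume a: "a \<in> A" and b: "b \<in> A"
  have S: "g \<in> \<S>" if "g \<in> carrier G" for g using that K_subset by auto
  show "(\<lambda>s. a s + b s) \<in> A" "(\<lambda>s. c * a s) \<in> A" using a b by (simp_all add: A_add A_scale)
  show "ip0 (\<lambda>s. a s + b s) d = ip0 a d + ip0 b d" if d: "d \<in> A" for d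
  proof -
    have "ip0 (\<lambda>s. a s + b s) d = G.mean (\<lambda>g. (ext a g + ext b g) * cnj (ext d g))"
      unfolding ip0_def using a b S by (intro G.mean_cong) (simp add: ext_add)
    then show ?thesis
      using MM.ip_add_left[of "ext a" "ext b" "ext d"] a b d ext_almost_periodic by (simp add: ip0_def)
  qed
  show "ip0 (\<lambda>s. c * a s) b = c * ip0 a b"
  proof -
    have "ip0 (\<lambda>s. c * a s) b = G.mean (\<lambda>g. (c * ext a g) * cnj (ext b g))"
      unfolding ip0_def using a S by (intro G.mean_cong) (simp add: ext_scale)
    then show ?thesis
      using MM.ip_sm_left[of "ext a" "ext b" c] a b ext_almost_periodic by (simp add: ip0_def)
  qed
  show "ip0 b a = cnj (ip0 a b)"
    unfolding ip0_def using MM.ip_cnj[of "ext a" "ext b"] a b ext_almost_periodic by simp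
  show "0 \<le> Re (ip0 a a)"
    unfolding ip0_def using MM.ip_nonneg[of "ext a"] a ext_almost_periodic by simp
qed

lemma AA_nrm: "AA.nrm a = MM.nrm (ext a)"
  by (simp add: AA.nrm_def MM.nrm_def ip0_def)

text \<open>Invariance of the mean under the substitution of \<open>k \<bullet> g\<close> for
  \<open>k\<close> moves the translation to the other argument.\<close>

lemma rt_adjoint:
  assumes g: "g \<in> K" and a: "a \<in> A" and b: "b \<in> A"
  shows "ip0 (rt g a) b = ip0 a (rt (inv\<^bsub>G\<^esub> g) b)"
proof -
  have gi: "inv\<^bsub>G\<^esub> g \<in> K" using K_inv g by blast
  let ?F = "\<lambda>k. ext a k * cnj (ext (rt (inv\<^bsub>G\<^esub> g) b) k)"
  have "G.mean ?F = G.mean (\<lambda>k. ?F (k \<otimes>\<^bsub>G\<^esub> g))"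
    using g rt_in[OF gi b] a
    by (intro G.mean_translate_right[symmetric] G.almost_periodic_mult G.almost_periodic_cnj ext_almost_periodic) auto
  also have "\<dots> = G.mean (\<lambda>k. ext (rt g a) k * cnj (ext b k))"
  proof (rule G.mean_cong)
    fix k assume "k \<in> carrier G"
    then have k: "k \<in> K" by simp
    have "k \<bullet> g \<in> K" using K_mult k g by blast
    moreover have "(k \<bullet> g) \<bullet> inv\<^bsub>G\<^esub> g = k"
      using G.inv_solve_right'[of k "k \<bullet> g" g] G.m_assoc[of k g "inv\<^bsub>G\<^esub> g"] G.r_one[of k] K_inv[OF g] k g by simp
    ultimately show "?F (k \<otimes>\<^bsub>G\<^esub> g) = ext (rt g a) k * cnj (ext b k)"
      using k g gi a b K_subset by (simp add: ext_rt subset_iff)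
  qed
  finally show ?thesis by (simp add: ip0_def)
qed

text \<open>\<open>lift\<close> extends the inverse of its argument, so the inverse of
  \<open>h s\<close> has to be inserted for \<open>U s\<close> to extend the right translation by
  \<open>h s\<close>.\<close>

definition U :: "'s \<Rightarrow> (('s \<Rightarrow> complex) \<Rightarrow> complex) \<Rightarrow> ('s \<Rightarrow> complex) \<Rightarrow> complex" where
  "U s = AA.lift (rt (inv\<^bsub>G\<^esub> (h s)))"

lemma hi_in: "inv\<^bsub>G\<^esub> (h s) \<in> K"
  using K_inv h_in by blast

lemma inv_inv_K: "g \<in> K \<Longrightarrow> inv\<^bsub>G\<^esub> (inv\<^bsub>G\<^esub> g) = g"
  using G.inv_inv by simp

lemma U_bounded: "U s \<in> bounded_maps AA.completion AA.completion"
  and hip_U: "\<phi> \<in> carrier AA.completion \<Longrightarrow> \<psi> \<in> carrier AA.completion \<Longrightarrow> AA.hip (U s \<phi>) (U s \<psi>) = AA.hip \<phi> \<psi>"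
  and U_emb: "b \<in> A \<Longrightarrow> U s (AA.emb b) = AA.emb (rt (h s) b)"
  unfolding U_def
  by (rule AA.lift_bounded[where r' = "rt (h s)"] AA.hip_lift[where r' = "rt (h s)"] AA.lift_emb;
      simp add: rt_in rt_inv rt_adjoint h_in hi_in)+

lemma U_in: "\<phi> \<in> carrier AA.completion \<Longrightarrow> U s \<phi> \<in> carrier AA.completion"
  using AA.NC.bounded_map_in[OF U_bounded] .

lemma U_inverse:
  assumes \<phi>: "\<phi> \<in> carrier AA.completion"
  shows "\<exists>\<psi>\<in>carrier AA.completion. U s \<psi> = \<phi>"
proof -
  let ?L = "AA.lift (rt (h s))"
  have L: "?L \<phi> \<in> carrier AA.completion"
    by (rule AA.lift_in[where r' = "rt (inv\<^bsub>G\<^esub> (h s))"])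
      (simp_all add: rt_in rt_inv rt_adjoint h_in hi_in inv_inv_K \<phi>)
  have "U s (?L \<phi>) = AA.lift (\<lambda>a. a) \<phi>"
    unfolding U_def by (rule AA.lift_compose) (simp_all add: rt_in rt_inv h_in hi_in \<phi> L)
  also have "\<dots> = \<phi>" by (rule AA.lift_ident[OF _ \<phi>]) simp
  finally show ?thesis using L by blast
qed

lemma U_mult:
  assumes \<phi>: "\<phi> \<in> carrier AA.completion"
  shows "U (s * t) \<phi> = U s (U t \<phi>)"
proof -
  have "inv\<^bsub>G\<^esub> (h t) \<bullet> inv\<^bsub>G\<^esub> (h s) = inv\<^bsub>G\<^esub> (h (s * t))"
    using G.inv_mult_group[of "h s" "h t"] h_in by (simp add: h_mult)
  then show ?thesis
    using U_in[OF \<phi>, of t] unfolding U_def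
    by (intro AA.lift_compose[symmetric]) (simp_all add: rt_rt rt_in hi_in \<phi>)
qed

lemma U_one:
  assumes e: "\<And>s. e * s = s \<and> s * e = s" and \<phi>: "\<phi> \<in> carrier AA.completion"
  shows "U e \<phi> = \<phi>"
proof -
  have "\<pi> e = restrict id (carrier X)" using identity_fixes e by blast
  then have "h e x = p x" if "x \<in> carrier X" for x using that by (simp add: h_def comp_apply)
  then have "h e = p" by (rule bounded_map_ext[OF K_bounded[OF h_in] K_bounded[OF K(3)]])
  then have "inv\<^bsub>G\<^esub> (h e) = p" using G.inv_one by simp
  then show ?thesis unfolding U_def by (intro AA.lift_ident[OF _ \<phi>]) (simp add: rt_p)
qed

section \<open>Functionals on the completion\<close>

definition pull :: "((('s \<Rightarrow> complex) \<Rightarrow> complex) \<Rightarrow> complex) \<Rightarrow> ('a \<Rightarrow> complex) \<Rightarrow> 'a \<Rightarrow> complex" where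
  "pull F f x = F (AA.emb (on_S [(f, x)]))"

text \<open>On all of \<open>K\<close> the integrand is at most the square of
  \<open>B * bnd * vnorm X x\<close>, hence so is its mean.\<close>

lemma nrm_single:
  assumes f: "f \<in> dual X" and B: "B > 0" "\<And>x. x \<in> carrier X \<Longrightarrow> cmod (f x) \<le> B * vnorm X x" and x: "x \<in> R"
  shows "AA.nrm (on_S [(f, x)]) \<le> B * bnd * vnorm X x"
proof (rule power2_le_imp_le)
  have xX: "x \<in> carrier X" using x R_subset by blast
  have a: "on_S [(f, x)] \<in> A" using f x by (auto simp: A_def)
  have "Re (ip0 (on_S [(f, x)]) (on_S [(f, x)])) \<le> (B * bnd * vnorm X x)\<^sup>2"
    unfolding ip0_def
  proof (rule G.mean_Re_le)
    show "G.almost_periodic (\<lambda>g. ext (on_S [(f, x)]) g * cnj (ext (on_S [(f, x)]) g))"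
      using a by (intro G.almost_periodic_mult G.almost_periodic_cnj ext_almost_periodic)
    fix g assume "g \<in> carrier G"
    then have g: "g \<in> K" by simp
    have "cmod (f (g x)) \<le> B * (bnd * vnorm X x)"
      using B(2)[OF K_in[OF g xX]] mult_left_mono[OF bnd(2)[OF g xX], of B] B(1) by linarith
    then have "(cmod (f (g x)))\<^sup>2 \<le> (B * bnd * vnorm X x)\<^sup>2"
      by (intro power_mono) (simp_all add: mult.assoc)
    moreover have "ext (on_S [(f, x)]) g = f (g x)" using f x g K_subset by (subst ext_on_S) auto
    ultimately show "Re (ext (on_S [(f, x)]) g * cnj (ext (on_S [(f, x)]) g)) \<le> (B * bnd * vnorm X x)\<^sup>2"
      by (simp add: complex_norm_square[symmetric] flip: of_real_power)
  qed
  then show "(AA.nrm (on_S [(f, x)]))\<^sup>2 \<le> (B * bnd * vnorm X x)\<^sup>2" using AA.nrm_sq[OF a] by simp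
  show "0 \<le> B * bnd * vnorm X x" using B bnd(1) xX by simp
qed

lemma pull_linear:
  assumes F: "F \<in> dual AA.completion" and f: "f \<in> dual X"
  shows "\<And>x y. x \<in> R \<Longrightarrow> y \<in> R \<Longrightarrow> pull F f (x \<oplus> y) = pull F f x + pull F f y"
    and "\<And>c x. x \<in> R \<Longrightarrow> pull F f (c \<odot> x) = c * pull F f x"
    and "\<exists>B\<ge>0. \<forall>x\<in>R. cmod (pull F f x) \<le> B * vnorm X x"
proof -
  have in_A: "on_S [(f, x)] \<in> A" if "x \<in> R" for x using f that by (auto simp: A_def)
  have f_pi: "f (\<pi> s (x \<oplus> y)) = f (\<pi> s x) + f (\<pi> s y)" "f (\<pi> s (c \<odot> x)) = c * f (\<pi> s x)"
    if "x \<in> R" "y \<in> R" for x y s c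
    using that R_subset bounded_map_in[OF pi_bounded] f
    by (auto simp: pi_add pi_smult dual_add dual_smult subset_iff)
  show "pull F f (x \<oplus> y) = pull F f x + pull F f y" if xy: "x \<in> R" "y \<in> R" for x y
  proof -
    have "on_S [(f, x \<oplus> y)] = (\<lambda>s. on_S [(f, x)] s + on_S [(f, y)] s)"
      using f_pi xy by (simp add: on_S_def fun_eq_iff)
    then show ?thesis
      using AA.emb_add[OF in_A[OF xy(1)] in_A[OF xy(2)]] AA.emb_in in_A xy
      by (simp add: pull_def AA.NC.dual_add[OF F] del: AA.completion_simps)
  qed
  show "pull F f (c \<odot> x) = c * pull F f x" if x: "x \<in> R" for x c
  proof -
    have "on_S [(f, c \<odot> x)] = (\<lambda>s. c * on_S [(f, x)] s)"
      using f_pi x by (simp add: on_S_def fun_eq_iff)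
    then show ?thesis
      using AA.emb_sm[OF in_A[OF x]] AA.emb_in in_A x
      by (simp add: pull_def AA.NC.dual_smult[OF F] del: AA.completion_simps)
  qed
  obtain B where B: "B > 0" "\<And>x. x \<in> carrier X \<Longrightarrow> cmod (f x) \<le> B * vnorm X x" using dual_bound[OF f] by blast
  obtain C where C: "C > 0" "\<And>\<phi>. \<phi> \<in> carrier AA.completion \<Longrightarrow> cmod (F \<phi>) \<le> C * vnorm AA.completion \<phi>"
    using AA.NC.dual_bound[OF F] by blast
  have "cmod (pull F f x) \<le> (C * (B * bnd)) * vnorm X x" if x: "x \<in> R" for x
  proof -
    have "cmod (pull F f x) \<le> C * AA.nrm (on_S [(f, x)])"
      unfolding pull_def using C(2)[OF AA.emb_in[OF in_A[OF x]]] AA.vnorm_emb[OF in_A[OF x]] by simp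
    also have "\<dots> \<le> C * (B * bnd * vnorm X x)" using nrm_single[OF f B x] C(1) by (intro mult_left_mono) auto
    finally show ?thesis by (simp add: mult.assoc)
  qed
  moreover have "C * (B * bnd) \<ge> 0" using B C bnd(1) by simp
  ultimately show "\<exists>B\<ge>0. \<forall>x\<in>R. cmod (pull F f x) \<le> B * vnorm X x" by blast
qed

lemma dual_completion_on_S:
  assumes F: "F \<in> dual AA.completion" and l: "l \<in> data"
  shows "F (AA.emb (on_S l)) = (\<Sum>(f, x)\<leftarrow>l. pull F f x)"
  using l
proof (induction l)
  case Nil
  have 0: "on_S [] \<in> A" by (auto simp: A_def)
  have "on_S [] = (\<lambda>s. 0 * on_S [] s)" by (simp add: on_S_def fun_eq_iff)
  then have "F (AA.emb (on_S [])) = 0 * F (AA.emb (on_S []))"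
    using AA.emb_sm[OF 0, of 0] AA.NC.dual_smult[OF F AA.emb_in[OF 0], of 0] by metis
  then show ?case by simp
next
  case (Cons fx l)
  obtain f x where fx: "fx = (f, x)" by (cases fx)
  have A: "on_S [(f, x)] \<in> A" "on_S l \<in> A" using Cons.prems fx unfolding A_def by auto
  have "on_S (fx # l) = (\<lambda>s. on_S [(f, x)] s + on_S l s)" by (simp add: on_S_def fx fun_eq_iff)
  then have "F (AA.emb (on_S (fx # l))) = F (AA.emb (on_S [(f, x)])) + F (AA.emb (on_S l))"
    using AA.emb_add[OF A] AA.NC.dual_add[OF F AA.emb_in[OF A(1)] AA.emb_in[OF A(2)]] by metis
  then show ?case using Cons fx by (simp add: pull_def)
qed

text \<open>Translation by \<open>h s\<close> replaces each vector \<open>x\<close> in the list by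
  \<open>\<pi> s x\<close>. On embedded vectors the coefficients of \<open>U\<close> are thus finite
  sums of coefficients of \<open>\<pi>\<^sub>r\<close>, without any error.\<close>

lemma dual_U_on_S:
  assumes F: "F \<in> dual AA.completion" and l: "l \<in> data"
  shows "F (U s (AA.emb (on_S l))) = (\<Sum>(f, x)\<leftarrow>l. pull F f (\<pi> s x))"
proof -
  have "on_S l \<in> A" using l by (auto simp: A_def)
  then have "U s (AA.emb (on_S l)) = AA.emb (on_S (act (h s) l))"
    using rt_on_S[OF h_in l] by (simp add: U_emb)
  also have "act (h s) l = act (\<pi> s) l"
    unfolding act_def using l h_apply by (intro map_cong) (auto simp: data_def)
  finally have "F (U s (AA.emb (on_S l))) = (\<Sum>(f, x)\<leftarrow>act (\<pi> s) l. pull F f x)"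
    using dual_completion_on_S[OF F act_data[OF h_in l, of s]] \<open>act (h s) l = act (\<pi> s) l\<close> by simp
  also have "\<dots> = (\<Sum>(f, x)\<leftarrow>l. pull F f (\<pi> s x))"
    by (simp add: act_def comp_def case_prod_unfold)
  finally show ?thesis .
qed

text \<open>Embedded vectors are dense, and since each \<open>U s\<close> is an isometry the
  approximation error is the same for all \<open>s\<close>.\<close>

lemma dual_U_approx:
  assumes F: "F \<in> dual AA.completion" and \<phi>: "\<phi> \<in> carrier AA.completion" and \<epsilon>: "\<epsilon> > 0"
  obtains l where "l \<in> data" "\<And>s. cmod (F (U s \<phi>) - (\<Sum>(f, x)\<leftarrow>l. pull F f (\<pi> s x))) < \<epsilon>"
proof -
  obtain C where C: "C > 0" "\<And>\<phi>. \<phi> \<in> carrier AA.completion \<Longrightarrow> cmod (F \<phi>) \<le> C * vnorm AA.completion \<phi>"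
    using AA.NC.dual_bound[OF F] by blast
  have "\<epsilon> / C > 0" using \<epsilon> C by simp
  then obtain b where b: "b \<in> A" "vnorm AA.completion (\<phi> \<ominus>\<^bsub>AA.completion\<^esub> AA.emb b) < \<epsilon> / C"
    using AA.emb_dense[OF \<phi>] by blast
  obtain l where l: "l \<in> data" "b = on_S l" using A_E[OF b(1)] .
  have "cmod (F (U s \<phi>) - F (U s (AA.emb b))) < \<epsilon>" for s
  proof -
    let ?d = "\<phi> \<ominus>\<^bsub>AA.completion\<^esub> AA.emb b"
    have eb: "AA.emb b \<in> carrier AA.completion" using AA.emb_in b by blast
    have d: "?d \<in> carrier AA.completion" using \<phi> eb by (rule AA.NC.diff_in)
    have "F (U s \<phi>) - F (U s (AA.emb b)) = F (U s \<phi> \<ominus>\<^bsub>AA.completion\<^esub> U s (AA.emb b))"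
      using AA.NC.dual_diff[OF F U_in[OF \<phi>] U_in[OF eb]] by simp
    also have "U s \<phi> \<ominus>\<^bsub>AA.completion\<^esub> U s (AA.emb b) = U s ?d"
      using AA.NC.bounded_map_diff[OF U_bounded \<phi> eb] by simp
    finally have "cmod (F (U s \<phi>) - F (U s (AA.emb b))) \<le> C * vnorm AA.completion (U s ?d)"
      using C(2)[OF U_in[OF d]] by simp
    also have "vnorm AA.completion (U s ?d) = vnorm AA.completion ?d" using hip_U[OF d d] by simp
    also have "C * \<dots> < C * (\<epsilon> / C)" using b C by (intro mult_strict_left_mono) auto
    also have "\<dots> = \<epsilon>" using C by simp
    finally show ?thesis .
  qed
  then show ?thesis using that[OF l(1)] dual_U_on_S[OF F l(1)] l(2) by simp
qed

lemma continuous_U: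
  assumes F: "F \<in> dual AA.completion" and \<phi>: "\<phi> \<in> carrier AA.completion"
  shows "continuous_on UNIV (\<lambda>s. F (U s \<phi>))"
proof -
  have "\<exists>l. l \<in> data \<and> (\<forall>s. cmod (F (U s \<phi>) - (\<Sum>(f, x)\<leftarrow>l. pull F f (\<pi> s x))) < inverse (real (Suc n)))" for n
    using dual_U_approx[OF F \<phi>, of "inverse (real (Suc n))"]
    by (metis inverse_positive_iff_positive of_nat_0_less_iff zero_less_Suc)
  then obtain l where l: "\<And>n. l n \<in> data"
    "\<And>n s. cmod (F (U s \<phi>) - (\<Sum>(f, x)\<leftarrow>l n. pull F f (\<pi> s x))) < inverse (real (Suc n))" by metis
  have lim: "uniform_limit UNIV (\<lambda>n s. \<Sum>(f, x)\<leftarrow>l n. pull F f (\<pi> s x)) (\<lambda>s. F (U s \<phi>)) sequentially"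
  proof (rule uniform_limitI)
    fix e :: real assume "e > 0"
    then obtain N where N: "inverse (real (Suc N)) < e" using reals_Archimedean by blast
    have "dist (\<Sum>(f, x)\<leftarrow>l n. pull F f (\<pi> s x)) (F (U s \<phi>)) < e" if "n \<ge> N" for n s
    proof -
      have "inverse (real (Suc n)) \<le> inverse (real (Suc N))" using that by (simp add: field_simps)
      then have "cmod (F (U s \<phi>) - (\<Sum>(f, x)\<leftarrow>l n. pull F f (\<pi> s x))) < e"
        using l(2)[of s n] N by linarith
      then show ?thesis by (simp add: dist_norm norm_minus_commute)
    qed
    then show "\<forall>\<^sub>F n in sequentially. \<forall>s\<in>UNIV. dist (\<Sum>(f, x)\<leftarrow>l n. pull F f (\<pi> s x)) (F (U s \<phi>)) < e"
      unfolding eventually_sequentially by blast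
  qed
  have cont: "continuous_on UNIV (\<lambda>s. \<Sum>(f, x)\<leftarrow>l'. pull F f (\<pi> s x))" if "l' \<in> data" for l'
    using that
  proof (induction l')
    case (Cons fx l')
    obtain f x where fx: "fx = (f, x)" by (cases fx)
    have f: "f \<in> dual X" and x: "x \<in> R" using Cons.prems fx by auto
    obtain B where B: "B \<ge> 0" "\<forall>x\<in>R. cmod (pull F f x) \<le> B * vnorm X x" using pull_linear(3)[OF F f] by blast
    \<comment> \<open>Weak continuity of \<pi> is tested by functionals on the whole space, so the
      functional on \<open>R\<close> is extended through \<open>p\<close>.\<close>
    have "(\<lambda>x\<in>carrier X. pull F f (p x)) \<in> dual X"
      by (rule dual_extend[where B = B]) (use pull_linear[OF F f] B in auto)
    from pi_continuous[OF _ this, of x]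
    have "continuous_on UNIV (\<lambda>s. (\<lambda>x\<in>carrier X. pull F f (p x)) (\<pi> s x))"
      using x R_subset by blast
    moreover have "(\<lambda>x\<in>carrier X. pull F f (p x)) (\<pi> s x) = pull F f (\<pi> s x)" for s
      using pi_R[OF x, of s] R_iff by simp
    ultimately have "continuous_on UNIV (\<lambda>s. pull F f (\<pi> s x))" by simp
    then show ?case using Cons fx by (simp add: continuous_on_add)
  qed simp
  show ?thesis
    by (rule uniform_limit_theorem[OF always_eventually lim sequentially_bot]) (use cont l(1) in blast)
qed

lemma unitary_U: "unitary_representation AA.completion AA.hip U"
  unfolding unitary_representation_def
proof (intro conjI allI ballI)
  show "complex_hilbert_space AA.completion AA.hip" by (rule AA.hilbert_completion)
  show "U s ` carrier AA.completion = carrier AA.completion" for s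
    using U_in U_inverse by (auto simp: image_iff) metis
  show "AA.hip (U s \<phi>) (U s \<psi>) = AA.hip \<phi> \<psi>"
    if "\<phi> \<in> carrier AA.completion" "\<psi> \<in> carrier AA.completion" for s \<phi> \<psi>
    using hip_U that by blast
  have U_ext: "U s \<in> extensional (carrier AA.completion)" for s by (simp add: U_def AA.lift_def)
  show "representation AA.completion U"
    unfolding representation_def
  proof (intro conjI allI impI)
    show "U s \<in> bounded_maps AA.completion AA.completion" for s by (rule U_bounded)
    show "U (s * t) = compose (carrier AA.completion) (U s) (U t)" for s t
      by (rule extensionalityI[OF U_ext compose_extensional]) (simp add: compose_eq U_mult)
    show "U e = restrict id (carrier AA.completion)" if "\<forall>s. e * s = s \<and> s * e = s" for e
      by (rule extensionalityI[OF U_ext restrict_extensional]) (use that in \<open>simp add: U_one\<close>)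
    show "continuous_map euclidean (weak_operator_topology AA.completion) U"
      unfolding AA.NC.continuous_map_wot_iff using U_bounded continuous_U by auto
  qed
qed

text \<open>Strict pointwise bounds by \<epsilon> would allow the supremum to equal \<epsilon>; the
  margin \<epsilon> / 2 keeps it strictly below.\<close>

lemma SUP_less:
  fixes f :: "'s \<Rightarrow> real"
  assumes "\<And>s. f s \<le> \<epsilon> / 2" "\<epsilon> > 0"
  shows "bdd_above (range f) \<and> (SUP s. f s) < \<epsilon>"
proof
  show "bdd_above (range f)" using assms(1) by (intro bdd_aboveI2)
  have "(SUP s. f s) \<le> \<epsilon> / 2" using assms(1) by (intro cSUP_least) auto
  then show "(SUP s. f s) < \<epsilon>" using assms(2) by linarith
qed

section \<open>Weak containment in both directions\<close>

lemma reversible_simps: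
  "carrier (reversible_space X \<pi>) = R" "add (reversible_space X \<pi>) = add X"
  "smult (reversible_space X \<pi>) = smult X" "vnorm (reversible_space X \<pi>) = vnorm X"
  "x \<in> R \<Longrightarrow> reversible_rep X \<pi> s x = \<pi> s x"
  by (simp_all add: reversible_space_def reversible_rep_def R_def)

lemma U_contained: "weakly_contained AA.completion U (reversible_space X \<pi>) (reversible_rep X \<pi>)"
  unfolding weakly_contained_def
proof (intro ballI allI impI)
  fix \<phi> F and \<epsilon> :: real assume \<phi>: "\<phi> \<in> carrier AA.completion" and F: "F \<in> dual AA.completion" and \<epsilon>: "\<epsilon> > 0"
  obtain l where l: "l \<in> data" "\<And>s. cmod (F (U s \<phi>) - (\<Sum>(f, x)\<leftarrow>l. pull F f (\<pi> s x))) < \<epsilon> / 2"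
    using dual_U_approx[OF F \<phi>, of "\<epsilon> / 2"] \<epsilon> by auto
  define \<eta> where "\<eta> j = snd (l ! j)" for j
  define k where "k j = restrict (pull F (fst (l ! j))) R" for j
  have lj: "fst (l ! j) \<in> dual X" "\<eta> j \<in> R" if "j < length l" for j
    unfolding \<eta>_def using l(1) nth_mem[OF that] by (cases "l ! j"; auto simp: data_def)+
  have kd: "k j \<in> dual (reversible_space X \<pi>)" if j: "j < length l" for j
  proof -
    obtain B where "B \<ge> 0" "\<forall>x\<in>R. cmod (pull F (fst (l ! j)) x) \<le> B * vnorm X x"
      using pull_linear(3)[OF F lj(1)[OF j]] by blast
    then show ?thesis
      unfolding dual_iff reversible_simps
      using pull_linear(1,2)[OF F lj(1)[OF j]] R_submodule by (auto simp: k_def)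
  qed
  have "(\<Sum>j<length l. k j (reversible_rep X \<pi> s (\<eta> j))) = (\<Sum>(f, x)\<leftarrow>l. pull F f (\<pi> s x))" for s
  proof -
    have "(\<Sum>j<length l. k j (reversible_rep X \<pi> s (\<eta> j))) = (\<Sum>j<length l. pull F (fst (l ! j)) (\<pi> s (snd (l ! j))))"
      using lj pi_R by (intro sum.cong) (auto simp: reversible_simps k_def \<eta>_def)
    then show ?thesis by (simp add: sum_list_sum_nth case_prod_beta atLeast0LessThan)
  qed
  then have "cmod (F (U s \<phi>) - (\<Sum>j<length l. k j (reversible_rep X \<pi> s (\<eta> j)))) \<le> \<epsilon> / 2" for s
    using l(2)[of s] by simp
  then show "\<exists>(k::nat) \<eta> h. (\<forall>j<k. \<eta> j \<in> carrier (reversible_space X \<pi>) \<and> h j \<in> dual (reversible_space X \<pi>)) \<and>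
      bdd_above (range (\<lambda>s. cmod (F (U s \<phi>) - (\<Sum>j<k. h j (reversible_rep X \<pi> s (\<eta> j)))))) \<and>
      (SUP s. cmod (F (U s \<phi>) - (\<Sum>j<k. h j (reversible_rep X \<pi> s (\<eta> j))))) < \<epsilon>"
    using lj kd SUP_less[OF _ \<epsilon>, of "\<lambda>s. cmod (F (U s \<phi>) - (\<Sum>j<length l. k j (reversible_rep X \<pi> s (\<eta> j))))"]
    by (intro exI[of _ "length l"] exI[of _ \<eta>] exI[of _ k]) (simp add: reversible_simps)
qed

text \<open>The coefficient of \<open>f\<close> and \<open>x\<close> is itself a vector
  \<open>a\<close> of the Hilbert space. Integration against an approximate identity for
  \<open>ext a\<close> is a bounded functional, and at the right translate of \<open>a\<close> by
  \<open>h s\<close> it nearly returns the value of \<open>ext a\<close> at \<open>h s\<close>. A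
  single coefficient of \<open>U\<close> therefore suffices.\<close>

lemma contained_U: "weakly_contained (reversible_space X \<pi>) (reversible_rep X \<pi>) AA.completion U"
  unfolding weakly_contained_def
proof (intro ballI allI impI)
  fix x f and \<epsilon> :: real
  assume "x \<in> carrier (reversible_space X \<pi>)" and f: "f \<in> dual (reversible_space X \<pi>)" and \<epsilon>: "\<epsilon> > 0"
  then have x: "x \<in> R" by (simp add: reversible_simps)
  have f': "\<And>x y. x \<in> R \<Longrightarrow> y \<in> R \<Longrightarrow> f (x \<oplus> y) = f x + f y" "\<And>c x. x \<in> R \<Longrightarrow> f (c \<odot> x) = c * f x"
    and "\<exists>C. \<forall>x\<in>R. cmod (f x) \<le> C * vnorm X x"
    using f unfolding dual_iff reversible_simps by auto
  then obtain C where C: "\<And>x. x \<in> R \<Longrightarrow> cmod (f x) \<le> C * vnorm X x" by blast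
  \<comment> \<open>The vectors of \<open>A\<close> come from functionals on the whole space, so
    \<open>f\<close> is first extended from \<open>R\<close> through \<open>p\<close>.\<close>
  define f2 where "f2 = (\<lambda>x\<in>carrier X. f (p x))"
  have f2: "f2 \<in> dual X"
    unfolding f2_def
  proof (rule dual_extend[where B = "\<bar>C\<bar>"])
    show "cmod (f x) \<le> \<bar>C\<bar> * vnorm X x" if "x \<in> R" for x
      using C[OF that] mult_right_mono[OF abs_ge_self[of C], of "vnorm X x"] that R_subset by fastforce
  qed (use f' in auto)
  have f2_R: "f2 y = f y" if "y \<in> R" for y using that R_iff by (simp add: f2_def)
  define a where "a = on_S [(f2, x)]"
  have a: "a \<in> A" using f2 x by (auto simp: a_def A_def)
  have ext_a: "ext a T = f2 (T x)" if "T \<in> \<S>" for T unfolding a_def using f2 x that by (simp add: ext_on_S)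
  have "\<epsilon> / 2 > 0" using \<epsilon> by simp
  then obtain \<beta> where \<beta>: "G.almost_periodic \<beta>"
    "\<And>k. k \<in> carrier G \<Longrightarrow> cmod (G.mean (\<lambda>g. ext a (g \<otimes>\<^bsub>G\<^esub> k) * \<beta> g) - ext a k) \<le> \<epsilon> / 2"
    by (rule G.approximate_identity[OF ext_almost_periodic[OF a]]) blast
  define lb where "lb b = G.mean (\<lambda>g. ext b g * \<beta> g)" for b
  have S: "g \<in> \<S>" if "g \<in> carrier G" for g using that K_subset by auto
  have \<beta>': "G.almost_periodic (\<lambda>g. cnj (\<beta> g))" using \<beta>(1) by (rule G.almost_periodic_cnj)
  \<comment> \<open>The double conjugation writes \<open>lb b\<close> as the inner product of
    \<open>ext b\<close> with the conjugate of \<beta>, so that linearity and Cauchy--Schwarz are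
    available.\<close>
  have lb_eq: "lb b = G.mean (\<lambda>g. ext b g * cnj (cnj (\<beta> g)))" for b by (simp add: lb_def)
  obtain k where k: "k \<in> dual AA.completion" "\<And>b. b \<in> A \<Longrightarrow> k (AA.emb b) = lb b"
  proof (rule AA.extend_functional[where l = lb and C = "MM.nrm (\<lambda>g. cnj (\<beta> g))"])
    fix b d :: "'s \<Rightarrow> complex" and c :: complex assume b: "b \<in> A"
    have bap: "G.almost_periodic (ext b)" using b by (rule ext_almost_periodic)
    show "lb (\<lambda>s. b s + d s) = lb b + lb d" if d: "d \<in> A"
    proof -
      have "lb (\<lambda>s. b s + d s) = G.mean (\<lambda>g. (ext b g + ext d g) * cnj (cnj (\<beta> g)))"
        unfolding lb_eq using b d S by (intro G.mean_cong) (simp add: ext_add)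
      then show ?thesis
        using MM.ip_add_left[of "ext b" "ext d" "\<lambda>g. cnj (\<beta> g)"] bap ext_almost_periodic[OF d] \<beta>'
        by (simp add: lb_def)
    qed
    show "lb (\<lambda>s. c * b s) = c * lb b"
    proof -
      have "lb (\<lambda>s. c * b s) = G.mean (\<lambda>g. (c * ext b g) * cnj (cnj (\<beta> g)))"
        unfolding lb_eq using b S by (intro G.mean_cong) (simp add: ext_scale)
      then show ?thesis
        using MM.ip_sm_left[of "ext b" "\<lambda>g. cnj (\<beta> g)" c] bap \<beta>' by (simp add: lb_def)
    qed
    show "cmod (lb b) \<le> MM.nrm (\<lambda>g. cnj (\<beta> g)) * AA.nrm b"
      using MM.cauchy_schwarz[of "ext b" "\<lambda>g. cnj (\<beta> g)"] bap \<beta>' by (simp add: lb_eq AA_nrm mult.commute)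
  qed (use MM.nrm_nonneg[of "\<lambda>g. cnj (\<beta> g)"] \<beta>' in auto)
  have "cmod (f (reversible_rep X \<pi> s x) - k (U s (AA.emb a))) \<le> \<epsilon> / 2" for s
  proof -
    have "k (U s (AA.emb a)) = G.mean (\<lambda>g. ext (rt (h s) a) g * \<beta> g)"
      using U_emb[OF a] k(2) rt_in[OF h_in a] by (simp add: lb_def)
    also have "\<dots> = G.mean (\<lambda>g. ext a (g \<otimes>\<^bsub>G\<^esub> h s) * \<beta> g)"
      using S by (intro G.mean_cong) (simp add: ext_rt h_in a)
    finally have "cmod (k (U s (AA.emb a)) - ext a (h s)) \<le> \<epsilon> / 2" using \<beta>(2)[of "h s"] h_in by simp
    moreover have "ext a (h s) = f (reversible_rep X \<pi> s x)"
      using ext_a[of "h s"] h_in K_subset h_apply[OF x] pi_R[OF x] x by (auto simp: f2_R reversible_simps)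
    ultimately show ?thesis by (simp add: norm_minus_commute)
  qed
  then show "\<exists>(k::nat) \<eta> h. (\<forall>j<k. \<eta> j \<in> carrier AA.completion \<and> h j \<in> dual AA.completion) \<and>
      bdd_above (range (\<lambda>s. cmod (f (reversible_rep X \<pi> s x) - (\<Sum>j<k. h j (U s (\<eta> j)))))) \<and>
      (SUP s. cmod (f (reversible_rep X \<pi> s x) - (\<Sum>j<k. h j (U s (\<eta> j))))) < \<epsilon>"
    using k(1) AA.emb_in[OF a] SUP_less[OF _ \<epsilon>, of "\<lambda>s. cmod (f (reversible_rep X \<pi> s x) - k (U s (AA.emb a)))"]
    by (intro exI[of _ "1::nat"] exI[of _ "\<lambda>_. AA.emb a"] exI[of _ "\<lambda>_. k"]) simp
qed

lemma weakly_equivalent_U: "weakly_equivalent (reversible_space X \<pi>) (reversible_rep X \<pi>) AA.completion U"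
  unfolding weakly_equivalent_def using U_contained contained_U by blast

end

theorem theorem3p6:
  fixes E :: "'a normed_module"
    and \<pi> :: "'s::semitopological_semigroup \<Rightarrow> 'a \<Rightarrow> 'a"
  assumes "complex_banach_space E"
    and "JdLG_admissible E \<pi>"
  shows "(\<exists>(H :: (('s \<Rightarrow> complex) \<Rightarrow> complex) normed_module) ip U.
            unitary_representation H ip U \<and>
            weakly_equivalent (reversible_space E \<pi>) (reversible_rep E \<pi>) H U) \<and>
         ((\<exists>ip\<^sub>E. complex_hilbert_space E ip\<^sub>E) \<longrightarrow>
           (\<exists>(H :: 'a normed_module) ip U.
              unitary_representation H ip U \<and>
              equivalent_rep (reversible_space E \<pi>) (reversible_rep E \<pi>) H U))"
proof -
  interpret J: jdlg_representation E \<pi>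
    using assms by (intro jdlg_representation.intro jdlg_representation_axioms.intro)
  show ?thesis
  proof (intro conjI impI)
    show "\<exists>(H :: (('s \<Rightarrow> complex) \<Rightarrow> complex) normed_module) ip U. unitary_representation H ip U \<and>
        weakly_equivalent (reversible_space E \<pi>) (reversible_rep E \<pi>) H U"
      by (intro exI conjI) (rule J.unitary_U J.weakly_equivalent_U)+
    assume "\<exists>ip\<^sub>E. complex_hilbert_space E ip\<^sub>E"
    then obtain ip\<^sub>E where "complex_hilbert_space E ip\<^sub>E" ..
    then show "\<exists>(H :: 'a normed_module) ip U. unitary_representation H ip U \<and>
        equivalent_rep (reversible_space E \<pi>) (reversible_rep E \<pi>) H U"
      by (rule J.hilbert_case)
  qed
qed

end
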